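(* Let $d\ge2$, $t\ge2$, let $X=\{x_1,\ldots,x_N\}\subset\mathbb S^{d-1}$ be a node-transitive spherical $t$-design and let $P_X$ be its Steiner-normalized Minkowski polytope. Then $$h_{P_X}(x_1)=\cdots=h_{P_X}(x_N)=:h.$$ If $C=\operatorname{conv}X$, then $$P_X=hC^\circ,\qquad P_X^\circ=h^{-1}C.$$ Consequently, $P_X$ is self-polar up to scale and orthogonal transformation if and only if $C$ is.
   Context: $\sigma$ is the normalized (probability) surface measure on the unit sphere $\mathbb S^{d-1}\subset\mathbb R^d$, and $\omega_{d-1}$ is the total $(d-1)$-area of $\mathbb S^{d-1}$. A finite set $X=\{x_1,\ldots,x_N\}\subset\mathbb S^{d-1}$ of $N$ distinct points is a spherical $t$-design if $\frac1N\sum_i p(x_i)=\int p\,d\sigma$ for every polynomial $p$ of total degree at most $t$. It is node-transitive if some subgroup $G\le O(d)$ preserves $X$ and acts transitively on it. For $t\ge2$, the Minkowski polytope $P_X\subset\mathbb R^d$ is the full-dimensional convex polytope, unique up to translation (Minkowski's theorem), whose surface area measure is $\frac{\omega_{d-1}}N\sum_i\delta_{x_i}$: it has exactly $N$ facets, with outer unit normals $x_1,\ldots,x_N$, each of $(d-1)$-area $\omega_{d-1}/N$. It is Steiner-normalized: the translate is chosen so that the Steiner point $d\int_{\mathbb S^{d-1}}h_{P_X}(u)u\,d\sigma(u)$ is $0$, which implies $0\in\operatorname{int}P_X$. Here $h_P(u)=\max_{y\in P}\langle u,y\rangle$ is the support function and $P^\circ=\{z:\langle z,y\rangle\le1\ \forall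 y\in P\}$ is the polar. A convex body $P$ with $0$ in its interior is self-polar up to scale and orthogonal transformation if $P^\circ=cUP$ for some $c>0$, $U\in O(d)$. *)

theory Defs
  imports "HOL-Analysis.Analysis" "HOL-Algebra.Group"
begin

text \<open>
  Surface measure on the unit sphere in polar-coordinate form: the area of a Borel set
  \<open>A\<close> of directions is \<open>d\<close> times the volume of the cone \<open>{r u | 0 < r < 1, u \<in> A}\<close>.
  It is a Borel measure on the whole space that is concentrated on the sphere.
\<close>

definition sphere_surface :: "(real ^ 'n) measure" where
  "sphere_surface =
     scale_measure (of_nat CARD('n))
       (distr (restrict_space lborel (ball 0 1 - {0})) borel (\<lambda>x. x /\<^sub>R norm x))"

text \<open>The type argument carries the dimension; this is \<open>\<omega>\<^bsub>d-1\<^esub>\<close> for \<open>d = CARD('n)\<close>.\<close>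

definition sphere_area :: "'n::finite itself \<Rightarrow> real" where
  "sphere_area _ = measure (sphere_surface :: (real ^ 'n) measure) (sphere 0 1)"

definition sphere_prob :: "(real ^ 'n) measure" where
  "sphere_prob = uniform_measure sphere_surface (sphere 0 1)"


text \<open>Real polynomial functions in \<open>d = CARD('n)\<close> variables of total degree at most \<open>t\<close>.\<close>

definition poly_fun_degree_le :: "nat \<Rightarrow> (real ^ 'n \<Rightarrow> real) \<Rightarrow> bool" where
  "poly_fun_degree_le t p \<longleftrightarrow>
     (\<exists>c :: ('n \<Rightarrow> nat) \<Rightarrow> real.
        p = (\<lambda>x. \<Sum>\<alpha> | (\<Sum>i\<in>UNIV. \<alpha> i) \<le> t. c \<alpha> * (\<Prod>i\<in>UNIV. x $ i ^ \<alpha> i)))"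

lemma finite_multi_indices: "finite {\<alpha> :: 'n::finite \<Rightarrow> nat. (\<Sum>i\<in>UNIV. \<alpha> i) \<le> t}"
proof (rule finite_subset)
  show "{\<alpha> :: 'n \<Rightarrow> nat. (\<Sum>i\<in>UNIV. \<alpha> i) \<le> t} \<subseteq> PiE UNIV (\<lambda>_. {..t})"
  proof
    fix \<alpha> :: "'n \<Rightarrow> nat"
    assume "\<alpha> \<in> {\<alpha>. (\<Sum>i\<in>UNIV. \<alpha> i) \<le> t}"
    then have le: "(\<Sum>i\<in>UNIV. \<alpha> i) \<le> t" by simp
    have "\<alpha> i \<le> t" for i
      using member_le_sum[of i UNIV \<alpha>] le by simp
    then show "\<alpha> \<in> PiE UNIV (\<lambda>_. {..t})"
      by (simp add: PiE_UNIV_domain)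
  qed
qed (simp add: finite_PiE)

definition spherical_design :: "nat \<Rightarrow> (real ^ 'n) set \<Rightarrow> bool" where
  "spherical_design t X \<longleftrightarrow>
     finite X \<and> X \<noteq> {} \<and> X \<subseteq> sphere 0 1 \<and>
     (\<forall>p. poly_fun_degree_le t p \<longrightarrow>
        (\<Sum>x\<in>X. p x) / real (card X) = (\<integral>x. p x \<partial>sphere_prob))"

definition orthogonal_group :: "(real ^ 'n \<Rightarrow> real ^ 'n) monoid" where
  "orthogonal_group = \<lparr>carrier = {f. orthogonal_transformation f}, mult = (\<circ>), one = id\<rparr>"

lemma group_orthogonal_group: "group orthogonal_group"
proof (rule groupI)
  fix f :: "real ^ 'n \<Rightarrow> real ^ 'n"
  assume "f \<in> carrier orthogonal_group"
  then have f: "orthogonal_transformation f"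
    by (simp add: orthogonal_group_def)
  have "inv_into UNIV f \<circ> f = id"
    using orthogonal_transformation_inj[OF f] by simp
  then show "\<exists>g\<in>carrier orthogonal_group. g \<otimes>\<^bsub>orthogonal_group\<^esub> f = \<one>\<^bsub>orthogonal_group\<^esub>"
    using orthogonal_transformation_inv[OF f] by (auto simp: orthogonal_group_def)
qed (auto simp: orthogonal_group_def orthogonal_transformation_compose comp_assoc id_def)

definition node_transitive :: "(real ^ 'n) set \<Rightarrow> bool" where
  "node_transitive X \<longleftrightarrow>
     (\<exists>G. subgroup G orthogonal_group \<and>
          (\<forall>g\<in>G. g ` X = X) \<and>
          (\<forall>x\<in>X. \<forall>y\<in>X. \<exists>g\<in>G. g x = y))"


definition support_function :: "(real ^ 'n) set \<Rightarrow> real ^ 'n \<Rightarrow> real" where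
  "support_function P u = (SUP y\<in>P. u \<bullet> y)"

definition support_face :: "(real ^ 'n) set \<Rightarrow> real ^ 'n \<Rightarrow> (real ^ 'n) set" where
  "support_face P u = {y \<in> P. u \<bullet> y = support_function P u}"

text \<open>
  The \<open>(d-1)\<close>-dimensional Lebesgue measure of a subset \<open>F\<close> of a hyperplane with unit normal \<open>u\<close>.
  Lebesgue measure is the product of the measure on the hyperplane and length in direction \<open>u\<close>,
  so this is the volume of the right prism of height 1 over \<open>F\<close>.
\<close>

definition hyperplane_area :: "real ^ 'n \<Rightarrow> (real ^ 'n) set \<Rightarrow> real" where
  "hyperplane_area u F = measure lebesgue {y + s *\<^sub>R u | y s. y \<in> F \<and> s \<in> {0..1}}"

text \<open>
  Full-dimensional polytopes with surface area measure \<open>(\<omega>\<^bsub>d-1\<^esub> / N) \<Sum>\<^bsub>x\<in>X\<^esub> \<delta>\<^bsub>x\<^esub>\<close>: the facets are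
  exactly the faces with outer unit normal in \<open>X\<close>, distinct normals give distinct facets,
  and every facet has area \<open>\<omega>\<^bsub>d-1\<^esub> / N\<close>.
\<close>

definition minkowski_polytope :: "(real ^ 'n) set \<Rightarrow> (real ^ 'n) set \<Rightarrow> bool" where
  "minkowski_polytope X P \<longleftrightarrow>
     polytope P \<and> interior P \<noteq> {} \<and>
     bij_betw (support_face P) X {F. F facet_of P} \<and>
     (\<forall>x\<in>X. hyperplane_area x (support_face P x) = sphere_area TYPE('n) / real (card X))"

definition steiner_point :: "(real ^ 'n) set \<Rightarrow> real ^ 'n" where
  "steiner_point P =
     real CARD('n) *\<^sub>R (\<integral>u. support_function P u *\<^sub>R u \<partial>sphere_prob)"

definition polar_body :: "(real ^ 'n) set \<Rightarrow> (real ^ 'n) set" where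
  "polar_body P = {z. \<forall>y\<in>P. z \<bullet> y \<le> 1}"

definition self_polar_up_to_similarity :: "(real ^ 'n) set \<Rightarrow> bool" where
  "self_polar_up_to_similarity P \<longleftrightarrow>
     compact P \<and> convex P \<and> 0 \<in> interior P \<and>
     (\<exists>c U. c > 0 \<and> orthogonal_transformation U \<and> polar_body P = (\<lambda>y. c *\<^sub>R U y) ` P)"

end

theory Submission
  imports Defs "HOL-Probability.Weak_Convergence"
begin

text \<open>
  Let \<open>h\<close> be the support function of \<open>P\<close>, so that \<open>P\<close> is the Wulff shape \<open>{y. \<forall>x\<in>X. x \<bullet> y \<le> h x}\<close>.
  Decomposing into cones over the facets bounds the volume of any Wulff shape of \<open>X\<close> near \<open>P\<close>, and
  as all facets have the same area, the bound is stationary at \<open>P\<close> along variations of \<open>h\<close> with fixed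
  sum. The volume is log-concave in the support numbers, hence \<open>P\<close> has maximal volume among Wulff
  shapes with the same sum of support numbers. Averaging \<open>h\<close> over the group gives the regular Wulff
  shape with constant support number, whose volume is at least that of \<open>P\<close> by log-concavity. So
  the Brunn-Minkowski inequality holds with equality, and \<open>P\<close> is a translate of the regular shape.
  The Steiner point of the regular shape is fixed by the transitive group, hence \<open>0\<close>; the
  translation is trivial, and the rest is polarity.
\<close>

section \<open>The Prekopa-Leindler inequality\<close>

text \<open>Brunn-Minkowski is used in its dimension-free product form. Weights are m / (m + n) with
  natural m, n, and every inequality is raised to the power m + n, so that only natural powers of
  \<open>ennreal\<close> values occur. Rational weights suffice: the variation at \<open>P\<close>
  runs along the parameters 1 / (n + 1), and the group average is a mean of finitely many functions.
  The main obstacle is the equality case, where equal volumes must yield a translate. Equality is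
  tested on half-spaces, which makes it a statement about one-dimensional marginals, and a second
  inequality with an exponential weight rigidifies those. In every direction u the marginals then
  differ by the shift u . v with one and the same vector v, the difference of the centroids, and
  separation turns this into an equality of sets. The second obstacle is that
  \<open>hyperplane_area\<close> is the volume of a right prism, whereas the volume argument needs
  cones with apex 0. The passage goes through oblique prisms, hence the volume factors of shears and
  stretches.\<close>

lemma lborel_inner_compact:
  fixes A :: "'a::euclidean_space set"
  assumes A: "A \<in> sets borel" and c: "c < emeasure lborel A"
  obtains K where "compact K" "K \<subseteq> A" "c < emeasure lborel K"
proof -
  let ?B = "\<lambda>n::nat. A \<inter> cball 0 (real n)"
  have "(SUP n. emeasure lborel (?B n)) = emeasure lborel (\<Union>n. ?B n)"
    using A by (intro SUP_emeasure_incseq) (auto simp: incseq_def)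
  also have "(\<Union>n. ?B n) = A"
    by (auto simp: real_arch_simple)
  finally have "c < (SUP n. emeasure lborel (?B n))"
    using c by simp
  then obtain n where n: "c < emeasure lborel (?B n)"
    unfolding less_SUP_iff by blast
  \<comment> \<open>\<open>inner_regular\<close> wants a finite measure, so Lebesgue measure is
    restricted to a ball that already captures more than \<open>c\<close>.\<close>
  define M where "M = density lborel (indicator (cball (0::'a) (real n)))"
  have em: "emeasure M S = emeasure lborel (S \<inter> cball 0 (real n))" if "S \<in> sets borel" for S
  proof -
    have cb: "cball (0::'a) (real n) \<in> sets lborel" by simp
    have "emeasure M S = (\<integral>\<^sup>+x. indicator (cball 0 (real n)) x * indicator S x \<partial>lborel)"
      unfolding M_def using that by (intro emeasure_density borel_measurable_indicator[OF cb]) simp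
    also have "\<dots> = (\<integral>\<^sup>+x. indicator (S \<inter> cball 0 (real n)) x \<partial>lborel)"
      by (intro nn_integral_cong) (auto simp: indicator_def)
    also have "\<dots> = emeasure lborel (S \<inter> cball 0 (real n))"
      using that by (intro nn_integral_indicator) auto
    finally show ?thesis .
  qed
  have "emeasure M A = (SUP K \<in> {K. K \<subseteq> A \<and> compact K}. emeasure M K)"
  proof (rule inner_regular)
    show "emeasure M (space M) \<noteq> \<infinity>"
      using em[of UNIV] emeasure_lborel_cball_finite[of "0::'a" "real n"]
      by (simp add: M_def less_top)
  qed (use A in \<open>auto simp: M_def\<close>)
  then obtain K where K: "K \<subseteq> A" "compact K" "c < emeasure M K"
    using n by (auto simp: em A less_SUP_iff)
  have "emeasure M K \<le> emeasure lborel K"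
    using K by (subst em) (auto intro!: emeasure_mono borel_compact)
  then show ?thesis
    using K that by (meson less_le_trans)
qed

lemma emeasure_lborel_affine_image:
  fixes K :: "real set"
  assumes "compact K" "0 < a"
  shows "emeasure lborel ((\<lambda>x. a * x + b) ` K) = ennreal a * emeasure lborel K"
proof -
  have K: "K \<in> sets borel" using assms by (simp add: borel_compact)
  have im: "compact ((\<lambda>x. a * x + b) ` K)"
    using assms by (intro compact_continuous_image) (auto intro!: continuous_intros)
  have "emeasure lborel ((\<lambda>x. a * x + b) ` K) = (\<integral>\<^sup>+x. indicator ((\<lambda>x. a * x + b) ` K) x \<partial>lborel)"
    using im by (simp add: borel_compact)
  also have "\<dots> = ennreal \<bar>a\<bar> * (\<integral>\<^sup>+x. indicator ((\<lambda>x. a * x + b) ` K) (b + a * x) \<partial>lborel)"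
    using borel_compact[OF im] assms by (intro nn_integral_real_affine) auto
  also have "(\<lambda>x. indicator ((\<lambda>x. a * x + b) ` K) (b + a * x) :: ennreal) = indicator K"
    using assms by (auto simp: fun_eq_iff indicator_def)
  finally show ?thesis using assms K by simp
qed

text \<open>The translates a K + b min L and a max K + b L both consist of weighted sums and meet at
  most in the single point a max K + b min L, so their lengths add up inside
  \<open>C\<close>.\<close>

lemma brunn_minkowski_real_compact:
  fixes K L C :: "real set"
  assumes "compact K" "compact L" "K \<noteq> {}" "L \<noteq> {}" "0 < a" "0 < b" "C \<in> sets borel"
    and sub: "\<And>x y. x \<in> K \<Longrightarrow> y \<in> L \<Longrightarrow> a * x + b * y \<in> C"
  shows "ennreal a * emeasure lborel K + ennreal b * emeasure lborel L \<le> emeasure lborel C"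
proof -
  define l where "l = Inf L"
  define k where "k = Sup K"
  have l: "l \<in> L" "\<And>y. y \<in> L \<Longrightarrow> l \<le> y"
    using assms by (auto simp: l_def intro!: closed_contains_Inf cInf_lower compact_imp_closed
        bounded_imp_bdd_below compact_imp_bounded)
  have k: "k \<in> K" "\<And>y. y \<in> K \<Longrightarrow> y \<le> k"
    using assms by (auto simp: k_def intro!: closed_contains_Sup cSup_upper compact_imp_closed
        bounded_imp_bdd_above compact_imp_bounded)
  let ?A = "(\<lambda>x. a * x + b * l) ` K" and ?B = "(\<lambda>y. b * y + a * k) ` L"
  have cA: "compact ?A" and cB: "compact ?B"
    using assms by (auto intro!: compact_continuous_image continuous_intros)
  have "?A \<inter> ?B \<subseteq> {a * k + b * l}"
  proof
    fix z assume "z \<in> ?A \<inter> ?B"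
    then obtain x y where xy: "x \<in> K" "y \<in> L" "z = a * x + b * l" "z = b * y + a * k" by auto
    have "a * x \<le> a * k" "b * l \<le> b * y" using xy k l assms by auto
    then have "z = a * k + b * l" using xy by linarith
    then show "z \<in> {a * k + b * l}" by simp
  qed
  then have "emeasure lborel (?A \<inter> ?B) \<le> emeasure lborel {a * k + b * l}"
    by (intro emeasure_mono) auto
  then have null: "emeasure lborel (?A \<inter> ?B) = 0" by simp
  have "ennreal a * emeasure lborel K + ennreal b * emeasure lborel L
      = emeasure lborel ?A + emeasure lborel ?B"
    using assms by (simp add: emeasure_lborel_affine_image)
  also have "\<dots> = emeasure lborel (?A \<union> ?B) + emeasure lborel (?A \<inter> ?B)"
    by (rule emeasure_Un_Int) (use cA cB in \<open>auto simp: borel_compact\<close>)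
  also have "\<dots> = emeasure lborel (?A \<union> ?B)"
    using null by simp
  also have "\<dots> \<le> emeasure lborel C"
    using assms sub[OF _ l(1)] sub[OF k(1)]
    by (intro emeasure_mono) (auto simp: add.commute mult.commute)
  finally show ?thesis .
qed

text \<open>Inner regularity in both arguments reduces this to compact sets. A Borel superset
  \<open>C\<close> stands in for the sumset, which need not be Borel itself.\<close>

lemma brunn_minkowski_real:
  fixes A B C :: "real set"
  assumes "A \<in> sets borel" "B \<in> sets borel" "C \<in> sets borel" "A \<noteq> {}" "B \<noteq> {}" "0 < a" "0 < b"
    and sub: "\<And>x y. x \<in> A \<Longrightarrow> y \<in> B \<Longrightarrow> a * x + b * y \<in> C"
  shows "ennreal a * emeasure lborel A + ennreal b * emeasure lborel B \<le> emeasure lborel C"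
proof -
  have inner: "emeasure lborel S = (SUP K\<in>{K. K \<subseteq> S \<and> K \<noteq> {} \<and> compact K}. emeasure lborel K)"
    if "S \<in> sets borel" "S \<noteq> {}" for S :: "real set"
  proof (rule antisym)
    show "emeasure lborel S \<le> (SUP K\<in>{K. K \<subseteq> S \<and> K \<noteq> {} \<and> compact K}. emeasure lborel K)"
    proof (rule dense_le)
      fix c assume "c < emeasure lborel S"
      then obtain K where K: "compact K" "K \<subseteq> S" "c < emeasure lborel K"
        using lborel_inner_compact[OF \<open>S \<in> sets borel\<close>] by blast
      then have "K \<noteq> {}" by auto
      then show "c \<le> (SUP K\<in>{K. K \<subseteq> S \<and> K \<noteq> {} \<and> compact K}. emeasure lborel K)"
        using K by (intro SUP_upper2[of K]) auto
    qed
    show "(SUP K\<in>{K. K \<subseteq> S \<and> K \<noteq> {} \<and> compact K}. emeasure lborel K) \<le> emeasure lborel S"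
      using that by (auto intro!: SUP_least emeasure_mono)
  qed
  have ne: "{K. K \<subseteq> S \<and> K \<noteq> {} \<and> compact K} \<noteq> {}" if "S \<noteq> {}" for S :: "real set"
    using that by (auto intro!: exI[of _ "{SOME x. x \<in> S}"] simp: some_in_eq)
  have "ennreal a * emeasure lborel K + ennreal b * emeasure lborel B \<le> emeasure lborel C"
    if K: "K \<subseteq> A" "K \<noteq> {}" "compact K" for K
  proof -
    have "ennreal a * emeasure lborel K + ennreal b * emeasure lborel B =
      (SUP L\<in>{K. K \<subseteq> B \<and> K \<noteq> {} \<and> compact K}. ennreal a * emeasure lborel K + ennreal b * emeasure lborel L)"
      using ne[of B] assms by (simp add: inner[of B] SUP_mult_left_ennreal ennreal_SUP_add_right)
    also have "\<dots> \<le> emeasure lborel C"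
      using K assms by (auto intro!: SUP_least brunn_minkowski_real_compact)
    finally show ?thesis .
  qed
  then have "(SUP K\<in>{K. K \<subseteq> A \<and> K \<noteq> {} \<and> compact K}. ennreal a * emeasure lborel K + ennreal b * emeasure lborel B)
      \<le> emeasure lborel C"
    by (auto intro!: SUP_least)
  then show ?thesis
    using ne[of A] assms
    by (simp add: inner[of A] SUP_mult_left_ennreal ennreal_SUP_add_left)
qed

section \<open>Layer-cake formula and the Prekopa-Leindler inequality on the line\<close>

lemma nn_integral_layer_cake:
  fixes f :: "real \<Rightarrow> ennreal"
  assumes [measurable]: "f \<in> borel_measurable borel"
  shows "(\<integral>\<^sup>+x. f x \<partial>lborel) = (\<integral>\<^sup>+t\<in>{0..}. emeasure lborel {x. ennreal t < f x} \<partial>lborel)"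
proof -
  have len: "(\<integral>\<^sup>+t. indicator {0..} t * indicator {x. ennreal t < f x} x \<partial>lborel) = f x" for x
  proof (cases "f x")
    case (real r)
    have "(\<integral>\<^sup>+t. indicator {0..} t * indicator {x. ennreal t < f x} x \<partial>lborel)
        = (\<integral>\<^sup>+t. indicator {0..<r} t \<partial>lborel)"
      using real by (intro nn_integral_cong) (auto simp: indicator_def ennreal_less_iff)
    then show ?thesis using real by simp
  next
    case top
    have "(\<integral>\<^sup>+t. indicator {0..} t * indicator {x. ennreal t < f x} x \<partial>lborel)
        = (\<integral>\<^sup>+t. indicator {0::real..} t \<partial>lborel)"
      using top by (intro nn_integral_cong) (auto simp: indicator_def)
    also have "\<dots> = top_class.top"
    proof -
      have "of_nat n \<le> emeasure lborel {0::real..}" for n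
      proof -
        have "of_nat n = emeasure lborel {0..real n}" by (simp add: ennreal_of_nat_eq_real_of_nat)
        also have "\<dots> \<le> emeasure lborel {0::real..}" by (intro emeasure_mono) auto
        finally show ?thesis .
      qed
      then have "emeasure lborel {0::real..} = top_class.top"
        by (metis ennreal_Ex_less_of_nat less_top linorder_not_less)
      then show ?thesis by simp
    qed
    finally show ?thesis using top by simp
  qed
  have "(\<integral>\<^sup>+x. f x \<partial>lborel)
      = (\<integral>\<^sup>+x. \<integral>\<^sup>+t. indicator {0..} t * indicator {x. ennreal t < f x} x \<partial>lborel \<partial>lborel)"
    by (simp add: len)
  also have "\<dots> = (\<integral>\<^sup>+t. \<integral>\<^sup>+x. indicator {0..} t * indicator {x. ennreal t < f x} x \<partial>lborel \<partial>lborel)"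
    by (rule lborel_pair.Fubini') (simp add: indicator_def[of "{x. _ x}"] case_prod_beta)
  also have "\<dots> = (\<integral>\<^sup>+t\<in>{0..}. emeasure lborel {x. ennreal t < f x} \<partial>lborel)"
    by (intro nn_integral_cong) (simp add: nn_integral_cmult mult.commute)
  finally show ?thesis .
qed

lemma measurable_emeasure_superlevel [measurable]:
  fixes f :: "real \<Rightarrow> ennreal" and g :: "real \<Rightarrow> real"
  assumes [measurable]: "f \<in> borel_measurable borel" "g \<in> borel_measurable borel"
  shows "(\<lambda>t. emeasure lborel {x. ennreal (g t) < f x}) \<in> borel_measurable borel"
proof -
  have "(\<lambda>t. emeasure lborel {x. ennreal (g t) < f x}) = (\<lambda>t. \<integral>\<^sup>+x. indicator {x. ennreal (g t) < f x} x \<partial>lborel)"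
    by simp
  also have "\<dots> \<in> borel_measurable borel"
    unfolding indicator_def by measurable
  finally show ?thesis .
qed

text \<open>Heights are measured as fractions of the bound \<open>c\<close>, so that functions with
  different bounds can be sliced by one common parameter t in (0,1). Levels t >= 1 are empty, and t
  = 0 is a null set.\<close>

lemma nn_integral_layer_cake_bounded:
  fixes f :: "real \<Rightarrow> ennreal"
  assumes [measurable]: "f \<in> borel_measurable borel" and b: "\<And>x. f x \<le> ennreal c" and c: "0 < c"
  shows "(\<integral>\<^sup>+x. f x \<partial>lborel) = ennreal c * (\<integral>\<^sup>+t\<in>{0<..<1}. emeasure lborel {x. ennreal (c * t) < f x} \<partial>lborel)"
proof -
  have "(\<integral>\<^sup>+x. f x \<partial>lborel) = (\<integral>\<^sup>+t. emeasure lborel {x. ennreal t < f x} * indicator {0..} t \<partial>lborel)"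
    by (rule nn_integral_layer_cake) fact
  also have "\<dots> = ennreal c * (\<integral>\<^sup>+t. emeasure lborel {x. ennreal (c * t) < f x} * indicator {0..} (c * t) \<partial>lborel)"
    using c nn_integral_real_affine[of "\<lambda>t. emeasure lborel {x. ennreal t < f x} * indicator {0..} t" c 0]
    by simp
  also have "(\<integral>\<^sup>+t. emeasure lborel {x. ennreal (c * t) < f x} * indicator {0..} (c * t) \<partial>lborel)
      = (\<integral>\<^sup>+t\<in>{0<..<1}. emeasure lborel {x. ennreal (c * t) < f x} \<partial>lborel)"
  proof (rule nn_integral_cong_AE)
    have emp: "{x. ennreal (c * t) < f x} = {}" if "1 \<le> t" for t
    proof -
      have "ennreal c \<le> ennreal (c * t)" using that c by (intro ennreal_leI) auto
      then show ?thesis using b by (auto simp: not_less intro: order_trans)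
    qed
    have "AE t in lborel. t \<noteq> (0::real)" by (rule AE_lborel_singleton)
    then show "AE t in lborel. emeasure lborel {x. ennreal (c * t) < f x} * indicator {0..} (c * t) =
        emeasure lborel {x. ennreal (c * t) < f x} * indicator {0<..<1} t"
    proof (rule AE_mp, intro AE_I2 impI)
      fix t :: real assume "t \<noteq> 0"
      then show "emeasure lborel {x. ennreal (c * t) < f x} * indicator {0..} (c * t) =
        emeasure lborel {x. ennreal (c * t) < f x} * indicator {0<..<1} t"
        using emp[of t] c by (cases "1 \<le> t") (auto simp: indicator_def zero_le_mult_iff)
    qed
  qed
  finally show ?thesis .
qed

text \<open>Weighted AM-GM raised to the power m + n. For positive finite values it is concavity of
  \<open>ln\<close>; a zero factor kills the left side, and otherwise an infinite one makes the
  right side infinite, since both weights are positive.\<close>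

lemma ennreal_weighted_am_gm:
  fixes a b :: ennreal and m n :: nat
  assumes "0 < m" "0 < n"
  shows "a ^ m * b ^ n \<le> (ennreal (m / (m + n)) * a + ennreal (n / (m + n)) * b) ^ (m + n)"
proof (cases "a = 0 \<or> b = 0 \<or> a = top_class.top \<or> b = top_class.top")
  case True
  have pos: "0 < real m / real (m + n)" "0 < real n / real (m + n)" using assms by simp_all
  from True show ?thesis
    using assms pos by (auto simp: zero_power ennreal_mult_top ennreal_top_mult ennreal_mult_eq_top_iff)
next
  case False
  then obtain x y where xy: "a = ennreal x" "b = ennreal y" "0 < x" "0 < y"
    by (cases a; cases b) (auto simp: less_le)
  define p q where "p = m / (m + n)" and "q = n / (m + n)"
  have pq: "0 < p" "0 < q" "p + q = 1" using assms by (auto simp: p_def q_def add_divide_distrib[symmetric])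
  have "p * ln x + q * ln y \<le> ln (p * x + q * y)"
  proof -
    have "concave_on {0<..} ln" by (rule ln_concave)
    from concave_onD[OF this, of q x y] show ?thesis
      using pq xy by (simp add: eq_diff_eq[symmetric, of p q 1])
  qed
  then have "(m + n) * (p * ln x + q * ln y) \<le> (m + n) * ln (p * x + q * y)"
    by (intro mult_left_mono) auto
  moreover have "(m + n) * (p * ln x + q * ln y) = m * ln x + n * ln y"
  proof -
    have "(m + n) * p = m" "(m + n) * q = n" using assms by (simp_all add: p_def q_def)
    then show ?thesis by (metis distrib_left mult.assoc)
  qed
  ultimately have "ln (x ^ m * y ^ n) \<le> ln ((p * x + q * y) ^ (m + n))"
    using xy pq by (simp add: ln_mult ln_realpow add_pos_pos)
  moreover have "0 < p * x + q * y" using xy pq by (simp add: add_pos_pos)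
  ultimately have "x ^ m * y ^ n \<le> (p * x + q * y) ^ (m + n)"
    using xy by (subst (asm) ln_le_cancel_iff) auto
  then have "ennreal (x ^ m * y ^ n) \<le> ennreal ((p * x + q * y) ^ (m + n))"
    by (rule ennreal_leI)
  also have "ennreal (x ^ m * y ^ n) = a ^ m * b ^ n"
    using xy by (simp add: ennreal_mult ennreal_power)
  also have "ennreal ((p * x + q * y) ^ (m + n)) = (ennreal p * a + ennreal q * b) ^ (m + n)"
    using xy pq by (simp add: ennreal_mult ennreal_power[symmetric] ennreal_plus)
  finally show ?thesis by (simp add: p_def q_def)
qed

text \<open>At equal relative height t < 1 the superlevel sets of \<open>f\<close> and
  \<open>g\<close> are nonempty, so Brunn-Minkowski on the line applies to each slice. Integrating
  over t and applying AM-GM gives the product form.\<close>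

lemma prekopa_leindler_real_sup:
  fixes f g h :: "real \<Rightarrow> ennreal" and m n :: nat
  assumes mn: "0 < m" "0 < n"
    and meas [measurable]: "f \<in> borel_measurable borel" "g \<in> borel_measurable borel" "h \<in> borel_measurable borel"
    and FG: "0 < F" "0 < G" "(SUP x. f x) = ennreal F" "(SUP x. g x) = ennreal G"
    and le: "\<And>x y. f x ^ m * g y ^ n \<le> h (m / (m + n) * x + n / (m + n) * y) ^ (m + n)"
  shows "(\<integral>\<^sup>+x. f x \<partial>lborel) ^ m * (\<integral>\<^sup>+x. g x \<partial>lborel) ^ n \<le> (\<integral>\<^sup>+x. h x \<partial>lborel) ^ (m + n)"
proof -
  define p q where "p = m / (m + n)" and "q = n / (m + n)"
  have pq: "0 < p" "0 < q" using mn by (auto simp: p_def q_def)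
  \<comment> \<open>\<open>r\<close> is the weighted geometric mean of the two suprema: the
    hypothesis lifts \<open>h\<close> above r t wherever \<open>f\<close> exceeds F t and
    \<open>g\<close> exceeds G t.\<close>
  define r where "r = root (m + n) (F ^ m * G ^ n)"
  have r: "0 < r" "r ^ (m + n) = F ^ m * G ^ n"
    using FG mn by (auto simp: r_def)
  let ?A = "\<lambda>t. {x. ennreal (F * t) < f x}" and ?B = "\<lambda>t. {x. ennreal (G * t) < g x}"
    and ?C = "\<lambda>t. {x. ennreal (r * t) < h x}"
  have level: "ennreal p * emeasure lborel (?A t) + ennreal q * emeasure lborel (?B t) \<le> emeasure lborel (?C t)"
    if t: "t \<in> {0<..<1}" for t
  proof (rule brunn_minkowski_real)
    have "ennreal (F * t) < (SUP x. f x)" "ennreal (G * t) < (SUP x. g x)"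
      using t FG by (auto simp: ennreal_less_iff)
    then show "?A t \<noteq> {}" "?B t \<noteq> {}" by (auto simp: less_SUP_iff)
    fix x y assume xy: "x \<in> ?A t" "y \<in> ?B t"
    have "ennreal (r * t) ^ (m + n) = ennreal (F * t) ^ m * ennreal (G * t) ^ n"
    proof -
      have "(r * t) ^ (m + n) = (F * t) ^ m * (G * t) ^ n"
        using r by (simp add: power_mult_distrib power_add)
      then show ?thesis
        using t r FG by (simp add: ennreal_power ennreal_mult[symmetric])
    qed
    also have "\<dots> < f x ^ m * g y ^ n"
    proof -
      have "f x < top_class.top" "g y < top_class.top"
        using SUP_upper[of x UNIV f] SUP_upper[of y UNIV g] FG
        by (auto intro: le_less_trans)
      then obtain u v where uv: "f x = ennreal u" "g y = ennreal v" "0 \<le> u" "0 \<le> v"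
        by (cases "f x"; cases "g y") auto
      have "F * t < u" "G * t < v"
        using xy uv FG t by (auto simp: ennreal_less_iff)
      then have "(F * t) ^ m * (G * t) ^ n < u ^ m * v ^ n"
        using FG t mn by (intro mult_strict_mono power_strict_mono)
          (auto intro!: zero_less_power intro: less_trans[OF mult_pos_pos])
      then show ?thesis
        using uv FG t by (simp add: ennreal_power ennreal_mult[symmetric] ennreal_less_iff)
    qed
    also have "\<dots> \<le> h (p * x + q * y) ^ (m + n)"
      unfolding p_def q_def by (rule le)
    finally have "ennreal (r * t) < h (p * x + q * y)"
      by (meson linorder_not_less power_mono zero_le)
    then show "p * x + q * y \<in> ?C t" by simp
  qed (use pq in measurable)
  \<comment> \<open>\<open>h\<close> may be unbounded. Cutting it off at \<open>r\<close> admits the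
    bounded layer-cake formula and leaves the superlevel sets at heights r t with t < 1
    unchanged.\<close>
  define h' where "h' x = min (h x) (ennreal r)" for x
  have [measurable]: "h' \<in> borel_measurable borel" unfolding h'_def by measurable
  have C: "?C t = {x. ennreal (r * t) < h' x}" if "t \<in> {0<..<1}" for t
    using that r by (auto simp: h'_def ennreal_less_iff)
  have fF: "f x \<le> ennreal F" for x using FG by (metis SUP_upper UNIV_I)
  have gG: "g x \<le> ennreal G" for x using FG by (metis SUP_upper UNIV_I)
  define a b c where "a = (\<integral>\<^sup>+t\<in>{0<..<1}. emeasure lborel (?A t) \<partial>lborel)"
    and "b = (\<integral>\<^sup>+t\<in>{0<..<1}. emeasure lborel (?B t) \<partial>lborel)"
    and "c = (\<integral>\<^sup>+t\<in>{0<..<1}. emeasure lborel (?C t) \<partial>lborel)"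
  have f: "(\<integral>\<^sup>+x. f x \<partial>lborel) = ennreal F * a"
    unfolding a_def using fF FG by (intro nn_integral_layer_cake_bounded) auto
  have g: "(\<integral>\<^sup>+x. g x \<partial>lborel) = ennreal G * b"
    unfolding b_def using gG FG by (intro nn_integral_layer_cake_bounded) auto
  have "ennreal r * c = ennreal r * (\<integral>\<^sup>+t\<in>{0<..<1}. emeasure lborel {x. ennreal (r * t) < h' x} \<partial>lborel)"
    unfolding c_def
    by (rule arg_cong[where f="\<lambda>z. ennreal r * z"], rule nn_integral_cong) (auto simp: C indicator_def)
  also have "\<dots> = (\<integral>\<^sup>+x. h' x \<partial>lborel)"
    using r by (intro nn_integral_layer_cake_bounded[symmetric]) (auto simp: h'_def)
  also have "\<dots> \<le> (\<integral>\<^sup>+x. h x \<partial>lborel)"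
    by (intro nn_integral_mono) (simp add: h'_def)
  finally have h: "ennreal r * c \<le> (\<integral>\<^sup>+x. h x \<partial>lborel)" .
  have "ennreal p * a + ennreal q * b
      = (\<integral>\<^sup>+t. (ennreal p * emeasure lborel (?A t) + ennreal q * emeasure lborel (?B t)) * indicator {0<..<1} t \<partial>lborel)"
    unfolding a_def b_def by (simp add: nn_integral_add nn_integral_cmult[symmetric] distrib_right mult.assoc)
  also have "\<dots> \<le> c"
    unfolding c_def using level by (intro nn_integral_mono) (auto simp: indicator_def)
  finally have abc: "ennreal p * a + ennreal q * b \<le> c" .
  have "(ennreal F * a) ^ m * (ennreal G * b) ^ n = ennreal r ^ (m + n) * (a ^ m * b ^ n)"
  proof -
    have "ennreal r ^ (m + n) = ennreal F ^ m * ennreal G ^ n"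
      using r FG by (simp add: ennreal_power ennreal_mult[symmetric])
    then show ?thesis by (simp add: power_mult_distrib ac_simps)
  qed
  also have "\<dots> \<le> ennreal r ^ (m + n) * (ennreal p * a + ennreal q * b) ^ (m + n)"
    unfolding p_def q_def by (intro mult_left_mono ennreal_weighted_am_gm mn) auto
  also have "\<dots> \<le> ennreal r ^ (m + n) * c ^ (m + n)"
    by (intro mult_left_mono power_mono abc) auto
  also have "\<dots> = (ennreal r * c) ^ (m + n)"
    by (simp add: power_mult_distrib)
  also have "\<dots> \<le> (\<integral>\<^sup>+x. h x \<partial>lborel) ^ (m + n)"
    by (intro power_mono h) auto
  finally show ?thesis unfolding f g .
qed

text \<open>Multiplication of \<open>ennreal\<close> fails to be continuous only where 0 meets
  infinity, and \<open>l\<close> and \<open>l ^ n\<close> never form such a pair.\<close>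

lemma ennreal_tendsto_power:
  fixes f :: "nat \<Rightarrow> ennreal"
  assumes "f \<longlonglongrightarrow> l"
  shows "(\<lambda>i. f i ^ n) \<longlonglongrightarrow> l ^ n"
proof (induction n)
  case (Suc n)
  show ?case
  proof (cases "l = 0 \<or> l = top_class.top")
    case True
    then show ?thesis
      unfolding power_Suc by (intro tendsto_mult_ennreal assms Suc.IH) (auto simp: power_0_left)
  next
    case False
    then show ?thesis
      unfolding power_Suc by (intro tendsto_mult_ennreal assms Suc.IH) auto
  qed
qed simp

text \<open>Truncating \<open>f\<close> and \<open>g\<close> at height N makes the suprema finite
  and only lowers the left side of the hypothesis; monotone convergence removes the truncation.
  Vanishing integrals are split off first, because the limit of the product could otherwise be of
  the form 0 times infinity.\<close>

lemma prekopa_leindler_real: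
  fixes f g h :: "real \<Rightarrow> ennreal" and m n :: nat
  assumes mn: "0 < m" "0 < n"
    and meas [measurable]: "f \<in> borel_measurable borel" "g \<in> borel_measurable borel" "h \<in> borel_measurable borel"
    and le: "\<And>x y. f x ^ m * g y ^ n \<le> h (m / (m + n) * x + n / (m + n) * y) ^ (m + n)"
  shows "(\<integral>\<^sup>+x. f x \<partial>lborel) ^ m * (\<integral>\<^sup>+x. g x \<partial>lborel) ^ n \<le> (\<integral>\<^sup>+x. h x \<partial>lborel) ^ (m + n)"
proof (cases "(\<integral>\<^sup>+x. f x \<partial>lborel) = 0 \<or> (\<integral>\<^sup>+x. g x \<partial>lborel) = 0")
  case True
  then show ?thesis using mn by (auto simp: zero_power)
next
  case False
  define tr where "tr f N x = min (f x) (of_nat N)" for f :: "real \<Rightarrow> ennreal" and N :: nat and x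
  have tr_meas: "tr f N \<in> borel_measurable borel" if "f \<in> borel_measurable borel" for f N
    using that unfolding tr_def by measurable
  have lim: "(\<lambda>N. \<integral>\<^sup>+x. tr f N x \<partial>lborel) \<longlonglongrightarrow> (\<integral>\<^sup>+x. f x \<partial>lborel)"
    if [measurable]: "f \<in> borel_measurable borel" for f
  proof -
    have inc: "incseq (tr f)"
      by (auto simp: incseq_def le_fun_def tr_def intro: min.coboundedI2)
    have "(SUP N. tr f N x) = f x" for x
    proof (rule antisym)
      show "(SUP N. tr f N x) \<le> f x" by (auto simp: tr_def intro: SUP_least)
      show "f x \<le> (SUP N. tr f N x)"
      proof (cases "f x = top_class.top")
        case True
        have "of_nat N \<le> (SUP N. tr f N x)" for N
          using True by (intro SUP_upper2[of N]) (auto simp: tr_def)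
        then have "(SUP N. tr f N x) = top_class.top"
          by (metis ennreal_Ex_less_of_nat less_top linorder_not_less)
        then show ?thesis by (metis top_greatest)
      next
        case False
        then obtain N where "f x < of_nat N" using ennreal_Ex_less_of_nat less_top by blast
        then show ?thesis by (intro SUP_upper2[of N]) (auto simp: tr_def)
      qed
    qed
    then have "(\<integral>\<^sup>+x. f x \<partial>lborel) = (SUP N. \<integral>\<^sup>+x. tr f N x \<partial>lborel)"
      using nn_integral_monotone_convergence_SUP[OF inc, of lborel] tr_meas[OF that] by simp
    moreover have "incseq (\<lambda>N. \<integral>\<^sup>+x. tr f N x \<partial>lborel)"
      using inc by (auto simp: incseq_def le_fun_def intro!: nn_integral_mono)
    ultimately show ?thesis using LIMSEQ_SUP by metis
  qed
  have bound: "(\<integral>\<^sup>+x. tr f N x \<partial>lborel) ^ m * (\<integral>\<^sup>+x. tr g N x \<partial>lborel) ^ n \<le> (\<integral>\<^sup>+x. h x \<partial>lborel) ^ (m + n)" for N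
  proof -
    have fin: "\<exists>F\<ge>0. (SUP x. tr f N x) = ennreal F" for f
    proof -
      have "(SUP x. tr f N x) \<le> of_nat N" by (auto simp: tr_def intro!: SUP_least)
      then have "(SUP x. tr f N x) < top_class.top" by (rule le_less_trans) (simp add: of_nat_less_top)
      then show ?thesis by (cases "SUP x. tr f N x") auto
    qed
    obtain F where F: "0 \<le> F" "(SUP x. tr f N x) = ennreal F" using fin by blast
    obtain G where G: "0 \<le> G" "(SUP x. tr g N x) = ennreal G" using fin by blast
    have zero: "(\<integral>\<^sup>+x. tr f N x \<partial>lborel) = 0" if "(SUP x. tr f N x) = 0" for f
    proof -
      have "tr f N x \<le> 0" for x using SUP_upper[of x UNIV "tr f N"] that by simp
      then show ?thesis by simp
    qed
    show ?thesis
    proof (cases "F = 0 \<or> G = 0")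
      case True
      then have "(\<integral>\<^sup>+x. tr f N x \<partial>lborel) = 0 \<or> (\<integral>\<^sup>+x. tr g N x \<partial>lborel) = 0"
        using F G zero by auto
      then show ?thesis using mn by (auto simp: zero_power)
    next
      case False
      show ?thesis
      proof (rule prekopa_leindler_real_sup[OF mn tr_meas[OF meas(1)] tr_meas[OF meas(2)] meas(3) _ _ F(2) G(2)])
        fix x y
        have "tr f N x ^ m * tr g N y ^ n \<le> f x ^ m * g y ^ n"
          by (intro mult_mono power_mono) (auto simp: tr_def)
        also note le
        finally show "tr f N x ^ m * tr g N y ^ n \<le> h (m / (m + n) * x + n / (m + n) * y) ^ (m + n)" .
      qed (use F G False in auto)
    qed
  qed
  have "(\<lambda>N. (\<integral>\<^sup>+x. tr f N x \<partial>lborel) ^ m * (\<integral>\<^sup>+x. tr g N x \<partial>lborel) ^ n)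
      \<longlonglongrightarrow> (\<integral>\<^sup>+x. f x \<partial>lborel) ^ m * (\<integral>\<^sup>+x. g x \<partial>lborel) ^ n"
    using False by (intro tendsto_mult_ennreal ennreal_tendsto_power lim meas) auto
  then show ?thesis
    by (rule LIMSEQ_le_const2) (use bound in auto)
qed

section \<open>From the line to finite products and Euclidean spaces\<close>

lemma fun_upd_in_extensional: "x \<in> extensional I \<Longrightarrow> x(i := s) \<in> extensional (insert i I)"
  by (auto simp: extensional_def)

text \<open>Induction on the coordinates: the inequality on the line, applied in coordinate i for
  fixed remaining coordinates, says exactly that the functions with i integrated out satisfy the
  hypothesis again. Points are \<open>extensional\<close> because these make up the space of
  \<open>PiM\<close>.\<close>

lemma prekopa_leindler_PiM:
  fixes f g h :: "('i \<Rightarrow> real) \<Rightarrow> ennreal" and m n :: nat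
  assumes mn: "0 < m" "0 < n" and I: "finite I"
  shows "f \<in> borel_measurable (PiM I (\<lambda>_. lborel)) \<Longrightarrow> g \<in> borel_measurable (PiM I (\<lambda>_. lborel)) \<Longrightarrow>
    h \<in> borel_measurable (PiM I (\<lambda>_. lborel)) \<Longrightarrow>
    (\<And>x y. x \<in> extensional I \<Longrightarrow> y \<in> extensional I \<Longrightarrow>
      f x ^ m * g y ^ n \<le> h (\<lambda>i\<in>I. m / (m + n) * x i + n / (m + n) * y i) ^ (m + n)) \<Longrightarrow>
    (\<integral>\<^sup>+x. f x \<partial>PiM I (\<lambda>_. lborel)) ^ m * (\<integral>\<^sup>+x. g x \<partial>PiM I (\<lambda>_. lborel)) ^ n
      \<le> (\<integral>\<^sup>+x. h x \<partial>PiM I (\<lambda>_. lborel)) ^ (m + n)"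
  using I
proof (induction I arbitrary: f g h)
  case empty
  then show ?case
    by (auto simp: PiM_empty nn_integral_count_space_finite restrict_def)
next
  case (insert i I)
  interpret product_sigma_finite "\<lambda>_::'i. lborel :: real measure" by standard
  let ?M = "\<lambda>I. PiM I (\<lambda>_. lborel :: real measure)"
  have upd: "(\<lambda>y. f (x(i := y))) \<in> borel_measurable borel"
    if "f \<in> borel_measurable (?M (insert i I))" "x \<in> extensional I" for f :: "('i \<Rightarrow> real) \<Rightarrow> ennreal" and x
    using measurable_comp[OF measurable_component_update that(1), of x] that(2) insert.hyps
    by (simp add: comp_def space_PiM PiE_def fun_upd_def)
  have marg: "(\<lambda>x. \<integral>\<^sup>+y. f (x(i := y)) \<partial>lborel) \<in> borel_measurable (?M I)"
    if [measurable]: "f \<in> borel_measurable (?M (insert i I))" for f :: "('i \<Rightarrow> real) \<Rightarrow> ennreal"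
    by measurable
  show ?case
    unfolding product_nn_integral_insert[OF insert.hyps(1,2) insert.prems(1)]
      product_nn_integral_insert[OF insert.hyps(1,2) insert.prems(2)]
      product_nn_integral_insert[OF insert.hyps(1,2) insert.prems(3)]
  proof (rule insert.IH[OF marg[OF insert.prems(1)] marg[OF insert.prems(2)] marg[OF insert.prems(3)]])
    fix x y :: "'i \<Rightarrow> real" assume x: "x \<in> extensional I" and y: "y \<in> extensional I"
    let ?z = "\<lambda>i\<in>I. m / (m + n) * x i + n / (m + n) * y i"
    show "(\<integral>\<^sup>+s. f (x(i := s)) \<partial>lborel) ^ m * (\<integral>\<^sup>+s. g (y(i := s)) \<partial>lborel) ^ n
        \<le> (\<integral>\<^sup>+s. h (?z(i := s)) \<partial>lborel) ^ (m + n)"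
    proof (rule prekopa_leindler_real[OF mn])
      fix s t :: real
      have "?z(i := m / (m + n) * s + n / (m + n) * t)
          = (\<lambda>j\<in>insert i I. m / (m + n) * (x(i := s)) j + n / (m + n) * (y(i := t)) j)"
        using insert.hyps by (auto simp: fun_eq_iff)
      then show "f (x(i := s)) ^ m * g (y(i := t)) ^ n \<le> h (?z(i := m / (m + n) * s + n / (m + n) * t)) ^ (m + n)"
        using insert.prems(4)[OF fun_upd_in_extensional[OF x] fun_upd_in_extensional[OF y], of s t]
        by (simp only:)
    qed (use x y in \<open>auto intro!: upd insert.prems\<close>)
  qed
qed

theorem prekopa_leindler:
  fixes f g h :: "'a::euclidean_space \<Rightarrow> ennreal" and m n :: nat
  assumes mn: "0 < m" "0 < n"
    and meas [measurable]: "f \<in> borel_measurable borel" "g \<in> borel_measurable borel" "h \<in> borel_measurable borel"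
    and le: "\<And>x y. f x ^ m * g y ^ n \<le> h ((m / (m + n)) *\<^sub>R x + (n / (m + n)) *\<^sub>R y) ^ (m + n)"
  shows "(\<integral>\<^sup>+x. f x \<partial>lborel) ^ m * (\<integral>\<^sup>+x. g x \<partial>lborel) ^ n \<le> (\<integral>\<^sup>+x. h x \<partial>lborel) ^ (m + n)"
proof -
  let ?P = "PiM (Basis::'a set) (\<lambda>_. lborel :: real measure)"
  let ?v = "\<lambda>z. \<Sum>b\<in>Basis. z b *\<^sub>R (b::'a)"
  have v: "?v \<in> measurable ?P borel" by measurable
  have eq: "(\<integral>\<^sup>+x. u x \<partial>lborel) = (\<integral>\<^sup>+z. u (?v z) \<partial>?P)" if "u \<in> borel_measurable borel" for u :: "'a \<Rightarrow> ennreal"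
  proof -
    have "(\<integral>\<^sup>+x. u x \<partial>lborel) = (\<integral>\<^sup>+x. u x \<partial>distr ?P borel ?v)"
      using lborel_eq[where 'a='a] by (rule arg_cong)
    also have "\<dots> = (\<integral>\<^sup>+z. u (?v z) \<partial>?P)"
      using that by (intro nn_integral_distr v) simp
    finally show ?thesis .
  qed
  show ?thesis
    unfolding eq[OF meas(1)] eq[OF meas(2)] eq[OF meas(3)]
  proof (rule prekopa_leindler_PiM[OF mn finite_Basis])
    fix x y :: "'a \<Rightarrow> real"
    have "?v (\<lambda>b\<in>Basis. m / (m + n) * x b + n / (m + n) * y b) = (m / (m + n)) *\<^sub>R ?v x + (n / (m + n)) *\<^sub>R ?v y"
      by (simp add: scaleR_sum_right sum.distrib scaleR_add_left)
    then show "f (?v x) ^ m * g (?v y) ^ n \<le> h (?v (\<lambda>b\<in>Basis. m / (m + n) * x b + n / (m + n) * y b)) ^ (m + n)"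
      using le by simp
  qed (use v in measurable)
qed

section \<open>Volume of linear images\<close>

lemma nn_integral_lborel_translate:
  fixes F :: "'a::euclidean_space \<Rightarrow> ennreal"
  assumes [measurable]: "F \<in> borel_measurable borel"
  shows "(\<integral>\<^sup>+x. F (c + x) \<partial>lborel) = (\<integral>\<^sup>+x. F x \<partial>lborel)"
proof -
  have "(\<integral>\<^sup>+x. F (c + x) \<partial>lborel) = (\<integral>\<^sup>+x. F x \<partial>distr lborel borel ((+) c))"
    by (subst nn_integral_distr) auto
  then show ?thesis by (simp add: lborel_distr_plus)
qed

lemma nn_integral_lborel_reflect:
  fixes F :: "'a::euclidean_space \<Rightarrow> ennreal"
  assumes [measurable]: "F \<in> borel_measurable borel"
  shows "(\<integral>\<^sup>+x. F (c - x) \<partial>lborel) = (\<integral>\<^sup>+x. F x \<partial>lborel)"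
proof -
  have "lborel = distr lborel borel (\<lambda>x::'a. c - x)"
    using lborel_affine[of "-1" c] by (simp add: density_1)
  then have "(\<integral>\<^sup>+x. F x \<partial>lborel) = (\<integral>\<^sup>+x. F x \<partial>distr lborel borel (\<lambda>x. c - x))"
    by simp
  also have "\<dots> = (\<integral>\<^sup>+x. F (c - x) \<partial>lborel)"
    by (subst nn_integral_distr) auto
  finally show ?thesis by simp
qed

text \<open>For an injective linear \<open>f\<close> this is 1 / |det f|: the preimage is measured,
  so images get divided by it.\<close>

definition vol_factor :: "('a::euclidean_space \<Rightarrow> 'a) \<Rightarrow> real" where
  "vol_factor f = measure lborel (f -` ball 0 1) / measure lborel (ball (0::'a) 1)"

text \<open>
  Uniqueness of Haar measure: for Borel sets \<open>A\<close>, \<open>E\<close>, both \<open>|E| |f\<^sup>-\<^sup>1 A|\<close> and \<open>|A| |f\<^sup>-\<^sup>1 E|\<close> are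
  the integral of \<open>1\<^sub>A(f x) 1\<^sub>E(f x + y)\<close> over all \<open>x\<close> and \<open>y\<close>.
\<close>

lemma emeasure_linear_vimage_cross:
  fixes f :: "'a::euclidean_space \<Rightarrow> 'a"
  assumes f: "linear f" "inj f" and A [measurable]: "A \<in> sets borel" and E [measurable]: "E \<in> sets borel"
  shows "emeasure lborel E * emeasure lborel (f -` A) = emeasure lborel A * emeasure lborel (f -` E)"
proof -
  have surj: "surj f" using f linear_injective_imp_surjective by blast
  define g where "g = inv_into UNIV f"
  have fg: "f (g y) = y" for y using surj by (simp add: g_def surj_f_inv_f)
  have [measurable]: "f \<in> borel_measurable borel"
    using f by (intro borel_measurable_continuous_onI) (simp add: linear_continuous_on linear_linear)
  have cont: "f -` S \<in> sets borel" if "S \<in> sets borel" for S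
    using measurable_sets_borel[OF \<open>f \<in> borel_measurable borel\<close> that] by simp
  have tr: "(\<integral>\<^sup>+y. indicator S (c + y) \<partial>lborel) = emeasure lborel S" if "S \<in> sets borel" for S and c :: 'a
    using that nn_integral_lborel_translate[of "indicator S" c] by simp
  have rf: "(\<integral>\<^sup>+y. indicator S (c - y) \<partial>lborel) = emeasure lborel S" if "S \<in> sets borel" for S and c :: 'a
    using that nn_integral_lborel_reflect[of "indicator S" c] by simp
  have pre: "(\<integral>\<^sup>+x. indicator S (f x) \<partial>lborel) = emeasure lborel (f -` S)" if "S \<in> sets borel" for S
  proof -
    have "(\<integral>\<^sup>+x. indicator S (f x) \<partial>lborel) = (\<integral>\<^sup>+x. indicator (f -` S) x \<partial>lborel)"
      by (intro nn_integral_cong) (simp add: indicator_def)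
    then show ?thesis using cont[OF that] by simp
  qed
  have "emeasure lborel E * emeasure lborel (f -` A)
      = (\<integral>\<^sup>+x. \<integral>\<^sup>+y. indicator A (f x) * indicator E (f x + y) \<partial>lborel \<partial>lborel)"
    by (simp add: nn_integral_cmult tr nn_integral_multc pre mult.commute)
  also have "\<dots> = (\<integral>\<^sup>+y. \<integral>\<^sup>+x. indicator A (f x) * indicator E (f x + y) \<partial>lborel \<partial>lborel)"
    by (intro lborel_pair.Fubini') simp
  also have "\<dots> = (\<integral>\<^sup>+y. \<integral>\<^sup>+x. indicator A (f x - y) * indicator E (f x) \<partial>lborel \<partial>lborel)"
  proof (rule nn_integral_cong)
    fix y :: 'a
    \<comment> \<open>Moving x by the preimage \<open>g y\<close> turns f x + y into f x and f x
      into f x - y, which carries y from one indicator to the other.\<close>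
    have shift: "f (x - g y) = f x - y" for x
      using f(1) fg by (simp add: linear_add linear_neg linear_diff)
    have "(\<integral>\<^sup>+x. indicator A (f x) * indicator E (f x + y) \<partial>lborel)
        = (\<integral>\<^sup>+x. indicator A (f (- g y + x)) * indicator E (f (- g y + x) + y) \<partial>lborel)"
      by (intro nn_integral_lborel_translate[symmetric]) simp
    then show "(\<integral>\<^sup>+x. indicator A (f x) * indicator E (f x + y) \<partial>lborel)
        = (\<integral>\<^sup>+x. indicator A (f x - y) * indicator E (f x) \<partial>lborel)"
      by (simp add: shift)
  qed
  also have "\<dots> = (\<integral>\<^sup>+x. \<integral>\<^sup>+y. indicator A (f x - y) * indicator E (f x) \<partial>lborel \<partial>lborel)"
    by (intro lborel_pair.Fubini'[symmetric]) simp
  also have "\<dots> = emeasure lborel A * emeasure lborel (f -` E)"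
    by (simp add: nn_integral_cmult rf nn_integral_multc pre)
  finally show ?thesis .
qed

lemma measure_ball_1_pos: "0 < measure lborel (ball (0::'a::euclidean_space) 1)"
  using content_ball_pos[of 1 "0::'a"] by simp

text \<open>The cross identity with the unit ball in the role of \<open>E\<close>. Positivity comes
  from \<open>A = UNIV\<close>: a zero factor would make the whole space null.\<close>

lemma
  fixes f :: "'a::euclidean_space \<Rightarrow> 'a"
  assumes f: "linear f" "inj f"
  shows emeasure_linear_vimage: "A \<in> sets borel \<Longrightarrow> emeasure lborel (f -` A) = ennreal (vol_factor f) * emeasure lborel A"
    and vol_factor_pos: "0 < vol_factor f"
proof -
  let ?B = "ball (0::'a) 1"
  have "surj f" using f linear_injective_imp_surjective by blast
  obtain g where g: "linear g" "g \<circ> f = id" using linear_injective_left_inverse[OF f] by blast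
  have gf: "g (f x) = x" for x using g by (metis comp_apply id_apply)
  have fg: "f (g x) = x" for x using \<open>surj f\<close> gf by (metis surjD)
  have "f -` ?B = g ` ?B"
  proof (intro equalityI subsetI)
    show "x \<in> g ` ?B" if "x \<in> f -` ?B" for x
      using that gf[of x] by (metis imageI vimageD)
    show "x \<in> f -` ?B" if "x \<in> g ` ?B" for x
      using that by (auto simp: fg)
  qed
  then have bnd: "bounded (f -` ?B)"
    using g bounded_linear_image[of ?B g] linear_conv_bounded_linear by auto
  have op: "open (f -` ?B)"
    using f by (intro open_vimage) (auto simp: linear_continuous_on linear_linear)
  have fin: "emeasure lborel (f -` ?B) = ennreal (measure lborel (f -` ?B))"
    using bnd by (intro emeasure_eq_ennreal_measure) (auto dest: emeasure_bounded_finite)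
  have finB: "emeasure lborel ?B = ennreal (measure lborel ?B)"
    by (intro emeasure_eq_ennreal_measure) (metis emeasure_lborel_ball_finite infinity_ennreal_def less_irrefl)
  note pos = measure_ball_1_pos[where 'a='a]
  have main: "emeasure lborel (f -` A) = ennreal (vol_factor f) * emeasure lborel A" if A: "A \<in> sets borel" for A
  proof -
    have "emeasure lborel ?B * emeasure lborel (f -` A) = emeasure lborel A * emeasure lborel (f -` ?B)"
      using emeasure_linear_vimage_cross[OF f A, of ?B] by simp
    also have "emeasure lborel (f -` ?B) = ennreal (vol_factor f) * emeasure lborel ?B"
      unfolding fin finB vol_factor_def using pos by (simp add: ennreal_mult[symmetric])
    finally have "emeasure lborel ?B * emeasure lborel (f -` A)
        = emeasure lborel ?B * (ennreal (vol_factor f) * emeasure lborel A)"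
      by (simp add: ac_simps)
    then show ?thesis
      using pos unfolding finB by (subst (asm) ennreal_mult_cancel_left) auto
  qed
  show "A \<in> sets borel \<Longrightarrow> emeasure lborel (f -` A) = ennreal (vol_factor f) * emeasure lborel A"
    by (rule main)
  show "0 < vol_factor f"
  proof (rule ccontr)
    assume "\<not> 0 < vol_factor f"
    then have "emeasure lborel (f -` UNIV) = 0"
      using main[of UNIV] by (simp add: ennreal_neg)
    then show False by simp
  qed
qed

lemma vol_factor_eqI:
  fixes f :: "'a::euclidean_space \<Rightarrow> 'a"
  assumes f: "linear f" "inj f" and eq: "emeasure lborel (f -` A) = ennreal c * emeasure lborel A"
    and A: "A \<in> sets borel" "emeasure lborel A \<noteq> 0" "emeasure lborel A \<noteq> \<infinity>" and c: "0 \<le> c"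
  shows "vol_factor f = c"
proof -
  have "ennreal (vol_factor f) * emeasure lborel A = ennreal c * emeasure lborel A"
    using emeasure_linear_vimage[OF f A(1)] eq by simp
  then show ?thesis
    using A c vol_factor_pos[OF f]
    by (subst (asm) (1 2) mult.commute, subst (asm) ennreal_mult_cancel_left) auto
qed

lemma vol_factor_compose:
  fixes f g :: "'a::euclidean_space \<Rightarrow> 'a"
  assumes f: "linear f" "inj f" and g: "linear g" "inj g"
  shows "vol_factor (f \<circ> g) = vol_factor f * vol_factor g"
proof (rule vol_factor_eqI[where A="ball 0 1"])
  have [measurable]: "f \<in> borel_measurable borel"
    using f by (intro borel_measurable_continuous_onI) (simp add: linear_continuous_on linear_linear)
  have "f -` ball 0 1 \<in> sets borel"
    using measurable_sets_borel[OF \<open>f \<in> borel_measurable borel\<close>, of "ball 0 1"] by simp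
  then have "emeasure lborel (g -` (f -` ball 0 1)) = ennreal (vol_factor g) * (ennreal (vol_factor f) * emeasure lborel (ball (0::'a) 1))"
    using emeasure_linear_vimage[OF g] emeasure_linear_vimage[OF f, of "ball 0 1"] by simp
  also have "\<dots> = ennreal (vol_factor f * vol_factor g) * emeasure lborel (ball (0::'a) 1)"
    using vol_factor_pos[OF f] vol_factor_pos[OF g] by (simp add: ennreal_mult ac_simps)
  finally show "emeasure lborel ((f \<circ> g) -` ball 0 1) = ennreal (vol_factor f * vol_factor g) * emeasure lborel (ball (0::'a) 1)"
    by (simp add: vimage_comp)
  show "emeasure lborel (ball (0::'a) 1) \<noteq> 0"
    using measure_ball_1_pos[where 'a='a] by (auto simp: measure_def)
  show "emeasure lborel (ball (0::'a) 1) \<noteq> \<infinity>"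
    using emeasure_lborel_ball_finite[of "0::'a" 1] by simp
qed (use assms vol_factor_pos[OF f] vol_factor_pos[OF g] in \<open>auto intro: linear_compose inj_compose\<close>)

lemma measure_linear_image_vol_factor:
  fixes f :: "'a::euclidean_space \<Rightarrow> 'a"
  assumes f: "linear f" "inj f" and S: "compact S"
  shows "measure lborel (f ` S) = measure lborel S / vol_factor f"
proof -
  have c: "compact (f ` S)"
    using f S by (intro compact_continuous_image) (auto simp: linear_continuous_on linear_linear)
  have "f -` (f ` S) = S" using f by (simp add: inj_vimage_image_eq)
  then have "emeasure lborel S = ennreal (vol_factor f) * emeasure lborel (f ` S)"
    using emeasure_linear_vimage[OF f, of "f ` S"] c by (simp add: borel_compact)
  then have "measure lborel S = vol_factor f * measure lborel (f ` S)"
    using vol_factor_pos[OF f] by (simp add: measure_def enn2real_mult)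
  then show ?thesis using vol_factor_pos[OF f] by simp
qed

lemma vol_factor_orthogonal:
  fixes f :: "'a::euclidean_space \<Rightarrow> 'a"
  assumes "orthogonal_transformation f"
  shows "vol_factor f = 1"
proof -
  have "f -` ball 0 1 = ball 0 1"
    using assms by (auto simp: orthogonal_transformation_norm)
  then show ?thesis using measure_ball_1_pos[where 'a='a] by (simp add: vol_factor_def)
qed

text \<open>
  The reflection in the direction of \<open>q\<close> conjugates a shear along \<open>q\<close> to its inverse, so the shear
  and its inverse have the same volume factor.
\<close>

lemma vol_factor_shear:
  fixes q x :: "'a::euclidean_space"
  assumes q: "q \<bullet> x = 0"
  shows "vol_factor (\<lambda>v. v + (x \<bullet> v) *\<^sub>R q) = 1"
proof (cases "q = 0")
  case True
  then show ?thesis using measure_ball_1_pos[where 'a='a] by (simp add: vol_factor_def)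
next
  case False
  define f g where "f = (\<lambda>v. v + (x \<bullet> v) *\<^sub>R q)" and "g = (\<lambda>v. v - (x \<bullet> v) *\<^sub>R q)"
  define R where "R v = v - (2 * (q \<bullet> v) / (q \<bullet> q)) *\<^sub>R q" for v
  have xq: "x \<bullet> q = 0" using q by (simp add: inner_commute)
  have lin: "linear f" "linear g" "linear R"
    by (auto intro!: linearI simp: f_def g_def R_def algebra_simps inner_add_right add_divide_distrib)
  have fg: "f (g v) = v" "g (f v) = v" for v
    by (simp_all add: f_def g_def inner_add_right inner_diff_right xq)
  have inj: "inj f" "inj g" using fg by (metis injI)+
  have R: "orthogonal_transformation R"
    unfolding orthogonal_transformation_def
  proof (intro conjI allI lin)
    fix v w
    show "R v \<bullet> R w = v \<bullet> w"
      using False by (simp add: R_def inner_diff_left inner_diff_right inner_commute field_simps)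
  qed
  have RR: "R (R v) = v" for v
    using False by (simp add: R_def inner_diff_right)
  have Rq: "R q = - q"
    using False by (simp add: R_def scaleR_2)
  have gR: "g = R \<circ> f \<circ> R"
  proof
    fix v
    have "x \<bullet> R v = x \<bullet> v" by (simp add: R_def inner_diff_right xq)
    then have "R (f (R v)) = R (R v) + (x \<bullet> v) *\<^sub>R R q"
      using lin(3) by (simp add: f_def linear_add linear_scale)
    then show "g v = (R \<circ> f \<circ> R) v" by (simp add: RR Rq g_def)
  qed
  have "vol_factor g = vol_factor f"
    unfolding gR using R inj lin
    by (simp add: vol_factor_compose vol_factor_orthogonal linear_compose inj_compose
        orthogonal_transformation_inj)
  moreover have "vol_factor f * vol_factor g = 1"
  proof -
    have "f \<circ> g = id" using fg by auto
    then have "vol_factor (f \<circ> g) = 1"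
      by (simp add: vol_factor_orthogonal orthogonal_transformation_id[unfolded id_def[symmetric]])
    then show ?thesis using inj lin by (simp add: vol_factor_compose)
  qed
  ultimately have "vol_factor f ^ 2 = 1" by (simp add: power2_eq_square)
  then show ?thesis
    using vol_factor_pos[OF lin(1) inj(1)] unfolding f_def[symmetric]
    by (simp add: power2_eq_1_iff)
qed

text \<open>A stretch along a basis vector is diagonal, so \<open>lborel_affine_euclidean\<close>
  yields its factor directly.\<close>

lemma vol_factor_stretch_axis:
  fixes b :: "'a::euclidean_space"
  assumes b: "b \<in> Basis" and c: "c \<noteq> 0"
  shows "vol_factor (\<lambda>v. v + ((c - 1) * (b \<bullet> v)) *\<^sub>R b) = 1 / \<bar>c\<bar>"
proof -
  define k where "k j = (if j = b then c else 1)" for j :: 'a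
  define T where "T = (\<lambda>v. v + ((c - 1) * (b \<bullet> v)) *\<^sub>R b)"
  have T: "0 + (\<Sum>j\<in>Basis. (k j * (v \<bullet> j)) *\<^sub>R j) = T v" for v
  proof -
    have "(\<Sum>j\<in>Basis. (k j * (v \<bullet> j)) *\<^sub>R j)
        = (\<Sum>j\<in>Basis. (v \<bullet> j) *\<^sub>R j + (if j = b then ((c - 1) * (v \<bullet> b)) *\<^sub>R b else 0))"
      by (intro sum.cong) (auto simp: k_def algebra_simps)
    also have "\<dots> = v + ((c - 1) * (v \<bullet> b)) *\<^sub>R b"
      using b by (simp add: sum.distrib euclidean_representation)
    finally show ?thesis by (simp add: T_def inner_commute)
  qed
  have prod: "(\<Prod>j\<in>Basis. \<bar>k j\<bar>) = \<bar>c\<bar>"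
    using b by (subst prod.remove[of _ b]) (auto simp: k_def intro!: prod.neutral)
  have lin: "linear T"
    by (intro linearI) (auto simp: T_def algebra_simps inner_add_right)
  have inj: "inj T"
  proof (rule linear_injective_0[THEN iffD2, OF lin, rule_format])
    fix v assume 0: "T v = 0"
    have "b \<bullet> T v = c * (b \<bullet> v)" using b by (simp add: T_def inner_add_right algebra_simps)
    then have "b \<bullet> v = 0" using 0 c by simp
    then show "v = 0" using 0 by (simp add: T_def)
  qed
  have [measurable]: "T \<in> borel_measurable borel"
    using lin by (intro borel_measurable_continuous_onI) (simp add: linear_continuous_on linear_linear)
  have "lborel = density (distr lborel borel T) (\<lambda>_. ennreal \<bar>c\<bar>)"
    using lborel_affine_euclidean[of k 0] c unfolding T prod by (simp add: k_def)
  then have "emeasure lborel (ball (0::'a) 1) = emeasure (density (distr lborel borel T) (\<lambda>_. ennreal \<bar>c\<bar>)) (ball 0 1)"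
    by simp
  also have "\<dots> = ennreal \<bar>c\<bar> * emeasure lborel (T -` ball 0 1)"
    by (simp add: emeasure_density_const emeasure_distr)
  finally have "measure lborel (ball (0::'a) 1) = \<bar>c\<bar> * measure lborel (T -` ball 0 1)"
    by (simp add: measure_def enn2real_mult)
  then show ?thesis
    unfolding T_def[symmetric] using c measure_ball_1_pos[where 'a='a] by (auto simp: vol_factor_def zero_less_mult_iff)
qed

text \<open>An orthogonal map carrying a basis vector to \<open>x\<close> conjugates the axis
  stretch into this one.\<close>

lemma vol_factor_stretch:
  fixes x :: "real ^ 'n"
  assumes x: "norm x = 1" and c: "c \<noteq> 0"
  shows "vol_factor (\<lambda>v. v + ((c - 1) * (x \<bullet> v)) *\<^sub>R x) = 1 / \<bar>c\<bar>"
proof -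
  obtain b :: "real ^ 'n" where b: "b \<in> Basis" using nonempty_Basis by blast
  obtain g where g: "orthogonal_transformation g" "g b = x"
    using orthogonal_transformation_exists[of b x] b x by (metis norm_Basis)
  define h where "h = inv_into UNIV g"
  have h: "orthogonal_transformation h"
    unfolding h_def by (rule orthogonal_transformation_inv) fact
  have gh: "g (h v) = v" for v
    using g by (simp add: h_def orthogonal_transformation_surj surj_f_inv_f)
  define T where "T = (\<lambda>v. v + ((c - 1) * (b \<bullet> v)) *\<^sub>R b)"
  have lin: "linear T"
    by (intro linearI) (auto simp: T_def algebra_simps inner_add_right)
  have inj: "inj T"
  proof (rule linear_injective_0[THEN iffD2, OF lin, rule_format])
    fix v assume 0: "T v = 0"
    have "b \<bullet> T v = c * (b \<bullet> v)" using b by (simp add: T_def inner_add_right algebra_simps)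
    then have "b \<bullet> v = 0" using 0 c by simp
    then show "v = 0" using 0 by (simp add: T_def)
  qed
  have bh: "b \<bullet> h v = x \<bullet> v" for v
    using g gh by (metis orthogonal_transformation_def)
  have "(\<lambda>v. v + ((c - 1) * (x \<bullet> v)) *\<^sub>R x) = g \<circ> T \<circ> h"
    using g by (auto simp: fun_eq_iff T_def bh gh orthogonal_transformation_linear linear_add linear_scale)
  then show ?thesis
    using lin inj g h vol_factor_stretch_axis[OF b c, folded T_def]
    by (simp add: vol_factor_compose vol_factor_orthogonal linear_compose inj_compose
        orthogonal_transformation_inj orthogonal_transformation_linear)
qed

section \<open>Equality in the Brunn-Minkowski inequality\<close>

text \<open>Prekopa-Leindler for the three indicator functions.\<close>

lemma brunn_minkowski_mult:
  fixes A B C :: "'a::euclidean_space set" and m n :: nat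
  assumes mn: "0 < m" "0 < n" and [measurable]: "A \<in> sets borel" "B \<in> sets borel" "C \<in> sets borel"
    and sub: "\<And>x y. x \<in> A \<Longrightarrow> y \<in> B \<Longrightarrow> (m / (m + n)) *\<^sub>R x + (n / (m + n)) *\<^sub>R y \<in> C"
  shows "emeasure lborel A ^ m * emeasure lborel B ^ n \<le> emeasure lborel C ^ (m + n)"
proof -
  have "(\<integral>\<^sup>+x. indicator A x \<partial>lborel) ^ m * (\<integral>\<^sup>+x. indicator B x \<partial>lborel) ^ n
      \<le> (\<integral>\<^sup>+x. indicator C x \<partial>lborel) ^ (m + n)"
    using mn sub by (intro prekopa_leindler) (auto simp: indicator_def zero_power)
  then show ?thesis by simp
qed

lemma measure_brunn_minkowski_mult:
  fixes A B C :: "'a::euclidean_space set" and m n :: nat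
  assumes mn: "0 < m" "0 < n" and meas: "A \<in> sets borel" "B \<in> sets borel" "C \<in> sets borel"
    and bnd: "bounded A" "bounded B" "bounded C"
    and sub: "\<And>x y. x \<in> A \<Longrightarrow> y \<in> B \<Longrightarrow> (m / (m + n)) *\<^sub>R x + (n / (m + n)) *\<^sub>R y \<in> C"
  shows "measure lborel A ^ m * measure lborel B ^ n \<le> measure lborel C ^ (m + n)"
proof -
  have fin: "emeasure lborel S = ennreal (measure lborel S)" if "bounded S" for S :: "'a set"
    using emeasure_bounded_finite[OF that] by (intro emeasure_eq_ennreal_measure) auto
  have "ennreal (measure lborel A ^ m * measure lborel B ^ n) \<le> ennreal (measure lborel C ^ (m + n))"
    using brunn_minkowski_mult[OF mn meas sub] unfolding fin[OF bnd(1)] fin[OF bnd(2)] fin[OF bnd(3)]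
    by (simp add: ennreal_power ennreal_mult)
  then show ?thesis by (subst (asm) ennreal_le_iff) auto
qed

section \<open>Quantile functions and the equality case of Cauchy-Schwarz\<close>

definition centroid :: "'a::euclidean_space set \<Rightarrow> 'a" where
  "centroid K = (\<integral>x. x \<partial>uniform_measure lborel K)"

text \<open>Points to the left of \<open>I w\<close> have cdf below \<open>w\<close>. Without atoms
  the cdf is continuous at \<open>I w\<close>, so it cannot jump past \<open>w\<close>
  there.\<close>

lemma (in cdf_distribution) cdf_pseudoinverse:
  assumes atomless: "\<And>x. measure M {x} = 0" and w: "0 < w" "w < 1"
  shows "cdf M (I w) = w"
proof (rule antisym)
  show "w \<le> cdf M (I w)" using pseudoinverse[OF w] by blast
  have "isCont (cdf M) (I w)" using atomless isCont_cdf by blast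
  then have "(cdf M \<longlongrightarrow> cdf M (I w)) (at_left (I w))"
    by (simp add: isCont_def filterlim_at_split)
  moreover have "\<forall>\<^sub>F y in at_left (I w). cdf M y \<le> w"
  proof (rule eventually_at_leftI)
    show "cdf M y \<le> w" if "y \<in> {I w - 1<..<I w}" for y
      using pseudoinverse[OF w, of y] that by (simp add: not_le less_imp_le)
  qed simp
  ultimately show "cdf M (I w) \<le> w"
    by (intro tendsto_upperbound) auto
qed

lemma null_sets_lborel_hyperplane:
  fixes u :: "'a::euclidean_space"
  assumes "u \<noteq> 0"
  shows "{x. u \<bullet> x = c} \<in> null_sets lborel"
proof -
  have "negligible {x. u \<bullet> x = c}" using assms by (intro negligible_hyperplane) auto
  then have "emeasure lebesgue {x. u \<bullet> x = c} = 0" by (simp add: negligible_iff_null_sets null_sets_def)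
  moreover have "{x. u \<bullet> x = c} \<in> sets lborel" by (simp add: closed_hyperplane borel_closed)
  ultimately show ?thesis by (simp add: null_sets_def)
qed

text \<open>The hypothesis reverses Cauchy-Schwarz for exp (X / 2) and exp (Y / 2). After division
  by their norms s and t, the square of the difference has integral at most 0, so the two functions
  are proportional almost everywhere and X - Y is the constant 2 ln s - 2 ln t.\<close>

lemma cauchy_schwarz_eq_exp:
  fixes X Y :: "'b \<Rightarrow> real"
  assumes "prob_space \<Omega>" and [measurable]: "X \<in> borel_measurable \<Omega>" "Y \<in> borel_measurable \<Omega>"
    and int: "integrable \<Omega> (\<lambda>w. exp (X w))" "integrable \<Omega> (\<lambda>w. exp (Y w))"
    and le: "(\<integral>w. exp (X w) \<partial>\<Omega>) * (\<integral>w. exp (Y w) \<partial>\<Omega>) \<le> (\<integral>w. exp ((X w + Y w) / 2) \<partial>\<Omega>)\<^sup>2"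
  shows "\<exists>c. AE w in \<Omega>. X w = Y w + c"
proof -
  interpret prob_space \<Omega> by fact
  let ?a = "\<integral>w. exp (X w) \<partial>\<Omega>" and ?b = "\<integral>w. exp (Y w) \<partial>\<Omega>" and ?m = "\<integral>w. exp ((X w + Y w) / 2) \<partial>\<Omega>"
  have pos: "0 < (\<integral>w. exp (Z w) \<partial>\<Omega>)" if "integrable \<Omega> (\<lambda>w. exp (Z w))" for Z :: "'b \<Rightarrow> real"
  proof -
    have "(\<integral>w. exp (Z w) \<partial>\<Omega>) \<noteq> 0"
    proof
      assume "(\<integral>w. exp (Z w) \<partial>\<Omega>) = 0"
      then have "AE w in \<Omega>. exp (Z w) = 0"
        using integral_nonneg_eq_0_iff_AE[OF that] by simp
      then have "AE w in \<Omega>. False" by simp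
      then show False by simp
    qed
    then show ?thesis by (simp add: less_le integral_nonneg_AE)
  qed
  define s t where "s = sqrt ?a" and "t = sqrt ?b"
  have st: "0 < s" "0 < t" "s\<^sup>2 = ?a" "t\<^sup>2 = ?b"
    using pos[OF int(1)] pos[OF int(2)] by (auto simp: s_def t_def)
  have intm: "integrable \<Omega> (\<lambda>w. exp ((X w + Y w) / 2))"
  proof (rule Bochner_Integration.integrable_bound)
    show "integrable \<Omega> (\<lambda>w. exp (X w) + exp (Y w))" using int by simp
    have "exp ((a + b) / 2) \<le> exp a + exp b" for a b :: real
    proof -
      have "exp ((a + b) / 2) \<le> exp (max a b)" by simp
      also have "\<dots> \<le> exp a + exp b" by (simp add: max_def)
      finally show ?thesis .
    qed
    then show "AE w in \<Omega>. norm (exp ((X w + Y w) / 2)) \<le> norm (exp (X w) + exp (Y w))"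
      by (auto simp: abs_of_pos add_pos_pos)
  qed simp
  have m: "s * t \<le> ?m"
  proof (rule power2_le_imp_le)
    show "(s * t)\<^sup>2 \<le> ?m\<^sup>2" using le st by (simp add: power_mult_distrib)
    show "0 \<le> ?m" using pos[OF intm] by simp
  qed
  define F where "F w = exp (X w / 2) / s - exp (Y w / 2) / t" for w
  have F2: "(F w)\<^sup>2 = exp (X w) / ?a + exp (Y w) / ?b - 2 * exp ((X w + Y w) / 2) / (s * t)" for w
  proof -
    have "(exp (X w / 2))\<^sup>2 = exp (X w)" "(exp (Y w / 2))\<^sup>2 = exp (Y w)"
      by (simp_all add: exp_double[symmetric])
    moreover have "exp (X w / 2) * exp (Y w / 2) = exp ((X w + Y w) / 2)"
      by (simp add: exp_add[symmetric] add_divide_distrib)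
    ultimately show ?thesis
      unfolding F_def st(3,4)[symmetric] power2_diff power_divide by (simp add: field_simps)
  qed
  have iF: "integrable \<Omega> (\<lambda>w. (F w)\<^sup>2)"
    unfolding F2 using int intm by simp
  have "(\<integral>w. (F w)\<^sup>2 \<partial>\<Omega>) = ?a / ?a + ?b / ?b - 2 * ?m / (s * t)"
    unfolding F2 using int intm by simp
  also have "\<dots> \<le> 0"
    using st m pos[OF int(1)] pos[OF int(2)] by (simp add: field_simps)
  finally have "(\<integral>w. (F w)\<^sup>2 \<partial>\<Omega>) = 0"
    by (intro antisym) (auto intro: integral_nonneg_AE)
  then have "AE w in \<Omega>. (F w)\<^sup>2 = 0"
    using integral_nonneg_eq_0_iff_AE[OF iF] by simp
  then have "AE w in \<Omega>. X w = Y w + (2 * ln s - 2 * ln t)"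
  proof (rule AE_mp, intro AE_I2 impI)
    fix w assume "(F w)\<^sup>2 = 0"
    then have "exp (X w / 2) / s = exp (Y w / 2) / t" by (simp add: F_def)
    then have "ln (exp (X w / 2) / s) = ln (exp (Y w / 2) / t)" by simp
    then show "X w = Y w + (2 * ln s - 2 * ln t)" using st by (simp add: ln_div)
  qed
  then show ?thesis by blast
qed

section \<open>Marginals of a compact set of positive volume\<close>

definition marginal :: "'a::euclidean_space set \<Rightarrow> 'a \<Rightarrow> real measure" where
  "marginal K u = distr (uniform_measure lborel K) borel (\<lambda>x. u \<bullet> x)"

context
  fixes K :: "'a::euclidean_space set" and u :: 'a
  assumes K: "compact K" "0 < measure lborel K" and u: "u \<noteq> 0"
begin

lemma body_borel [measurable]: "K \<in> sets borel"
  using K by (simp add: borel_compact)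

lemma emeasure_body: "emeasure lborel K = ennreal (measure lborel K)" "emeasure lborel K \<noteq> 0" "emeasure lborel K \<noteq> \<infinity>"
proof -
  show "emeasure lborel K = ennreal (measure lborel K)"
    using emeasure_compact_finite[OF K(1)] by (intro emeasure_eq_ennreal_measure) auto
  then show "emeasure lborel K \<noteq> 0" "emeasure lborel K \<noteq> \<infinity>" using K by auto
qed

lemma prob_space_uniform_body: "prob_space (uniform_measure lborel K)"
  using emeasure_body by (intro prob_space_uniform_measure) auto

lemma real_distribution_marginal: "real_distribution (marginal K u)"
  unfolding marginal_def
  by (intro prob_space.real_distribution_distr prob_space_uniform_body) simp

lemma measure_marginal:
  assumes "A \<in> sets borel"
  shows "measure (marginal K u) A = measure lborel (K \<inter> (\<lambda>x. u \<bullet> x) -` A) / measure lborel K"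
proof -
  have [measurable]: "(\<lambda>x. u \<bullet> x) -` A \<in> sets borel"
    using measurable_sets_borel[of "\<lambda>x. u \<bullet> x" borel A] assms by simp
  show ?thesis
    using assms emeasure_body K by (simp add: marginal_def measure_distr measure_uniform_measure)
qed

lemma marginal_atomless: "measure (marginal K u) {c} = 0"
proof -
  have "K \<inter> (\<lambda>x. u \<bullet> x) -` {c} \<in> null_sets lborel"
    by (rule null_sets_subset[OF null_sets_lborel_hyperplane[OF u, of c]]) auto
  then have "measure lborel (K \<inter> (\<lambda>x. u \<bullet> x) -` {c}) = 0"
    by (simp add: measure_eq_0_null_sets)
  then show ?thesis by (simp add: measure_marginal)
qed

lemma AE_uniform_body: "AE x in uniform_measure lborel K. x \<in> K"
  by (rule AE_uniform_measureI) auto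

lemma integrable_uniform_body:
  fixes f :: "'a \<Rightarrow> 'b::{banach, second_countable_topology}"
  assumes "continuous_on K f" "f \<in> borel_measurable borel"
  shows "integrable (uniform_measure lborel K) f"
proof -
  interpret prob_space "uniform_measure lborel K" by (rule prob_space_uniform_body)
  have "bounded (f ` K)" using assms K compact_continuous_image compact_imp_bounded by blast
  then obtain B where "\<forall>x\<in>K. norm (f x) \<le> B" by (auto simp: bounded_iff)
  then show ?thesis
    using AE_uniform_body assms(2) by (intro integrable_const_bound[where B=B]) auto
qed

lemma integral_marginal_id: "(\<integral>t. t \<partial>marginal K u) = u \<bullet> centroid K"
  unfolding marginal_def centroid_def
  by (subst integral_distr) (auto intro!: integral_inner_right integrable_uniform_body continuous_intros)

lemma integrable_marginal_exp: "integrable (marginal K u) exp"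
  unfolding marginal_def
  by (subst integrable_distr_eq) (auto intro!: integrable_uniform_body continuous_intros)

text \<open>Translates an exponentially weighted volume in space into an integral over the marginal,
  so that the spatial Prekopa-Leindler inequality speaks about one-dimensional
  distributions.\<close>

lemma nn_integral_marginal_exp:
  "(\<integral>\<^sup>+x. ennreal (exp (u \<bullet> x)) * indicator K x \<partial>lborel) = ennreal (measure lborel K * (\<integral>t. exp t \<partial>marginal K u))"
proof -
  have "ennreal (\<integral>t. exp t \<partial>marginal K u) = (\<integral>\<^sup>+t. ennreal (exp t) \<partial>marginal K u)"
    by (intro nn_integral_eq_integral[symmetric] integrable_marginal_exp) simp
  also have "\<dots> = (\<integral>\<^sup>+x. ennreal (exp (u \<bullet> x)) \<partial>uniform_measure lborel K)"
    unfolding marginal_def by (subst nn_integral_distr) auto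
  also have "\<dots> = (\<integral>\<^sup>+x. ennreal (exp (u \<bullet> x)) * indicator K x \<partial>lborel) / ennreal (measure lborel K)"
    using emeasure_body(1) by (subst nn_integral_uniform_measure) auto
  finally have "ennreal (measure lborel K) * ennreal (\<integral>t. exp t \<partial>marginal K u)
      = (\<integral>\<^sup>+x. ennreal (exp (u \<bullet> x)) * indicator K x \<partial>lborel)"
    using K(2) by (simp add: ennreal_times_divide) (subst mult.commute, simp add: ennreal_mult_divide_eq)
  then show ?thesis
    using K(2) by (simp add: ennreal_mult' )
qed

end

text \<open>
  Cutting \<open>K\<close>, \<open>L\<close> and \<open>M\<close> by parallel hyperplanes shows that the quantile function of the
  marginal of \<open>M\<close> is the mean of those of \<open>K\<close> and \<open>L\<close>. Applying the Prekopa-Leindler inequality with the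
  weight \<open>exp (u \<bullet> x)\<close> then gives equality in the Cauchy-Schwarz inequality for the
  exponentials of these quantile functions, so they differ by a constant.
\<close>

lemma marginal_translate:
  fixes K L M :: "'a::euclidean_space set"
  assumes K: "compact K" and L: "compact L" and M: "compact M"
    and V: "measure lborel K = V" "measure lborel L = V" "measure lborel M = V" "0 < V"
    and mid: "\<And>x y. x \<in> K \<Longrightarrow> y \<in> L \<Longrightarrow> (1 / 2) *\<^sub>R x + (1 / 2) *\<^sub>R y \<in> M"
    and u: "u \<noteq> 0"
  shows "marginal K u = distr (marginal L u) borel (\<lambda>t. t + u \<bullet> (centroid K - centroid L))"
proof -
  have pos: "0 < measure lborel K" "0 < measure lborel L" "0 < measure lborel M" using V by auto
  note Kf = K pos(1) u and Lf = L pos(2) u and Mf = M pos(3) u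
  interpret K: cdf_distribution "marginal K u"
    using real_distribution_marginal[OF Kf] by (simp add: cdf_distribution_def)
  interpret L: cdf_distribution "marginal L u"
    using real_distribution_marginal[OF Lf] by (simp add: cdf_distribution_def)
  interpret M: cdf_distribution "marginal M u"
    using real_distribution_marginal[OF Mf] by (simp add: cdf_distribution_def)
  \<comment> \<open>On (0,1) with Lebesgue measure the quantile functions \<open>X\<close> and
    \<open>Y\<close> realize both marginals on one probability space, cut at the same mass
    w.\<close>
  define \<Omega> where "\<Omega> = restrict_space lborel {0<..<1::real}"
  interpret \<Omega>: prob_space \<Omega>
    by (auto simp add: \<Omega>_def emeasure_restrict_space space_restrict_space intro!: prob_spaceI)
  define X Y where "X = K.I" and "Y = L.I"
  have X [measurable]: "X \<in> borel_measurable \<Omega>" and Y [measurable]: "Y \<in> borel_measurable \<Omega>"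
    using K.measurable_CI L.measurable_CI by (simp_all add: X_def Y_def \<Omega>_def cong: measurable_cong_sets sets_restrict_space_cong)
  have dX: "distr \<Omega> borel X = marginal K u" and dY: "distr \<Omega> borel Y = marginal L u"
    unfolding \<Omega>_def X_def Y_def by (rule K.distr_I_eq_M L.distr_I_eq_M)+
  let ?Z = "\<lambda>w. (X w + Y w) / 2"
  have Zm: "?Z \<in> borel_measurable \<Omega>" by measurable
  have quantile: "cdf (marginal M u) (?Z w) = w" if w: "0 < w" "w < 1" for w
  proof -
    define a b where "a = X w" and "b = Y w"
    have ca: "cdf (marginal K u) a = w" and cb: "cdf (marginal L u) b = w"
      unfolding a_def b_def X_def Y_def
      using K.cdf_pseudoinverse[OF marginal_atomless[OF Kf] w] L.cdf_pseudoinverse[OF marginal_atomless[OF Lf] w] by auto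
    have half: "measure (marginal K u) A * measure (marginal L u) B \<le> (measure (marginal M u) C)\<^sup>2"
      if meas: "A \<in> sets borel" "B \<in> sets borel" "C \<in> sets borel"
        and sub: "\<And>s t. s \<in> A \<Longrightarrow> t \<in> B \<Longrightarrow> (s + t) / 2 \<in> C" for A B C
    proof -
      let ?f = "\<lambda>x::'a. u \<bullet> x"
      have b: "?f -` A \<in> sets borel" "?f -` B \<in> sets borel" "?f -` C \<in> sets borel"
        using measurable_sets_borel[of ?f borel] meas by simp_all
      have "measure lborel (K \<inter> ?f -` A) ^ 1 * measure lborel (L \<inter> ?f -` B) ^ 1 \<le> measure lborel (M \<inter> ?f -` C) ^ (1 + 1)"
      proof (rule measure_brunn_minkowski_mult)
        show "bounded (K \<inter> ?f -` A)" "bounded (L \<inter> ?f -` B)" "bounded (M \<inter> ?f -` C)"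
          using K L M by (auto intro: bounded_Int compact_imp_bounded)
        fix x y assume "x \<in> K \<inter> ?f -` A" "y \<in> L \<inter> ?f -` B"
        then show "(real 1 / real (1 + 1)) *\<^sub>R x + (real 1 / real (1 + 1)) *\<^sub>R y \<in> M \<inter> ?f -` C"
          using mid[of x y] sub[of "u \<bullet> x" "u \<bullet> y"] by (simp add: inner_add_right add_divide_distrib)
      qed (use K L M b in \<open>auto simp: borel_compact\<close>)
      then show ?thesis
        using V by (simp add: measure_marginal[OF Kf meas(1)] measure_marginal[OF Lf meas(2)]
            measure_marginal[OF Mf meas(3)] power2_eq_square divide_right_mono)
    qed
    \<comment> \<open>The lower parts of \<open>K\<close> and \<open>L\<close> have mass w, and
      their midpoints force mass at least w of \<open>M\<close> up to \<open>?Z w\<close>; the upper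
      parts force at least 1 - w beyond it. Together the cut at \<open>?Z w\<close> is
      exact.\<close>
    have "w * w \<le> (measure (marginal M u) {..?Z w})\<^sup>2"
      using half[of "{..a}" "{..b}" "{..?Z w}"] ca cb by (auto simp: cdf_def a_def b_def)
    then have lo: "w \<le> measure (marginal M u) {..?Z w}"
      using w by (metis power2_eq_square power2_le_imp_le measure_nonneg)
    have gt: "measure N {c<..} = 1 - cdf N c" if "cdf_distribution N" for N and c :: real
    proof -
      interpret N: cdf_distribution N by fact
      show ?thesis
        using N.prob_compl[of "{..c}"] by (simp add: cdf_def Compl_eq_Diff_UNIV[symmetric])
    qed
    have "(1 - w) * (1 - w) \<le> (measure (marginal M u) {?Z w<..})\<^sup>2"
      using half[of "{a<..}" "{b<..}" "{?Z w<..}"] gt[OF K.cdf_distribution_axioms, of a] gt[OF L.cdf_distribution_axioms, of b] ca cb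
      by (auto simp: a_def b_def)
    then have "1 - w \<le> measure (marginal M u) {?Z w<..}"
      using w by (metis power2_eq_square power2_le_imp_le measure_nonneg)
    then show ?thesis
      using lo gt[OF M.cdf_distribution_axioms, of "?Z w"] by (simp add: cdf_def)
  qed
  \<comment> \<open>By \<open>quantile\<close>, the event that \<open>?Z\<close> is at most x lies
    between (0, c) and (0, c] with c the cdf of the marginal of \<open>M\<close> at x, so its
    probability is c.\<close>
  have dZ: "distr \<Omega> borel ?Z = marginal M u"
  proof (intro cdf_unique ext)
    show "real_distribution (distr \<Omega> borel ?Z)"
      by (intro \<Omega>.real_distribution_distr) simp
    show "real_distribution (marginal M u)" by standard
    fix x
    let ?c = "cdf (marginal M u) x"
    have c: "0 \<le> ?c" "?c \<le> 1" using M.cdf_nonneg M.cdf_bounded_prob by auto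
    have sets: "{w \<in> space \<Omega>. ?Z w \<le> x} \<in> sets \<Omega>" by measurable
    have interval: "measure \<Omega> S = measure lborel S" if "S \<subseteq> {0<..<1}" for S
      using that by (simp add: \<Omega>_def measure_restrict_space)
    have cdfZ: "cdf (distr \<Omega> borel ?Z) x = measure \<Omega> {w \<in> space \<Omega>. ?Z w \<le> x}"
      by (subst cdf_def, subst measure_distr[OF Zm]) (auto intro!: arg_cong[where f="measure \<Omega>"])
    have sp: "space \<Omega> = {0<..<1}" by (simp add: \<Omega>_def space_restrict_space)
    have in_sets: "S \<in> sets \<Omega>" if "S \<in> sets borel" "S \<subseteq> {0<..<1}" for S
      using that by (auto simp: \<Omega>_def sets_restrict_space image_iff)
    have "measure \<Omega> {w \<in> space \<Omega>. ?Z w \<le> x} \<le> measure \<Omega> ({0<..?c} \<inter> {0<..<1})"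
    proof (rule \<Omega>.finite_measure_mono)
      show "{w \<in> space \<Omega>. ?Z w \<le> x} \<subseteq> {0<..?c} \<inter> {0<..<1}"
      proof
        fix w assume "w \<in> {w \<in> space \<Omega>. ?Z w \<le> x}"
        then have w: "0 < w" "w < 1" "?Z w \<le> x" by (auto simp: sp)
        have "w \<le> ?c" using M.cdf_nondecreasing[OF w(3)] quantile[OF w(1,2)] by linarith
        then show "w \<in> {0<..?c} \<inter> {0<..<1}" using w by auto
      qed
    qed (rule in_sets, auto)
    also have "\<dots> \<le> ?c"
    proof -
      have "measure lborel ({0<..?c} \<inter> {0<..<1}) \<le> measure lborel {0<..?c}"
        using c by (intro measure_mono_fmeasurable) (auto simp: fmeasurable_def)
      then show ?thesis using c by (simp add: interval)
    qed
    finally have up: "cdf (distr \<Omega> borel ?Z) x \<le> ?c" by (simp add: cdfZ)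
    have "?c = measure \<Omega> {0<..<?c}" using c by (subst interval) auto
    also have "\<dots> \<le> measure \<Omega> {w \<in> space \<Omega>. ?Z w \<le> x}"
    proof (rule \<Omega>.finite_measure_mono[OF _ sets], rule)
      fix w assume w: "w \<in> {0<..<?c}"
      then have "cdf (marginal M u) (?Z w) < ?c" using quantile c by auto
      then have "?Z w \<le> x" using M.cdf_nondecreasing[of x "?Z w"] by linarith
      then show "w \<in> {w \<in> space \<Omega>. ?Z w \<le> x}" using w c by (auto simp: sp)
    qed
    finally show "cdf (distr \<Omega> borel ?Z) x = ?c" using up cdfZ by simp
  qed
  have int_eq: "(\<integral>w. exp (X w) \<partial>\<Omega>) = (\<integral>t. exp t \<partial>N)" "integrable N exp \<Longrightarrow> integrable \<Omega> (\<lambda>w. exp (X w))"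
    if "distr \<Omega> borel X = N" "X \<in> borel_measurable \<Omega>" for X :: "real \<Rightarrow> real" and N
  proof -
    show "(\<integral>w. exp (X w) \<partial>\<Omega>) = (\<integral>t. exp t \<partial>N)"
      unfolding that(1)[symmetric] using that(2)
      by (subst integral_distr) auto
    show "integrable \<Omega> (\<lambda>w. exp (X w))" if "integrable N exp"
      using that \<open>X \<in> borel_measurable \<Omega>\<close> unfolding \<open>distr \<Omega> borel X = N\<close>[symmetric]
      by (subst (asm) integrable_distr_eq) auto
  qed
  \<comment> \<open>The weight exp (u . x) is log-affine: its value at a midpoint is the geometric
    mean of the end values, so the weighted indicators again satisfy the hypothesis of
    Prekopa-Leindler.\<close>
  have weighted: "(\<integral>t. exp t \<partial>marginal K u) * (\<integral>t. exp t \<partial>marginal L u) \<le> (\<integral>t. exp t \<partial>marginal M u)\<^sup>2"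
  proof -
    let ?f = "\<lambda>S x. ennreal (exp (u \<bullet> x)) * indicator S x"
    have "(\<integral>\<^sup>+x. ?f K x \<partial>lborel) ^ 1 * (\<integral>\<^sup>+x. ?f L x \<partial>lborel) ^ 1 \<le> (\<integral>\<^sup>+x. ?f M x \<partial>lborel) ^ (1 + 1)"
    proof (rule prekopa_leindler)
      fix x y :: 'a
      show "?f K x ^ 1 * ?f L y ^ 1
          \<le> ?f M ((real 1 / real (1 + 1)) *\<^sub>R x + (real 1 / real (1 + 1)) *\<^sub>R y) ^ (1 + 1)"
      proof (cases "x \<in> K \<and> y \<in> L")
        case True
        have "exp (u \<bullet> x) * exp (u \<bullet> y) = exp (u \<bullet> ((1 / 2) *\<^sub>R x + (1 / 2) *\<^sub>R y)) ^ 2"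
          by (simp add: exp_add[symmetric] exp_double[symmetric] inner_add_right)
        then show ?thesis
          using True mid[of x y] by (simp add: ennreal_mult[symmetric] ennreal_power power2_eq_square)
      qed auto
    qed (use K L M in \<open>auto intro!: borel_measurable_times_ennreal borel_measurable_indicator simp: borel_compact\<close>)
    moreover have nn: "0 \<le> (\<integral>t. exp t \<partial>N)" for N :: "real measure" by (auto intro: integral_nonneg_AE)
    ultimately have "ennreal (V * (\<integral>t. exp t \<partial>marginal K u) * (V * (\<integral>t. exp t \<partial>marginal L u)))
        \<le> ennreal ((V * (\<integral>t. exp t \<partial>marginal M u))\<^sup>2)"
      using V(4) unfolding nn_integral_marginal_exp[OF Kf] nn_integral_marginal_exp[OF Lf] nn_integral_marginal_exp[OF Mf] V
      by (simp add: ennreal_mult ennreal_power power2_eq_square)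
    then have "V * V * ((\<integral>t. exp t \<partial>marginal K u) * (\<integral>t. exp t \<partial>marginal L u)) \<le> V * V * (\<integral>t. exp t \<partial>marginal M u)\<^sup>2"
      using V(4) nn by (subst (asm) ennreal_le_iff) (auto simp: power2_eq_square ac_simps)
    then show ?thesis using V(4) by (simp add: mult_le_cancel_left_pos)
  qed
  obtain c where c: "AE w in \<Omega>. X w = Y w + c"
    using cauchy_schwarz_eq_exp[OF \<Omega>.prob_space_axioms X Y int_eq(2)[OF dX X integrable_marginal_exp[OF Kf]]
        int_eq(2)[OF dY Y integrable_marginal_exp[OF Lf]]]
      weighted int_eq(1)[OF dX X] int_eq(1)[OF dY Y] int_eq(1)[OF dZ Zm] by auto
  have "marginal K u = distr \<Omega> borel (\<lambda>w. Y w + c)"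
    unfolding dX[symmetric] using c by (intro distr_cong_AE) auto
  also have "\<dots> = distr (marginal L u) borel (\<lambda>t. t + c)"
    unfolding dY[symmetric] by (subst distr_distr) (auto simp: comp_def)
  finally have eq: "marginal K u = distr (marginal L u) borel (\<lambda>t. t + c)" .
  have "integrable (uniform_measure lborel L) (\<lambda>x. u \<bullet> x)"
    by (intro integrable_uniform_body[OF Lf] continuous_intros) simp
  then have intL: "integrable (marginal L u) (\<lambda>t. t)"
    unfolding marginal_def by (subst integrable_distr_eq) auto
  \<comment> \<open>Taking expectations identifies the constant \<open>c\<close> as the inner
    product of u with the difference of the centroids. This gives one translation vector common to
    all directions.\<close>
  have "u \<bullet> centroid K = (\<integral>t. t + c \<partial>marginal L u)"
    unfolding integral_marginal_id[OF Kf, symmetric] eq by (subst integral_distr) auto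
  also have "\<dots> = u \<bullet> centroid L + c"
    using intL L.prob_space by (simp add: integral_marginal_id[OF Lf])
  finally show ?thesis using eq by (simp add: inner_diff_right)
qed

section \<open>From equal marginals to equal convex bodies\<close>

lemma measure_lborel_interior_pos:
  fixes S :: "'a::euclidean_space set"
  assumes "bounded S" "S \<in> sets borel" "x \<in> interior S"
  shows "0 < measure lborel S"
proof -
  obtain e where e: "0 < e" "ball x e \<subseteq> S" using assms(3) mem_interior by blast
  have "0 < measure lborel (ball x e)" using content_ball_pos[OF e(1)] by simp
  also have "\<dots> \<le> measure lborel S"
    using assms e emeasure_bounded_finite[OF assms(1)]
    by (intro measure_mono_fmeasurable) (auto simp: fmeasurable_def)
  finally show ?thesis .
qed

text \<open>An interior point of \<open>K\<close> outside the translate of \<open>L\<close> could be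
  cut off by a half-space disjoint from that translate. The half-space would have positive mass for
  the marginal of \<open>K\<close> but none for the shifted marginal of \<open>L\<close>. Since
  \<open>K\<close> is the closure of its interior, interior points suffice.\<close>

lemma marginal_translate_imp_subset:
  fixes K L :: "'a::euclidean_space set"
  assumes K: "compact K" "convex K" "interior K \<noteq> {}" and L: "compact L" "convex L" "0 < measure lborel L"
    and marg: "\<And>u. u \<noteq> 0 \<Longrightarrow> marginal K u = distr (marginal L u) borel (\<lambda>t. t + u \<bullet> v)"
  shows "K \<subseteq> (+) v ` L"
proof -
  have pos: "0 < measure lborel K"
    using K measure_lborel_interior_pos[of K] by (auto simp: compact_imp_bounded borel_compact)
  have vL: "closed ((+) v ` L)" "convex ((+) v ` L)" "(+) v ` L \<noteq> {}"
    using L by (auto intro: compact_imp_closed compact_translation convex_translation)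
  have "interior K \<subseteq> (+) v ` L"
  proof (rule ccontr)
    assume "\<not> interior K \<subseteq> (+) v ` L"
    then obtain y where y: "y \<in> interior K" "y \<notin> (+) v ` L" by blast
    obtain a b where ab: "a \<bullet> y < b" "\<And>x. x \<in> (+) v ` L \<Longrightarrow> b < a \<bullet> x"
      using separating_hyperplane_closed_point[OF vL(2,1) y(2)] by blast
    have "a \<noteq> 0" using ab vL(3) by force
    let ?S = "K \<inter> (\<lambda>x. a \<bullet> x) -` {..<b}"
    have op: "open ((\<lambda>x. a \<bullet> x) -` {..<b})" by (intro open_vimage open_lessThan continuous_intros)
    have "y \<in> interior ?S" using y ab op by (simp add: interior_Int interior_open)
    then have "0 < measure lborel ?S"
      using K op by (intro measure_lborel_interior_pos[of _ y]) (auto simp: bounded_Int compact_imp_bounded borel_compact)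
    then have "0 < measure (marginal K a) {..<b}"
      using pos by (simp add: measure_marginal[OF K(1) pos \<open>a \<noteq> 0\<close>])
    also have "measure (marginal K a) {..<b} = measure (marginal L a) ((\<lambda>t. t + a \<bullet> v) -` {..<b})"
      by (subst marg[OF \<open>a \<noteq> 0\<close>], subst measure_distr) (auto simp: marginal_def)
    also have "\<dots> = measure lborel (L \<inter> (\<lambda>x. a \<bullet> x) -` ((\<lambda>t. t + a \<bullet> v) -` {..<b})) / measure lborel L"
    proof (rule measure_marginal[OF L(1,3) \<open>a \<noteq> 0\<close>])
      show "(\<lambda>t. t + a \<bullet> v) -` {..<b} \<in> sets borel"
        using measurable_sets_borel[of "\<lambda>t. t + a \<bullet> v" borel "{..<b}"] by simp
    qed
    also have "L \<inter> (\<lambda>x. a \<bullet> x) -` ((\<lambda>t. t + a \<bullet> v) -` {..<b}) = {}"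
      using ab(2) by (force simp: inner_add_right add.commute)
    finally show False by simp
  qed
  then have "closure (interior K) \<subseteq> (+) v ` L" using vL(1) by (simp add: closure_minimal)
  then show ?thesis
    using K convex_closure_interior[of K] by (simp add: closure_closed compact_imp_closed)
qed

theorem brunn_minkowski_equality:
  fixes K L M :: "'a::euclidean_space set"
  assumes K: "compact K" "convex K" "interior K \<noteq> {}" and L: "compact L" "convex L" "interior L \<noteq> {}"
    and M: "compact M"
    and eq: "measure lborel L = measure lborel K" "measure lborel M = measure lborel K"
    and mid: "\<And>x y. x \<in> K \<Longrightarrow> y \<in> L \<Longrightarrow> (1 / 2) *\<^sub>R x + (1 / 2) *\<^sub>R y \<in> M"
  shows "K = (+) (centroid K - centroid L) ` L"
proof
  have pos: "0 < measure lborel K"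
    using K measure_lborel_interior_pos[of K] by (auto simp: compact_imp_bounded borel_compact)
  show "K \<subseteq> (+) (centroid K - centroid L) ` L"
  proof (rule marginal_translate_imp_subset[OF K L(1,2)])
    show "marginal K u = distr (marginal L u) borel (\<lambda>t. t + u \<bullet> (centroid K - centroid L))" if "u \<noteq> 0" for u
      using that eq pos mid by (intro marginal_translate[OF K(1) L(1) M, of "measure lborel K"]) auto
  qed (use eq pos in simp)
  have mid': "\<And>x y. x \<in> L \<Longrightarrow> y \<in> K \<Longrightarrow> (1 / 2) *\<^sub>R x + (1 / 2) *\<^sub>R y \<in> M"
    using mid by (metis add.commute)
  have "L \<subseteq> (+) (centroid L - centroid K) ` K"
  proof (rule marginal_translate_imp_subset[OF L K(1,2)])
    show "marginal L u = distr (marginal K u) borel (\<lambda>t. t + u \<bullet> (centroid L - centroid K))" if "u \<noteq> 0" for u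
      using that eq pos mid' by (intro marginal_translate[OF L(1) K(1) M, of "measure lborel K"]) auto
  qed (use eq pos in simp)
  then show "(+) (centroid K - centroid L) ` L \<subseteq> K"
    by force
qed

section \<open>Volume of cones\<close>

lemma measure_lborel_affine_image:
  fixes S :: "'a::euclidean_space set"
  assumes "compact S" "0 \<le> r"
  shows "measure lborel ((\<lambda>x. c + r *\<^sub>R x) ` S) = r ^ DIM('a) * measure lborel S"
proof -
  have im: "compact ((\<lambda>x. c + r *\<^sub>R x) ` S)"
    using assms by (intro compact_continuous_image continuous_intros)
  have "measure lebesgue ((\<lambda>x. r *\<^sub>R x + c) ` S) = \<bar>r\<bar> ^ DIM('a) * measure lebesgue S"
    by (rule measure_lebesgue_affine)
  then show ?thesis
    using assms im by (simp add: measure_completion borel_compact add.commute)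
qed

definition cone_over :: "'a::real_vector set \<Rightarrow> 'a set" where
  "cone_over F = (\<lambda>(r, z). r *\<^sub>R z) ` ({0..1} \<times> F)"

lemma compact_cone_over:
  fixes F :: "'a::real_normed_vector set"
  assumes "compact F"
  shows "compact (cone_over F)"
  unfolding cone_over_def using assms
  by (intro compact_continuous_image compact_Times) (auto intro!: continuous_intros simp: case_prod_beta)

lemma cone_overI: "0 \<le> r \<Longrightarrow> r \<le> 1 \<Longrightarrow> z \<in> F \<Longrightarrow> y = r *\<^sub>R z \<Longrightarrow> y \<in> cone_over F"
  by (auto simp: cone_over_def image_iff)

lemma cone_overE:
  assumes "y \<in> cone_over F"
  obtains r z where "0 \<le> r" "r \<le> 1" "z \<in> F" "y = r *\<^sub>R z"
  using assms by (auto simp: cone_over_def)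

text \<open>The axis \<open>v\<close> need not be normal to the base. For a unit normal this is the
  solid behind \<open>hyperplane_area\<close>.\<close>

definition prism :: "'a::real_vector \<Rightarrow> 'a set \<Rightarrow> 'a set" where
  "prism v F = (\<lambda>(s, w). w + s *\<^sub>R v) ` ({0..1} \<times> F)"

lemma compact_prism:
  fixes F :: "'a::real_normed_vector set"
  assumes "compact F"
  shows "compact (prism v F)"
  unfolding prism_def using assms
  by (intro compact_continuous_image compact_Times) (auto intro!: continuous_intros simp: case_prod_beta)

lemma prismI: "0 \<le> s \<Longrightarrow> s \<le> 1 \<Longrightarrow> w \<in> F \<Longrightarrow> y = w + s *\<^sub>R v \<Longrightarrow> y \<in> prism v F"
  by (auto simp: prism_def image_iff)

lemma prismE:
  assumes "y \<in> prism v F"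
  obtains s w where "0 \<le> s" "s \<le> 1" "w \<in> F" "y = w + s *\<^sub>R v"
  using assms by (auto simp: prism_def)

lemma hyperplane_area_eq_prism:
  assumes "compact F"
  shows "hyperplane_area u F = measure lborel (prism u F)"
proof -
  have "{y + s *\<^sub>R u | y s. y \<in> F \<and> s \<in> {0..1}} = prism u F"
    by (auto simp: prism_def image_iff) blast+
  then show ?thesis
    using compact_prism[OF assms, of u]
    by (simp add: hyperplane_area_def measure_completion borel_compact)
qed

text \<open>A stretch \<open>S\<close> along the normal, a shear \<open>R\<close> parallel to the
  base and a translation carry the right prism to the oblique one. Only \<open>S\<close> changes
  volume, by t h, the height of the oblique prism. Its constant \<open>c\<close> is negative because
  this prism points from the base toward the side of the origin.\<close>

lemma measure_oblique_prism:
  fixes F :: "(real ^ 'n) set"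
  assumes x: "norm x = 1" and F: "compact F" and flat: "\<And>w. w \<in> F \<Longrightarrow> x \<bullet> w = h"
    and t: "x \<bullet> p = h" "0 < h" "0 < t"
  shows "measure lborel (prism (- t *\<^sub>R p) F) = t * h * measure lborel (prism x F)"
proof -
  have xx: "x \<bullet> x = 1" using x by (simp add: norm_eq_1)
  define c where "c = - (t * h)"
  have c: "c \<noteq> 0" "\<bar>c\<bar> = t * h" using t by (auto simp: c_def)
  define S where "S v = v + ((c - 1) * (x \<bullet> v)) *\<^sub>R x" for v
  \<comment> \<open>Chosen so that \<open>S\<close> followed by \<open>R\<close> sends x to c (x +
    q) = (c / h) p = - t p, the required axis; \<open>q\<close> is orthogonal to x because p has
    height h.\<close>
  define q where "q = (1 / h) *\<^sub>R p - x"
  have "x \<bullet> q = 0" using t xx by (simp add: q_def inner_diff_right)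
  then have q: "q \<bullet> x = 0" by (simp add: inner_commute)
  define R where "R v = v + (x \<bullet> v) *\<^sub>R q" for v
  have lin: "linear S" "linear R"
    by (auto intro!: linearI simp: S_def R_def algebra_simps inner_add_right)
  have xS: "x \<bullet> S v = c * (x \<bullet> v)" for v
    using xx by (simp add: S_def inner_add_right algebra_simps)
  have xR: "x \<bullet> R v = x \<bullet> v" for v
    using q by (simp add: R_def inner_add_right inner_commute)
  have inj: "inj S" "inj R"
  proof -
    show "inj S"
    proof (rule linear_injective_0[THEN iffD2, OF lin(1), rule_format])
      fix v assume 0: "S v = 0"
      then have "x \<bullet> v = 0" using xS[of v] c by simp
      then show "v = 0" using 0 by (simp add: S_def)
    qed
    show "inj R"
    proof (rule linear_injective_0[THEN iffD2, OF lin(2), rule_format])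
      fix v assume 0: "R v = 0"
      then have "x \<bullet> v = 0" using xR[of v] by simp
      then show "v = 0" using 0 by (simp add: R_def)
    qed
  qed
  have RS: "(R \<circ> S) v = v - (x \<bullet> v) *\<^sub>R (x + t *\<^sub>R p)" for v
  proof -
    have "(R \<circ> S) v = v + ((c - 1) * (x \<bullet> v)) *\<^sub>R x + (c * (x \<bullet> v)) *\<^sub>R q"
      by (simp add: R_def xS) (simp add: S_def)
    also have "\<dots> = v + (x \<bullet> v) *\<^sub>R ((c / h) *\<^sub>R p - x)"
      by (simp add: q_def algebra_simps)
    also have "(c / h) *\<^sub>R p = - t *\<^sub>R p" using t by (simp add: c_def)
    finally show ?thesis by (simp add: algebra_simps)
  qed
  have shape: "prism (- t *\<^sub>R p) F = (+) (h *\<^sub>R (x + t *\<^sub>R p)) ` (R \<circ> S) ` prism x F"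
  proof -
    have pt: "h *\<^sub>R (x + t *\<^sub>R p) + (R \<circ> S) (w + s *\<^sub>R x) = w + s *\<^sub>R (- t *\<^sub>R p)" if "w \<in> F" for w s
      unfolding RS using flat[OF that] xx by (simp add: inner_add_right algebra_simps)
    show ?thesis
    proof (intro equalityI subsetI)
      fix y assume "y \<in> prism (- t *\<^sub>R p) F"
      then obtain s w where "0 \<le> s" "s \<le> 1" "w \<in> F" "y = w + s *\<^sub>R (- t *\<^sub>R p)" by (rule prismE)
      then show "y \<in> (+) (h *\<^sub>R (x + t *\<^sub>R p)) ` (R \<circ> S) ` prism x F"
        using pt[of w s] by (metis image_eqI prismI)
    next
      fix y assume "y \<in> (+) (h *\<^sub>R (x + t *\<^sub>R p)) ` (R \<circ> S) ` prism x F"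
      then obtain z where z: "z \<in> prism x F" "y = h *\<^sub>R (x + t *\<^sub>R p) + (R \<circ> S) z" by auto
      from z(1) obtain s w where "0 \<le> s" "s \<le> 1" "w \<in> F" "z = w + s *\<^sub>R x" by (rule prismE)
      then show "y \<in> prism (- t *\<^sub>R p) F" using pt[of w s] z(2) by (metis prismI)
    qed
  qed
  have P: "compact (prism x F)" by (rule compact_prism) fact
  have lRS: "linear (R \<circ> S)" "inj (R \<circ> S)"
    using lin inj by (auto intro: linear_compose inj_compose)
  have "vol_factor (R \<circ> S) = 1 / (t * h)"
    using lin inj vol_factor_shear[OF q] vol_factor_stretch[OF x c(1)] c(2)
    by (simp add: vol_factor_compose R_def[abs_def] S_def[abs_def])
  then have "measure lborel ((R \<circ> S) ` prism x F) = t * h * measure lborel (prism x F)"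
    using measure_linear_image_vol_factor[OF lRS P] t by simp
  moreover have "compact ((R \<circ> S) ` prism x F)"
    using lRS(1) by (intro compact_continuous_image linear_continuous_on P) (simp only: linear_linear)
  ultimately show ?thesis
    using measure_lborel_affine_image[of "(R \<circ> S) ` prism x F" 1 "h *\<^sub>R (x + t *\<^sub>R p)"]
    unfolding shape by simp
qed

text \<open>
  For \<open>0 < r < 1\<close>, the truncated cone between the heights \<open>r h\<close> and \<open>h\<close> lies between two oblique
  prisms with axis along a point \<open>p\<close> of the base; then let \<open>r\<close> tend to 1.
\<close>

lemma measure_cone_over:
  fixes F :: "(real ^ 'n) set"
  assumes x: "norm x = 1" and F: "compact F" "convex F" and flat: "\<And>w. w \<in> F \<Longrightarrow> x \<bullet> w = h" and h: "0 < h"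
  shows "real CARD('n) * measure lborel (cone_over F) = h * measure lborel (prism x F)"
proof (cases "F = {}")
  case True
  then show ?thesis by (simp add: cone_over_def prism_def)
next
  case False
  then obtain p where p: "p \<in> F" by blast
  let ?d = "CARD('n)"
  let ?C = "cone_over F"
  define c where "c = measure lborel ?C"
  define A where "A = h * measure lborel (prism x F)"
  \<comment> \<open>Since 1 - r ^ d = (1 - r) q r, dividing the volume of the truncated cone by 1 -
    r leaves \<open>q r\<close>. Its limit d at r = 1 is the factor \<open>CARD('n)\<close> of the
    pyramid formula.\<close>
  define q where "q r = (\<Sum>i<?d. r ^ i)" for r :: real
  have C: "compact ?C" by (rule compact_cone_over) fact
  have conv: "(1 - \<rho>) *\<^sub>R p + \<rho> *\<^sub>R w \<in> F" if "w \<in> F" "0 \<le> \<rho>" "\<rho> \<le> 1" for w \<rho>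
    using convexD_alt[OF F(2) p that(1), of \<rho>] that by simp
  have bounds: "q r * c \<le> A" "r ^ (?d - 1) * A \<le> q r * c" if r: "0 < r" "r < 1" for r
  proof -
    define t where "t = 1 - r"
    have t: "0 < t" "t < 1" and rt: "r = 1 - t" using r by (auto simp: t_def)
    let ?rC = "(\<lambda>y. 0 + r *\<^sub>R y) ` ?C"
    have rC: "compact ?rC" using C by (intro compact_continuous_image continuous_intros)
    have mrC: "measure lborel ?rC = r ^ ?d * c"
      using measure_lborel_affine_image[OF C, of r 0] r by (simp add: c_def)
    have pow: "1 - r ^ ?d = t * q r" unfolding t_def q_def by (rule one_diff_power_eq)
    let ?T = "\<lambda>\<tau>. prism (- \<tau> *\<^sub>R p) F"
    have T: "compact (?T \<tau>)" for \<tau> by (rule compact_prism) fact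
    have mT: "measure lborel (?T \<tau>) = \<tau> * A" if "0 < \<tau>" for \<tau>
      using measure_oblique_prism[OF x F(1) flat flat[OF p] h that] by (simp add: A_def)
    have "?C \<subseteq> ?rC \<union> ?T t"
    proof
      fix y assume "y \<in> ?C"
      then obtain \<rho> w where y: "0 \<le> \<rho>" "\<rho> \<le> 1" "w \<in> F" "y = \<rho> *\<^sub>R w" by (rule cone_overE)
      show "y \<in> ?rC \<union> ?T t"
      proof (cases "\<rho> \<le> r")
        case True
        have "(\<rho> / r) *\<^sub>R w \<in> ?C" using y True r by (intro cone_overI[of "\<rho> / r" w]) auto
        moreover have "y = 0 + r *\<^sub>R ((\<rho> / r) *\<^sub>R w)" using y r by simp
        ultimately show ?thesis by blast
      next
        case False
        \<comment> \<open>The point \<rho> w is the base point (1 - \<rho>) p + \<rho> w pushed back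
          by (1 - \<rho>) p, which is at most t p as \<rho> > r.\<close>
        have "y \<in> ?T t"
        proof (rule prismI)
          show "(1 - \<rho>) *\<^sub>R p + \<rho> *\<^sub>R w \<in> F" using conv y by blast
          show "0 \<le> (1 - \<rho>) / t" "(1 - \<rho>) / t \<le> 1" using y False t by (auto simp: t_def)
          have "((1 - \<rho>) / t) *\<^sub>R (- t *\<^sub>R p) = - ((1 - \<rho>) *\<^sub>R p)" using t by simp
          then show "y = (1 - \<rho>) *\<^sub>R p + \<rho> *\<^sub>R w + ((1 - \<rho>) / t) *\<^sub>R (- t *\<^sub>R p)"
            unfolding y(4) by (simp only:) simp
        qed
        then show ?thesis by simp
      qed
    qed
    then have "c \<le> measure lborel (?rC \<union> ?T t)"
      unfolding c_def using C rC T
      by (intro measure_mono_fmeasurable fmeasurable_compact) (auto simp: borel_compact)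
    also have "\<dots> \<le> measure lborel ?rC + measure lborel (?T t)"
      using rC T by (intro measure_Un_le) (auto simp: borel_compact)
    also have "\<dots> = r ^ ?d * c + t * A"
      using mrC mT[OF t(1)] by (simp only:)
    finally have "(1 - r ^ ?d) * c \<le> t * A"
      by (simp add: left_diff_distrib)
    then have "t * (q r * c) \<le> t * A"
      by (simp add: pow mult.assoc)
    then show "q r * c \<le> A" using t by simp
    \<comment> \<open>Inner prism over the shrunken base t p + r F, contained in \<open>F\<close>.
      The parameter t / r compensates the scaling by r, so the axis becomes - t p and the heights
      run from h down to r h.\<close>
    let ?U = "(\<lambda>y. t *\<^sub>R p + r *\<^sub>R y) ` ?T (t / r)"
    have U: "compact ?U" using T by (intro compact_continuous_image continuous_intros)
    have mU: "measure lborel ?U = r ^ ?d * (t / r * A)"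
    proof -
      have "measure lborel (?T (t / r)) = t / r * A" using r t by (intro mT) simp
      then show ?thesis
        using measure_lborel_affine_image[OF T, of r "t *\<^sub>R p" "t / r"] r by (simp only: less_imp_le) simp
    qed
    have Uform: "\<exists>s w. 0 \<le> s \<and> s \<le> 1 \<and> w \<in> F \<and> y = (1 - r - s * t) *\<^sub>R p + r *\<^sub>R w" if "y \<in> ?U" for y
    proof -
      obtain z where z: "z \<in> ?T (t / r)" "y = t *\<^sub>R p + r *\<^sub>R z" using \<open>y \<in> ?U\<close> by auto
      from z(1) obtain s w where s: "0 \<le> s" "s \<le> 1" "w \<in> F" "z = w + s *\<^sub>R (- (t / r) *\<^sub>R p)" by (rule prismE)
      have rz: "r *\<^sub>R z = r *\<^sub>R w - (s * t) *\<^sub>R p" unfolding s(4) using r by (simp add: scaleR_add_right scaleR_diff_right)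
      have "1 - r - s * t = t - s * t" by (simp add: t_def)
      then have "y = (1 - r - s * t) *\<^sub>R p + r *\<^sub>R w" by (simp add: z(2) rz scaleR_diff_left)
      then show ?thesis using s by blast
    qed
    have UC: "?U \<subseteq> ?C"
    proof
      fix y assume "y \<in> ?U"
      then obtain s w where s: "0 \<le> s" "s \<le> 1" "w \<in> F" "y = (1 - r - s * t) *\<^sub>R p + r *\<^sub>R w"
        using Uform by blast
      define \<rho> where "\<rho> = 1 - s * t"
      have "s * t \<le> t" using s t by (simp add: mult_left_le_one_le)
      moreover have "0 \<le> s * t" using s t by simp
      ultimately have \<rho>: "r \<le> \<rho>" "\<rho> \<le> 1" using rt unfolding \<rho>_def by linarith+
      show "y \<in> ?C"
      proof (rule cone_overI)
        show "0 \<le> \<rho>" "\<rho> \<le> 1" using \<rho> r by auto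
        show "(1 - r / \<rho>) *\<^sub>R p + (r / \<rho>) *\<^sub>R w \<in> F" using \<rho> r s by (intro conv) auto
        have "\<rho> * (1 - r / \<rho>) = 1 - r - s * t" "\<rho> * (r / \<rho>) = r"
          using \<rho> r by (auto simp: \<rho>_def field_simps)
        then show "y = \<rho> *\<^sub>R ((1 - r / \<rho>) *\<^sub>R p + (r / \<rho>) *\<^sub>R w)"
          using s(4) by (simp add: scaleR_add_right)
      qed
    qed
    have rCC: "?rC \<subseteq> ?C"
    proof
      fix y assume "y \<in> ?rC"
      then obtain z where z: "z \<in> ?C" "y = r *\<^sub>R z" by auto
      from z(1) obtain \<rho> w where y: "0 \<le> \<rho>" "\<rho> \<le> 1" "w \<in> F" "z = \<rho> *\<^sub>R w" by (rule cone_overE)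
      show "y \<in> ?C" using y z r by (intro cone_overI[of "r * \<rho>" w]) (auto intro: mult_le_one)
    qed
    have flat_int: "x \<bullet> y = r * h" if "y \<in> ?rC" "y \<in> ?U" for y
    proof (rule antisym)
      obtain z where z: "z \<in> ?C" "y = r *\<^sub>R z" using \<open>y \<in> ?rC\<close> by auto
      from z(1) obtain \<rho> w where y: "0 \<le> \<rho>" "\<rho> \<le> 1" "w \<in> F" "z = \<rho> *\<^sub>R w" by (rule cone_overE)
      show "x \<bullet> y \<le> r * h" using z y flat[OF y(3)] r h by (simp add: mult_left_le_one_le)
      obtain s w where s: "0 \<le> s" "s \<le> 1" "w \<in> F" "y = (1 - r - s * t) *\<^sub>R p + r *\<^sub>R w"
        using Uform[OF \<open>y \<in> ?U\<close>] by blast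
      have "x \<bullet> y = (1 - s * t) * h"
        unfolding s(4) using flat[OF p] flat[OF s(3)] by (simp add: inner_add_right algebra_simps)
      moreover have "s * t \<le> t" using s t by (simp add: mult_left_le_one_le)
      then have "r \<le> 1 - s * t" using rt by linarith
      ultimately show "r * h \<le> x \<bullet> y" using h by (simp add: mult_right_mono)
    qed
    have "x \<noteq> 0" using x by auto
    have "AE y in lborel. y \<notin> ?rC \<or> y \<notin> ?U"
      using AE_not_in[OF null_sets_lborel_hyperplane[OF \<open>x \<noteq> 0\<close>, of "r * h"]]
      by eventually_elim (use flat_int in blast)
    then have "measure lborel ?rC + measure lborel ?U = measure lborel (?rC \<union> ?U)"
      using rC U by (intro measure_Un_AE[symmetric] fmeasurable_compact)
    also have "\<dots> \<le> c"
      unfolding c_def using C rC U UC rCC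
      by (intro measure_mono_fmeasurable fmeasurable_compact) (auto simp: borel_compact)
    finally have "r ^ ?d * (t / r * A) \<le> (1 - r ^ ?d) * c"
      unfolding mrC mU by (simp add: left_diff_distrib)
    then have "r ^ ?d * (t / r * A) \<le> t * (q r * c)"
      by (simp only: pow mult.assoc)
    moreover have "r ^ ?d = r * r ^ (?d - 1)" by (metis power_eq_if zero_less_card_finite less_irrefl)
    ultimately have "t * (r ^ (?d - 1) * A) \<le> t * (q r * c)" using r by (simp add: ac_simps)
    then show "r ^ (?d - 1) * A \<le> q r * c" using t by simp
  qed
  have ev: "\<forall>\<^sub>F r in at_left 1. 0 < r \<and> r < (1::real)"
    by (rule eventually_at_leftI[of 0]) auto
  have lq: "((\<lambda>r. q r * c) \<longlongrightarrow> q 1 * c) (at_left 1)"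
    unfolding q_def by (intro tendsto_intros)
  have lA: "((\<lambda>r. r ^ (?d - 1) * A) \<longlongrightarrow> 1 ^ (?d - 1) * A) (at_left (1::real))"
    by (intro tendsto_intros)
  have "q 1 * c \<le> A"
  proof (rule tendsto_upperbound[OF lq])
    show "\<forall>\<^sub>F r in at_left 1. q r * c \<le> A"
      by (rule eventually_mono[OF ev]) (use bounds in blast)
  qed simp
  moreover have "1 ^ (?d - 1) * A \<le> q 1 * c"
  proof (rule tendsto_le[OF _ lq lA])
    show "\<forall>\<^sub>F r in at_left 1. r ^ (?d - 1) * A \<le> q r * c"
      by (rule eventually_mono[OF ev]) (use bounds in blast)
  qed simp
  ultimately show ?thesis by (simp add: q_def c_def A_def)
qed

section \<open>Wulff shapes with facets of equal area\<close>

definition wulff :: "'a::real_inner set \<Rightarrow> ('a \<Rightarrow> real) \<Rightarrow> 'a set" where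
  "wulff X k = {y. \<forall>x\<in>X. x \<bullet> y \<le> k x}"

lemma closed_wulff: "closed (wulff X k)"
proof -
  have "wulff X k = (\<Inter>x\<in>X. {y. x \<bullet> y \<le> k x})" by (auto simp: wulff_def)
  then show ?thesis by (auto intro!: closed_INT closed_halfspace_le)
qed

lemma convex_wulff: "convex (wulff X k)"
proof -
  have "wulff X k = (\<Inter>x\<in>X. {y. x \<bullet> y \<le> k x})" by (auto simp: wulff_def)
  then show ?thesis by (auto intro!: convex_INT convex_halfspace_le)
qed

lemma wulff_cong: "(\<And>x. x \<in> X \<Longrightarrow> k x = l x) \<Longrightarrow> wulff X k = wulff X l"
  by (simp add: wulff_def)

text \<open>The form of a Minkowski polytope suited to the volume argument: with an interior point
  at 0, all support numbers \<open>h x\<close> are positive and the cones from 0 over the facets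
  fill \<open>P\<close>. The heights are kept as a function on normals so that they can be
  varied.\<close>

locale equifacetal =
  fixes X P :: "(real ^ 'n) set" and h :: "real ^ 'n \<Rightarrow> real" and a :: real
  assumes finite_X: "finite X" and X_sphere: "X \<subseteq> sphere 0 1"
    and compact_P: "compact P" and convex_P: "convex P" and zero_interior: "0 \<in> interior P"
    and upper: "\<And>x y. x \<in> X \<Longrightarrow> y \<in> P \<Longrightarrow> x \<bullet> y \<le> h x"
    and boundary: "\<And>y. y \<in> frontier P \<Longrightarrow> \<exists>x\<in>X. x \<bullet> y = h x"
    and area: "\<And>x. x \<in> X \<Longrightarrow> hyperplane_area x {y \<in> P. x \<bullet> y = h x} = a"
begin

abbreviation face :: "real ^ 'n \<Rightarrow> (real ^ 'n) set" where
  "face x \<equiv> {y \<in> P. x \<bullet> y = h x}"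

abbreviation vol :: "(real ^ 'n \<Rightarrow> real) \<Rightarrow> real" where
  "vol k \<equiv> measure lborel (wulff X k)"

lemma norm_X: "x \<in> X \<Longrightarrow> norm x = 1"
  using X_sphere by auto

lemma h_pos: assumes "x \<in> X" shows "0 < h x"
proof -
  obtain e where e: "0 < e" "ball 0 e \<subseteq> P" using zero_interior mem_interior by blast
  have "(e / 2) *\<^sub>R x \<in> P" using e norm_X[OF assms] by (intro subsetD[OF e(2)]) simp
  then have "x \<bullet> ((e / 2) *\<^sub>R x) \<le> h x" by (rule upper[OF assms])
  then show ?thesis using e norm_X[OF assms] by (simp add: norm_eq_1)
qed

lemma face: "compact (face x)" "convex (face x)"
proof -
  have eq: "face x = P \<inter> {y. x \<bullet> y = h x}" by auto
  show "compact (face x)" unfolding eq using compact_P closed_hyperplane by (rule compact_Int_closed)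
  show "convex (face x)" unfolding eq using convex_P convex_hyperplane by (rule convex_Int)
qed

lemma ray_hits_face:
  assumes "y \<noteq> 0"
  obtains x r where "x \<in> X" "0 < r" "r *\<^sub>R y \<in> face x"
proof -
  obtain r where r: "0 < r" "0 + r *\<^sub>R y \<in> frontier P"
    using ray_to_frontier[OF compact_imp_bounded[OF compact_P] zero_interior assms] by blast
  then obtain x where "x \<in> X" "x \<bullet> (r *\<^sub>R y) = h x" using boundary[OF r(2)] by auto
  moreover have "r *\<^sub>R y \<in> P" using r compact_P by (simp add: frontier_def compact_imp_closed)
  ultimately show ?thesis using r that by blast
qed

lemma X_nonempty: "X \<noteq> {}"
proof -
  obtain b :: "real ^ 'n" where "b \<in> Basis" using nonempty_Basis by blast
  then show ?thesis using ray_hits_face[of b] by (auto simp: nonzero_Basis)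
qed

text \<open>The ray through a point of \<open>wulff X k\<close> leaves \<open>P\<close> through a facet, which bounds how far out the point is.\<close>

lemma wulff_subset_cones:
  assumes k: "\<And>x. x \<in> X \<Longrightarrow> 0 < k x"
  shows "wulff X k \<subseteq> (\<Union>x\<in>X. (\<lambda>y. 0 + (k x / h x) *\<^sub>R y) ` cone_over (face x))"
proof
  have in_cone: "\<exists>x\<in>X. \<exists>z\<in>face x. \<exists>s. 0 \<le> s \<and> s \<le> k x / h x \<and> y = s *\<^sub>R z" if y: "y \<in> wulff X k" "y \<noteq> 0" for y
  proof -
    obtain x r where x: "x \<in> X" "0 < r" "r *\<^sub>R y \<in> face x" using ray_hits_face[OF y(2)] by blast
    have "x \<bullet> y \<le> k x" using y x by (simp add: wulff_def)
    moreover have "r * (x \<bullet> y) = h x" using x by simp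
    ultimately have "h x \<le> r * k x" using x(2) by (metis mult_left_mono less_imp_le)
    then have "1 / r \<le> k x / h x" using h_pos[OF x(1)] x(2) by (simp add: field_simps)
    moreover have "y = (1 / r) *\<^sub>R (r *\<^sub>R y)" using x(2) by simp
    ultimately have "0 \<le> 1 / r \<and> 1 / r \<le> k x / h x \<and> y = (1 / r) *\<^sub>R (r *\<^sub>R y)"
      using x(2) by simp
    then show ?thesis using x(1,3) by blast
  qed
  fix y assume y: "y \<in> wulff X k"
  have "\<exists>x\<in>X. \<exists>z\<in>face x. \<exists>s. 0 \<le> s \<and> s \<le> k x / h x \<and> y = s *\<^sub>R z"
  proof (cases "y = 0")
    case True
    obtain b :: "real ^ 'n" where "b \<noteq> 0" using nonempty_Basis nonzero_Basis by blast
    then obtain x r where x: "x \<in> X" "r *\<^sub>R b \<in> face x" using ray_hits_face by blast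
    then have "0 \<le> k x / h x" using k h_pos by (simp add: less_imp_le)
    then have "0 \<le> (0::real) \<and> 0 \<le> k x / h x \<and> y = 0 *\<^sub>R (r *\<^sub>R b)"
      using True by simp
    then show ?thesis using x by blast
  qed (use in_cone y in blast)
  then obtain x z s where x: "x \<in> X" "z \<in> face x" "0 \<le> s" "s \<le> k x / h x" "y = s *\<^sub>R z" by blast
  have pos: "0 < k x / h x" using k h_pos x by simp
  have "(s / (k x / h x)) *\<^sub>R z \<in> cone_over (face x)"
    using x pos by (intro cone_overI[of "s / (k x / h x)" z]) (simp_all del: divide_divide_eq_right)
  moreover have "y = 0 + (k x / h x) *\<^sub>R ((s / (k x / h x)) *\<^sub>R z)"
    using x k[OF x(1)] h_pos[OF x(1)] by simp
  ultimately show "y \<in> (\<Union>x\<in>X. (\<lambda>y. 0 + (k x / h x) *\<^sub>R y) ` cone_over (face x))" using x(1) by blast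
qed

lemma compact_cone: "compact (cone_over (face x))"
  by (rule compact_cone_over[OF face(1)])

lemma compact_wulff:
  assumes k: "\<And>x. x \<in> X \<Longrightarrow> 0 < k x"
  shows "compact (wulff X k)"
proof -
  have "compact (\<Union>x\<in>X. (\<lambda>y. 0 + (k x / h x) *\<^sub>R y) ` cone_over (face x))"
    using finite_X by (intro compact_UN compact_continuous_image continuous_intros compact_cone) auto
  then show ?thesis
    using wulff_subset_cones[OF k] closed_wulff
    by (meson bounded_subset compact_eq_bounded_closed)
qed

text \<open>Scaling a cone by k x / h x multiplies its volume by the d-th power of that ratio. The
  bound is attained at k = h, by \<open>sum_cones\<close>.\<close>

lemma vol_le:
  assumes k: "\<And>x. x \<in> X \<Longrightarrow> 0 < k x"
  shows "vol k \<le> (\<Sum>x\<in>X. (k x / h x) ^ CARD('n) * measure lborel (cone_over (face x)))"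
proof -
  let ?S = "\<lambda>x. (\<lambda>y. 0 + (k x / h x) *\<^sub>R y) ` cone_over (face x)"
  have S: "compact (?S x)" for x
    by (intro compact_continuous_image continuous_intros compact_cone)
  have "vol k \<le> measure lborel (\<Union>x\<in>X. ?S x)"
    using wulff_subset_cones[OF k] compact_wulff[OF k] S finite_X
    by (intro measure_mono_fmeasurable fmeasurable_compact compact_UN) (auto simp: borel_compact)
  also have "\<dots> \<le> (\<Sum>x\<in>X. measure lborel (?S x))"
    using finite_X S emeasure_compact_finite[OF S]
    by (intro measure_subadditive_finite) (auto simp: borel_compact less_top[symmetric])
  also have "\<dots> = (\<Sum>x\<in>X. (k x / h x) ^ CARD('n) * measure lborel (cone_over (face x)))"
    using k h_pos by (intro sum.cong refl, subst measure_lborel_affine_image) (auto simp: compact_cone less_imp_le)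
  finally show ?thesis .
qed

lemma P_eq_wulff: "P = wulff X h"
proof
  show "P \<subseteq> wulff X h" using upper by (auto simp: wulff_def)
  show "wulff X h \<subseteq> P"
  proof
    fix y assume "y \<in> wulff X h"
    then obtain x where x: "x \<in> X" "y \<in> (\<lambda>y. 0 + (h x / h x) *\<^sub>R y) ` cone_over (face x)"
      using wulff_subset_cones[of h] h_pos by blast
    then have "y \<in> cone_over (face x)" using h_pos[OF x(1)] by auto
    then obtain r z where y: "0 \<le> r" "r \<le> 1" "z \<in> face x" "y = r *\<^sub>R z" by (rule cone_overE)
    have "0 \<in> P" using zero_interior interior_subset by blast
    then show "y \<in> P" using convexD_alt[OF convex_P, of 0 z r] y by simp
  qed
qed

text \<open>Two cones overlap only in a hyperplane, so the volumes of the cones add up inside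
  \<open>P\<close>. The converse inequality is \<open>vol_le\<close> for k = h.\<close>

lemma sum_cones: "(\<Sum>x\<in>X. measure lborel (cone_over (face x))) = measure lborel P"
proof (rule antisym)
  have "0 \<in> P" using zero_interior interior_subset by blast
  then have sub: "cone_over (face x) \<subseteq> P" for x
    using convexD_alt[OF convex_P, of 0] by (auto elim!: cone_overE)
  \<comment> \<open>On the cone over \<open>face x\<close> the ratio (x . y) / h x is maximal among
    all normals. A point of two cones therefore gives equal ratios, that is, it lies in the
    hyperplane normal to \<open>?u\<close> below.\<close>
  have height: "h x * (x' \<bullet> y) \<le> h x' * (x \<bullet> y)" if y: "y \<in> cone_over (face x)" and x: "x \<in> X" "x' \<in> X" for x x' y
  proof -
    obtain r z where z: "0 \<le> r" "r \<le> 1" "z \<in> face x" "y = r *\<^sub>R z" using y by (rule cone_overE)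
    have "h x * (r * (x' \<bullet> z)) \<le> h x * (r * h x')"
      using z x upper[of x' z] h_pos[of x] by (intro mult_left_mono) auto
    then show ?thesis using z by (simp add: ac_simps)
  qed
  have null: "AE y in lborel. y \<notin> cone_over (face x) \<or> y \<notin> cone_over (face x')"
    if x: "x \<in> X" "x' \<in> X" "x \<noteq> x'" for x x'
  proof -
    let ?u = "h x *\<^sub>R x' - h x' *\<^sub>R x"
    have "?u \<noteq> 0"
    proof
      assume u: "?u = 0"
      then have "norm (h x *\<^sub>R x') = norm (h x' *\<^sub>R x)" by simp
      then have "h x = h x'" using norm_X x h_pos[of x] h_pos[of x'] by simp
      then show False using u x h_pos[of x] by (simp add: scaleR_diff_right[symmetric])
    qed
    then have "AE y in lborel. y \<notin> {y. ?u \<bullet> y = 0}"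
      by (intro AE_not_in null_sets_lborel_hyperplane)
    then show ?thesis
    proof eventually_elim
      case (elim y)
      then show ?case
        using height[of y x x'] height[of y x' x] x by (auto simp: inner_diff_left)
    qed
  qed
  have "(\<Sum>x\<in>X. measure lborel (cone_over (face x))) = measure lborel (\<Union>x\<in>X. cone_over (face x))"
    using finite_X compact_cone null
    by (intro measure_UNION_AE[symmetric] fmeasurable_compact) (auto simp: pairwise_def)
  also have "\<dots> \<le> measure lborel P"
    using sub finite_X compact_cone compact_P
    by (intro measure_mono_fmeasurable fmeasurable_compact) (auto simp: borel_compact intro!: sets.finite_UN)
  finally show "(\<Sum>x\<in>X. measure lborel (cone_over (face x))) \<le> measure lborel P" .
  show "measure lborel P \<le> (\<Sum>x\<in>X. measure lborel (cone_over (face x)))"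
  proof -
    have "(\<Sum>x\<in>X. (h x / h x) ^ CARD('n) * measure lborel (cone_over (face x))) = (\<Sum>x\<in>X. measure lborel (cone_over (face x)))"
      by (intro sum.cong) (use h_pos in force)+
    then show ?thesis using vol_le[of h] h_pos P_eq_wulff by simp
  qed
qed

lemma measure_cone: "x \<in> X \<Longrightarrow> real CARD('n) * measure lborel (cone_over (face x)) = h x * a"
  using measure_cone_over[OF norm_X face(1,2)] h_pos area[of x] hyperplane_area_eq_prism[OF face(1), of x x] by simp

lemma vol_pos:
  assumes k: "\<And>x. x \<in> X \<Longrightarrow> 0 < k x"
  shows "0 \<in> interior (wulff X k)" "0 < vol k"
proof -
  define e where "e = Min (k ` X)"
  have e: "0 < e" "\<And>x. x \<in> X \<Longrightarrow> e \<le> k x"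
    using finite_X X_nonempty k by (auto simp: e_def)
  have "ball 0 e \<subseteq> wulff X k"
  proof
    fix y :: "real ^ 'n" assume y: "y \<in> ball 0 e"
    have "x \<bullet> y \<le> k x" if "x \<in> X" for x
      using norm_cauchy_schwarz[of x y] norm_X[OF that] e(2)[OF that] y by simp
    then show "y \<in> wulff X k" by (simp add: wulff_def)
  qed
  then show "0 \<in> interior (wulff X k)" using e by (auto simp: mem_interior)
  then show "0 < vol k"
    using compact_wulff[OF k] by (intro measure_lborel_interior_pos) (auto simp: compact_imp_bounded borel_compact)
qed

text \<open>Weighted means of points of the two Wulff shapes satisfy the averaged inequalities, so
  the product form of Brunn-Minkowski applies.\<close>

lemma vol_log_concave:
  fixes m n :: nat
  assumes mn: "0 < m" "0 < n" and k: "\<And>x. x \<in> X \<Longrightarrow> 0 < k x" and l: "\<And>x. x \<in> X \<Longrightarrow> 0 < l x"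
  shows "vol k ^ m * vol l ^ n \<le> vol (\<lambda>x. (m / (m + n)) * k x + (n / (m + n)) * l x) ^ (m + n)"
proof -
  have p: "0 < real m / real (m + n)" "0 < real n / real (m + n)" using mn by simp_all
  let ?j = "\<lambda>x. (m / (m + n)) * k x + (n / (m + n)) * l x"
  have j: "0 < ?j x" if "x \<in> X" for x
    using mn k[OF that] l[OF that] p by (intro add_pos_pos mult_pos_pos) auto
  show ?thesis
  proof (rule measure_brunn_minkowski_mult[OF mn])
    fix y z assume "y \<in> wulff X k" "z \<in> wulff X l"
    then show "(m / (m + n)) *\<^sub>R y + (n / (m + n)) *\<^sub>R z \<in> wulff X ?j"
      using p by (auto simp: wulff_def inner_add_right simp del: of_nat_add intro!: add_mono divide_right_mono mult_left_mono)
  qed (use compact_wulff k l j in \<open>auto simp: borel_compact compact_imp_bounded\<close>)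
qed

text \<open>
  The cone estimate \<open>vol_le\<close> has derivative \<open>a \<Sum>(k - h) = 0\<close> at \<open>h\<close>, while log-concavity puts
  \<open>vol\<close> above the geometric interpolation of its values at \<open>h\<close> and \<open>k\<close>.
\<close>

lemma vol_maximal:
  assumes k: "\<And>x. x \<in> X \<Longrightarrow> 0 < k x" and sum: "(\<Sum>x\<in>X. k x) = (\<Sum>x\<in>X. h x)"
  shows "vol k \<le> vol h"
proof -
  let ?d = "CARD('n)"
  define c where "c x = measure lborel (cone_over (face x))" for x
  define V where "V = vol h"
  \<comment> \<open>The bound of \<open>vol_le\<close> for the support numbers h + s (k -
    h).\<close>
  define U where "U s = (\<Sum>x\<in>X. (1 + s * ((k x - h x) / h x)) ^ ?d * c x)" for s :: real
  have kpos: "0 < vol k" by (rule vol_pos[OF k])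
  have V: "0 < V" unfolding V_def using h_pos by (rule vol_pos)
  have U0: "U 0 = V" by (simp add: U_def V_def c_def sum_cones P_eq_wulff[symmetric])
  have "(U has_real_derivative (\<Sum>x\<in>X. real ?d * (1 + 0 * ((k x - h x) / h x)) ^ (?d - 1) * ((k x - h x) / h x) * c x)) (at 0)"
    unfolding U_def by (auto intro!: derivative_eq_intros sum.cong dest: h_pos)
  also have "(\<Sum>x\<in>X. real ?d * (1 + 0 * ((k x - h x) / h x)) ^ (?d - 1) * ((k x - h x) / h x) * c x) = (\<Sum>x\<in>X. a * (k x - h x))"
  proof (intro sum.cong refl)
    fix x assume x: "x \<in> X"
    have "real ?d * (1 + 0 * ((k x - h x) / h x)) ^ (?d - 1) * ((k x - h x) / h x) * c x
        = (real ?d * c x) * ((k x - h x) / h x)" by simp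
    also have "\<dots> = a * (k x - h x)"
      using measure_cone[OF x] h_pos[OF x] by (simp add: c_def)
    finally show "real ?d * (1 + 0 * ((k x - h x) / h x)) ^ (?d - 1) * ((k x - h x) / h x) * c x = a * (k x - h x)" .
  qed
  also have "\<dots> = 0" using sum by (simp add: sum_distrib_left[symmetric] sum_subtractf)
  finally have dU: "(U has_real_derivative 0) (at 0)" .
  have "((\<lambda>s. ln (U s)) has_real_derivative 0) (at 0)"
    using DERIV_chain2[OF DERIV_ln[of "U 0"] dU] U0 V by simp
  then have "((\<lambda>s. (ln (U (0 + s)) - ln (U 0)) / s) \<longlongrightarrow> 0) (at 0)"
    by (simp only: DERIV_def)
  \<comment> \<open>Log-concavity is available for rational weights only, so s runs through 1 / (n +
    1), which mixes n parts of \<open>h\<close> with one part of \<open>k\<close>.\<close>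
  moreover have "filterlim (\<lambda>n. inverse (real (Suc n))) (at 0) sequentially"
    by (intro filterlim_atI LIMSEQ_inverse_real_of_nat) auto
  ultimately have lim: "(\<lambda>n. (ln (U (0 + inverse (real (Suc n)))) - ln (U 0)) / inverse (real (Suc n))) \<longlonglongrightarrow> 0"
    by (rule filterlim_compose)
  have bound: "ln (vol k) - ln V \<le> (ln (U (0 + inverse (real (Suc n)))) - ln (U 0)) / inverse (real (Suc n))" if n: "0 < n" for n
  proof -
    let ?s = "inverse (real (Suc n))"
    let ?j = "\<lambda>x. (n / (n + 1)) * h x + (1 / (n + 1)) * k x"
    have j: "0 < ?j x" if "x \<in> X" for x
      using n k[OF that] h_pos[OF that] by (intro add_pos_pos mult_pos_pos) auto
    have "vol ?j \<le> (\<Sum>x\<in>X. (?j x / h x) ^ ?d * c x)"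
      unfolding c_def by (rule vol_le[OF j])
    also have "\<dots> = U ?s"
      unfolding U_def
    proof (intro sum.cong refl arg_cong2[where f="(*)"] arg_cong2[where f="(^)"])
      fix x assume "x \<in> X"
      show "?j x / h x = 1 + ?s * ((k x - h x) / h x)"
      proof -
        define u where "u = k x / h x"
        have "?j x / h x = n / (n + 1) + ?s * u" "(k x - h x) / h x = u - 1"
          using h_pos[OF \<open>x \<in> X\<close>]
          by (simp_all add: u_def add_divide_distrib diff_divide_distrib inverse_eq_divide add.commute)
        moreover have "n / (n + 1) = 1 - ?s" by (simp add: field_simps)
        ultimately show ?thesis by (simp only:) (simp only: algebra_simps)
      qed
    qed
    finally have jU: "vol ?j \<le> U ?s" .
    have jpos: "0 < vol ?j" by (rule vol_pos[OF j])
    have Upos: "0 < U ?s" using jpos jU by linarith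
    have "V ^ n * vol k ^ 1 \<le> vol (\<lambda>x. (n / (n + 1)) * h x + (real 1 / (n + 1)) * k x) ^ (n + 1)"
      unfolding V_def using vol_log_concave[of n 1 h k] n k h_pos by simp
    also have "\<dots> \<le> U ?s ^ (n + 1)" using jU jpos by (intro power_mono) auto
    finally have "ln (V ^ n * vol k) \<le> ln (U ?s ^ (n + 1))"
      using V kpos Upos by (subst ln_le_cancel_iff) (auto intro!: mult_pos_pos zero_less_power)
    then have "n * ln V + ln (vol k) \<le> (n + 1) * ln (U ?s)"
      using V kpos Upos by (simp add: ln_mult ln_realpow distrib_right)
    then show ?thesis unfolding U0 by (simp add: field_simps)
  qed
  have "ln (vol k) - ln V \<le> 0"
    by (rule LIMSEQ_le_const[OF lim]) (use bound in \<open>auto intro!: exI[of _ 1]\<close>)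
  then show ?thesis using V kpos by (simp add: V_def)
qed


section \<open>Symmetrization over the transitive group\<close>

lemma vol_orthogonal:
  assumes g: "orthogonal_transformation g" "g ` X = X" and k: "\<And>x. x \<in> X \<Longrightarrow> 0 < k x"
  shows "vol (\<lambda>x. k (g x)) = vol k"
proof -
  have gX: "g x \<in> X" if "x \<in> X" for x using g that by auto
  have pres: "g x \<bullet> g y = x \<bullet> y" for x y
    using g(1) by (auto simp: orthogonal_transformation_def)
  have "wulff X k = g ` wulff X (\<lambda>x. k (g x))"
  proof (intro equalityI subsetI)
    fix y assume y: "y \<in> wulff X k"
    obtain z where z: "y = g z" using orthogonal_transformation_surj[OF g(1)] by (metis surjD)
    have "x \<bullet> z \<le> k (g x)" if "x \<in> X" for x
      using y gX[OF that] pres[of x z] by (auto simp: wulff_def z)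
    then have "z \<in> wulff X (\<lambda>x. k (g x))" by (simp add: wulff_def)
    then show "y \<in> g ` wulff X (\<lambda>x. k (g x))" using z by blast
  next
    fix y assume "y \<in> g ` wulff X (\<lambda>x. k (g x))"
    then obtain z where z: "z \<in> wulff X (\<lambda>x. k (g x))" "y = g z" by blast
    have "x \<bullet> y \<le> k x" if "x \<in> X" for x
    proof -
      have "x \<in> g ` X" using that g(2) by simp
      then obtain x' where "x' \<in> X" "x = g x'" by blast
      then show ?thesis using z by (auto simp: wulff_def pres)
    qed
    then show "y \<in> wulff X k" by (simp add: wulff_def)
  qed
  then show ?thesis
    using measure_linear_image_vol_factor[OF orthogonal_transformation_linear[OF g(1)] orthogonal_transformation_inj[OF g(1)]
        compact_wulff[of "\<lambda>x. k (g x)"]] k gX vol_factor_orthogonal[OF g(1)]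
    by simp
qed

text \<open>Each new function enters the average with weight 1 / (card S + 1), which is
  log-concavity with exponents \<open>card S\<close> and 1; the common power is cancelled at the
  end.\<close>

lemma vol_average:
  assumes S: "finite S" "S \<noteq> {}" and k: "\<And>k x. k \<in> S \<Longrightarrow> x \<in> X \<Longrightarrow> 0 < k x"
    and c: "0 \<le> c" "\<And>k. k \<in> S \<Longrightarrow> c \<le> vol k"
  shows "c \<le> vol (\<lambda>x. (\<Sum>k\<in>S. k x) / card S)"
  using S k c(2)
proof (induction S rule: finite_ne_induct)
  case (singleton k)
  then show ?case by simp
next
  case (insert k S)
  let ?m = "card S"
  let ?avg = "\<lambda>S x. (\<Sum>k\<in>S. k x) / card S"
  have m: "0 < ?m" using insert.hyps by (simp add: card_gt_0_iff)
  have IH: "c \<le> vol (?avg S)" using insert.IH insert.prems by simp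
  have pos: "0 < ?avg S x" if "x \<in> X" for x
    using insert.hyps insert.prems(1) that m by (intro divide_pos_pos sum_pos) auto
  have avg: "(?m / (?m + 1)) * ?avg S x + (real 1 / (?m + 1)) * k x = ?avg (insert k S) x" for x
    using insert.hyps m by (simp add: add_divide_distrib[symmetric] add.commute)
  have "c ^ (?m + 1) = c ^ ?m * c ^ 1" by simp
  also have "\<dots> \<le> vol (?avg S) ^ ?m * vol k ^ 1"
    using IH c(1) insert.prems(2)[of k] by (intro mult_mono power_mono) auto
  also have "\<dots> \<le> vol (\<lambda>x. (?m / (?m + 1)) * ?avg S x + (real 1 / (?m + 1)) * k x) ^ (?m + 1)"
    using vol_log_concave[of ?m 1 "?avg S" k] m pos insert.prems(1)[of k] by simp
  also have "\<dots> = vol (?avg (insert k S)) ^ (?m + 1)"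
    unfolding avg ..
  finally show ?case
    by (rule power_le_imp_le_base[of c ?m, unfolded Suc_eq_plus1]) simp
qed

lemma homothetic_to_regular:
  assumes G: "G \<noteq> {}" "\<And>f g. f \<in> G \<Longrightarrow> g \<in> G \<Longrightarrow> f \<circ> g \<in> G"
    "\<And>g. g \<in> G \<Longrightarrow> orthogonal_transformation g" "\<And>g. g \<in> G \<Longrightarrow> g ` X = X"
    and trans: "\<And>x y. x \<in> X \<Longrightarrow> y \<in> X \<Longrightarrow> \<exists>g\<in>G. g x = y"
  obtains \<eta> v where "0 < \<eta>" "P = (+) v ` wulff X (\<lambda>_. \<eta>)"
proof -
  have gX: "g x \<in> X" if "g \<in> G" "x \<in> X" for g x using G(4)[OF that(1)] that(2) by auto
  define S where "S = (\<lambda>g. restrict (\<lambda>x. h (g x)) X) ` G"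
  have "S \<subseteq> PiE X (\<lambda>_. h ` X)" unfolding S_def using gX by auto
  then have fin: "finite S" using finite_X by (meson finite_PiE finite_imageI finite_subset)
  have ne: "S \<noteq> {}" using G(1) by (simp add: S_def)
  have pos: "0 < k x" if "k \<in> S" "x \<in> X" for k x
    using that gX h_pos by (auto simp: S_def)
  define avg where "avg x = (\<Sum>k\<in>S. k x) / card S" for x
  have volS: "vol k = vol h" if k: "k \<in> S" for k
  proof -
    obtain g where g: "g \<in> G" "k = restrict (\<lambda>x. h (g x)) X" using k by (auto simp: S_def)
    have "vol k = vol (\<lambda>x. h (g x))" unfolding g(2) by (intro arg_cong[where f="measure lborel"] wulff_cong) simp
    then show ?thesis using vol_orthogonal[OF G(3,4)[OF g(1)], of h] h_pos by simp
  qed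
  \<comment> \<open>Precomposition with g is an injective self-map of the finite set
    \<open>S\<close>, hence a permutation of it. The average is therefore constant along the orbit,
    which is all of \<open>X\<close>.\<close>
  have const: "avg x = avg y" if xy: "x \<in> X" "y \<in> X" for x y
  proof -
    obtain g where g: "g \<in> G" "g x = y" using trans[OF xy] by blast
    let ?\<phi> = "\<lambda>k. restrict (\<lambda>x. k (g x)) X"
    have "inj_on ?\<phi> S"
    proof (rule inj_onI)
      fix k l assume kl: "k \<in> S" "l \<in> S" "?\<phi> k = ?\<phi> l"
      have "k z = l z" for z
      proof (cases "z \<in> X")
        case True
        then have "z \<in> g ` X" using G(4)[OF g(1)] by simp
        then obtain w where w: "w \<in> X" "z = g w" by blast
        then show ?thesis using fun_cong[OF kl(3), of w] by simp
      next
        case False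
        then show ?thesis using kl(1,2) by (auto simp: S_def)
      qed
      then show "k = l" by blast
    qed
    moreover have "?\<phi> ` S \<subseteq> S"
    proof
      fix l assume "l \<in> ?\<phi> ` S"
      then obtain f where f: "f \<in> G" "l = ?\<phi> (restrict (\<lambda>x. h (f x)) X)" by (auto simp: S_def)
      have "l = restrict (\<lambda>x. h ((f \<circ> g) x)) X" unfolding f(2) using gX[OF g(1)] by (auto simp: fun_eq_iff)
      then show "l \<in> S" using G(2)[OF f(1) g(1)] unfolding S_def by blast
    qed
    ultimately have bij: "bij_betw ?\<phi> S S"
      using fin by (metis bij_betw_def card_image card_subset_eq)
    have "(\<Sum>k\<in>S. k y) = (\<Sum>k\<in>S. ?\<phi> k x)" using g(2) xy by simp
    also have "\<dots> = (\<Sum>k\<in>S. k x)" by (rule sum.reindex_bij_betw[OF bij])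
    finally show ?thesis by (simp add: avg_def)
  qed
  obtain x0 where x0: "x0 \<in> X" using X_nonempty by blast
  define \<eta> where "\<eta> = avg x0"
  have avg\<eta>: "avg x = \<eta>" if "x \<in> X" for x unfolding \<eta>_def using const that x0 by blast
  have \<eta>: "0 < \<eta>"
    unfolding \<eta>_def avg_def using fin ne pos x0 by (intro divide_pos_pos sum_pos) (auto simp: card_gt_0_iff)
  have sumS: "(\<Sum>x\<in>X. k x) = (\<Sum>x\<in>X. h x)" if k: "k \<in> S" for k
  proof -
    obtain g where g: "g \<in> G" "k = restrict (\<lambda>x. h (g x)) X" using k by (auto simp: S_def)
    have "bij_betw g X X"
      using G(3,4)[OF g(1)] orthogonal_transformation_inj by (metis bij_betw_def inj_on_subset subset_UNIV)
    then have "(\<Sum>x\<in>X. h (g x)) = (\<Sum>x\<in>X. h x)" by (rule sum.reindex_bij_betw)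
    then show ?thesis by (simp add: g(2))
  qed
  have sum\<eta>: "(\<Sum>x\<in>X. \<eta>) = (\<Sum>x\<in>X. h x)"
  proof -
    have "(\<Sum>x\<in>X. \<eta>) = (\<Sum>x\<in>X. avg x)" using avg\<eta> by simp
    also have "\<dots> = (\<Sum>x\<in>X. \<Sum>k\<in>S. k x) / card S" by (simp add: avg_def sum_divide_distrib)
    also have "(\<Sum>x\<in>X. \<Sum>k\<in>S. k x) = (\<Sum>k\<in>S. \<Sum>x\<in>X. k x)" by (rule sum.swap)
    also have "\<dots> = card S * (\<Sum>x\<in>X. h x)" using sumS by simp
    finally show ?thesis using fin ne by simp
  qed
  have "vol h \<le> vol avg"
    unfolding avg_def by (rule vol_average[OF fin ne]) (use pos volS in auto)
  also have "vol avg = vol (\<lambda>_. \<eta>)"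
    using avg\<eta> by (intro arg_cong[where f="measure lborel"] wulff_cong)
  finally have ge: "vol h \<le> vol (\<lambda>_. \<eta>)" .
  have le: "vol (\<lambda>_. \<eta>) \<le> vol h"
    using \<eta> sum\<eta> by (intro vol_maximal) auto
  \<comment> \<open>The Wulff shape of the averaged heights contains all midpoints. Its volume is at
    most \<open>vol h\<close> by maximality and at least that by log-concavity, which is the
    equality case needed below.\<close>
  let ?mid = "\<lambda>x. (1 / 2) * h x + (1 / 2) * \<eta>"
  have midpos: "0 < ?mid x" if "x \<in> X" for x using h_pos[OF that] \<eta> by simp
  have "(\<Sum>x\<in>X. ?mid x) = (\<Sum>x\<in>X. h x)"
    using sum\<eta> by (simp add: sum.distrib sum_divide_distrib[symmetric])
  then have mid_le: "vol ?mid \<le> vol h" using midpos by (intro vol_maximal)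
  have "(vol h)\<^sup>2 \<le> vol h * vol (\<lambda>_. \<eta>)"
    using ge by (simp add: power2_eq_square mult_left_mono)
  also have "\<dots> \<le> (vol ?mid)\<^sup>2"
    using vol_log_concave[of 1 1 h "\<lambda>_. \<eta>"] h_pos \<eta> by (simp add: power2_eq_square)
  finally have mid_ge: "vol h \<le> vol ?mid" by (rule power2_le_imp_le) simp
  have wP: "wulff X h = P" by (rule P_eq_wulff[symmetric])
  have "P = (+) (centroid P - centroid (wulff X (\<lambda>_. \<eta>))) ` wulff X (\<lambda>_. \<eta>)"
  proof (rule brunn_minkowski_equality[where M="wulff X ?mid"])
    show "interior P \<noteq> {}" using zero_interior by blast
    show "interior (wulff X (\<lambda>_. \<eta>)) \<noteq> {}" using vol_pos(1)[of "\<lambda>_. \<eta>"] \<eta> by blast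
    show "measure lborel (wulff X (\<lambda>_. \<eta>)) = measure lborel P" using ge le wP by simp
    show "measure lborel (wulff X ?mid) = measure lborel P" using mid_ge mid_le wP by simp
    fix x y assume "x \<in> P" "y \<in> wulff X (\<lambda>_. \<eta>)"
    then show "(1 / 2) *\<^sub>R x + (1 / 2) *\<^sub>R y \<in> wulff X ?mid"
      unfolding wP[symmetric] by (auto simp: wulff_def inner_add_right intro!: add_mono divide_right_mono)
  qed (use compact_P convex_P compact_wulff \<eta> midpos convex_wulff in auto)
  then show ?thesis using that \<eta> by blast
qed

end

section \<open>Minkowski polytopes and the Steiner point\<close>

lemma hyperplane_area_translation: "hyperplane_area u ((+) c ` F) = hyperplane_area u F"
proof -
  have "{y + s *\<^sub>R u | y s. y \<in> (+) c ` F \<and> s \<in> {0..1}} = (+) c ` {y + s *\<^sub>R u | y s. y \<in> F \<and> s \<in> {0..1}}"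
    (is "?L = (+) c ` ?R")
  proof (intro equalityI subsetI)
    fix z assume "z \<in> ?L"
    then obtain y s where "y \<in> F" "s \<in> {0..1}" "z = c + (y + s *\<^sub>R u)" by (auto simp: add.assoc)
    then show "z \<in> (+) c ` ?R" by blast
  next
    fix z assume "z \<in> (+) c ` ?R"
    then obtain y s where "y \<in> F" "s \<in> {0..1}" "z = (c + y) + s *\<^sub>R u" by (auto simp: add.assoc)
    then show "z \<in> ?L" by blast
  qed
  then show ?thesis by (simp add: hyperplane_area_def measure_translation)
qed

lemma bdd_above_inner_image:
  fixes P :: "'a::real_inner set"
  assumes "bounded P"
  shows "bdd_above ((\<lambda>y. u \<bullet> y) ` P)"
proof -
  obtain B where B: "\<And>y. y \<in> P \<Longrightarrow> norm y \<le> B" using assms by (auto simp: bounded_iff)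
  have "u \<bullet> y \<le> norm u * B" if "y \<in> P" for y
    using norm_cauchy_schwarz[of u y] mult_left_mono[OF B[OF that], of "norm u"] by simp
  then show ?thesis by (intro bdd_aboveI2)
qed

lemma inner_le_support_function: "bounded P \<Longrightarrow> y \<in> P \<Longrightarrow> u \<bullet> y \<le> support_function P u"
  unfolding support_function_def by (intro cSUP_upper bdd_above_inner_image)

lemma support_function_le: "P \<noteq> {} \<Longrightarrow> (\<And>y. y \<in> P \<Longrightarrow> u \<bullet> y \<le> b) \<Longrightarrow> support_function P u \<le> b"
  unfolding support_function_def by (intro cSUP_least)

lemma minkowski_polytope_homothetic:
  fixes X P :: "(real ^ 'n) set"
  assumes fin: "finite X" "X \<subseteq> sphere 0 1" and trans: "node_transitive X" and mink: "minkowski_polytope X P"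
  obtains \<eta> v where "0 < \<eta>" "P = (+) v ` wulff X (\<lambda>_. \<eta>)"
proof -
  have P: "polytope P" and ne: "interior P \<noteq> {}"
    and facets: "support_face P ` X = {F. F facet_of P}"
    and area: "\<And>x. x \<in> X \<Longrightarrow> hyperplane_area x (support_face P x) = sphere_area TYPE('n) / real (card X)"
    using mink by (auto simp: minkowski_polytope_def bij_betw_def)
  note comp = polytope_imp_compact[OF P]
  obtain p where p: "p \<in> interior P" using ne by blast
  \<comment> \<open>An interior point is moved to 0 to obtain positive heights; this auxiliary shift
    is absorbed into \<open>v\<close> at the end.\<close>
  let ?P = "(+) (- p) ` P"
  let ?h = "\<lambda>x. support_function P x - x \<bullet> p"
  have shift: "{y \<in> ?P. x \<bullet> y = ?h x} = (+) (- p) ` support_face P x" for x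
    by (auto simp: support_face_def inner_diff_right inner_add_right)
  interpret equifacetal X ?P ?h "sphere_area TYPE('n) / real (card X)"
  proof
    show "compact ?P" by (rule compact_translation[OF comp])
    show "convex ?P" using polytope_imp_convex[OF P] by (rule convex_translation)
    show "0 \<in> interior ?P" unfolding interior_translation using p by (intro image_eqI[of _ _ p]) auto
    show "x \<bullet> y \<le> ?h x" if "x \<in> X" "y \<in> ?P" for x y
      using that inner_le_support_function[OF compact_imp_bounded[OF comp]] by (auto simp: inner_diff_right)
    show "\<exists>x\<in>X. x \<bullet> y = ?h x" if y: "y \<in> frontier ?P" for y
    proof -
      obtain z where z: "z \<in> frontier P" "y = - p + z" using y unfolding frontier_translation by blast
      \<comment> \<open>The relative boundary of a polyhedron is the union of its facets, and each
        facet is a support face with normal in \<open>X\<close>.\<close>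
      have "z \<in> P - rel_interior P"
        using z(1) comp ne by (simp add: frontier_def compact_imp_closed rel_interior_nonempty_interior)
      then obtain F where "F facet_of P" "z \<in> F"
        using rel_boundary_of_polyhedron[OF polytope_imp_polyhedron[OF P]] by blast
      then obtain x where "x \<in> X" "z \<in> support_face P x" using facets by blast
      then show ?thesis using z(2) by (intro bexI[of _ x]) (auto simp: support_face_def inner_diff_right)
    qed
    show "hyperplane_area x {y \<in> ?P. x \<bullet> y = ?h x} = sphere_area TYPE('n) / real (card X)" if "x \<in> X" for x
      unfolding shift hyperplane_area_translation by (rule area[OF that])
  qed (use fin in auto)
  obtain G where G: "subgroup G (orthogonal_group :: (real ^ 'n \<Rightarrow> real ^ 'n) monoid)" "\<And>g. g \<in> G \<Longrightarrow> g ` X = X"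
      "\<And>x y. x \<in> X \<Longrightarrow> y \<in> X \<Longrightarrow> \<exists>g\<in>G. g x = y"
    using trans by (auto simp: node_transitive_def)
  obtain \<eta> v where "0 < \<eta>" "?P = (+) v ` wulff X (\<lambda>_. \<eta>)"
  proof (rule homothetic_to_regular[of G])
    show "G \<noteq> {}" using subgroup.one_closed[OF G(1)] by blast
    show "f \<circ> g \<in> G" if "f \<in> G" "g \<in> G" for f g
      using subgroup.m_closed[OF G(1) that] by (simp add: orthogonal_group_def)
    show "orthogonal_transformation g" if "g \<in> G" for g
      using subgroup.subset[OF G(1)] that by (auto simp: orthogonal_group_def)
  qed (use G in auto)
  moreover have "P = (+) p ` ?P" by (simp add: image_image)
  ultimately have "P = (+) (p + v) ` wulff X (\<lambda>_. \<eta>)" by (simp add: image_image add.assoc)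
  then show ?thesis using that \<open>0 < \<eta>\<close> by blast
qed

section \<open>The rotation-invariant probability measure on the sphere\<close>

abbreviation punctured_ball :: "(real ^ 'n) set" where
  "punctured_ball \<equiv> ball 0 1 - {0}"

lemma sets_sphere_surface [measurable_cong, simp]: "sets sphere_surface = sets borel"
  by (simp add: sphere_surface_def)

lemma space_sphere_surface [simp]: "space sphere_surface = UNIV"
  using sets_eq_imp_space_eq[OF sets_sphere_surface] by simp

lemma sets_sphere_prob [measurable_cong, simp]: "sets sphere_prob = sets borel"
  by (simp add: sphere_prob_def)

lemma space_sphere_prob [simp]: "space sphere_prob = UNIV"
  by (simp add: sphere_prob_def)

lemma emeasure_sphere_surface:
  fixes A :: "(real ^ 'n) set"
  assumes A: "A \<in> sets borel"
  shows "emeasure sphere_surface A = of_nat CARD('n) * emeasure lborel {x \<in> punctured_ball. x /\<^sub>R norm x \<in> A}"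
proof -
  let ?f = "\<lambda>x::real ^ 'n. x /\<^sub>R norm x"
  have f: "?f \<in> borel_measurable (restrict_space lborel punctured_ball)"
    by (intro measurable_restrict_space1) measurable
  have "emeasure sphere_surface A
      = of_nat CARD('n) * emeasure (restrict_space lborel punctured_ball) (?f -` A \<inter> punctured_ball)"
    using A f by (simp add: sphere_surface_def emeasure_distr space_restrict_space)
  also have "emeasure (restrict_space lborel punctured_ball) (?f -` A \<inter> punctured_ball)
      = emeasure lborel (?f -` A \<inter> punctured_ball)"
    by (intro emeasure_restrict_space) auto
  also have "?f -` A \<inter> punctured_ball = {x \<in> punctured_ball. x /\<^sub>R norm x \<in> A}" by auto
  finally show ?thesis .
qed

lemma emeasure_punctured_ball:
  "emeasure lborel (punctured_ball :: (real ^ 'n) set) \<noteq> 0" "emeasure lborel (punctured_ball :: (real ^ 'n) set) \<noteq> \<infinity>"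
proof -
  have "emeasure lborel (punctured_ball :: (real ^ 'n) set) = emeasure lborel (ball (0 :: real ^ 'n) 1)"
    by (intro emeasure_Diff_null_set) auto
  then show "emeasure lborel (punctured_ball :: (real ^ 'n) set) \<noteq> 0" "emeasure lborel (punctured_ball :: (real ^ 'n) set) \<noteq> \<infinity>"
    using measure_ball_1_pos[where 'a="real ^ 'n"] emeasure_lborel_ball_finite[of "0 :: real ^ 'n" 1]
    by (auto simp: measure_def)
qed

lemma emeasure_sphere_surface_sphere:
  "emeasure sphere_surface (sphere (0 :: real ^ 'n) 1) = of_nat CARD('n) * emeasure lborel (punctured_ball :: (real ^ 'n) set)"
proof -
  have "{x \<in> punctured_ball. x /\<^sub>R norm x \<in> sphere (0 :: real ^ 'n) 1} = punctured_ball" by auto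
  then show ?thesis by (simp add: emeasure_sphere_surface)
qed

lemma emeasure_sphere_surface_sphere_nontrivial:
  "emeasure sphere_surface (sphere (0 :: real ^ 'n) 1) \<noteq> 0" "emeasure sphere_surface (sphere (0 :: real ^ 'n) 1) \<noteq> \<infinity>"
  using emeasure_punctured_ball[where 'n='n]
  by (auto simp: emeasure_sphere_surface_sphere ennreal_mult_eq_top_iff)

lemma prob_space_sphere_prob: "prob_space (sphere_prob :: (real ^ 'n) measure)"
  unfolding sphere_prob_def
  using emeasure_sphere_surface_sphere_nontrivial by (intro prob_space_uniform_measure)

lemma AE_sphere_prob: "AE u in (sphere_prob :: (real ^ 'n) measure). norm u = 1"
  unfolding sphere_prob_def by (rule AE_uniform_measureI) auto

text \<open>Radial projection commutes with \<open>g\<close>, and \<open>g\<close> preserves both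
  the punctured ball and Lebesgue measure.\<close>

lemma sphere_surface_orthogonal:
  fixes g :: "real ^ 'n \<Rightarrow> real ^ 'n"
  assumes g: "orthogonal_transformation g" and A: "A \<in> sets borel"
  shows "emeasure sphere_surface (g -` A) = emeasure sphere_surface A"
proof -
  note lin = orthogonal_transformation_linear[OF g]
  have [measurable]: "g \<in> borel_measurable borel"
    using lin by (intro borel_measurable_continuous_onI linear_continuous_on) (simp add: linear_linear)
  have gA: "g -` A \<in> sets borel"
    using measurable_sets_borel[OF \<open>g \<in> borel_measurable borel\<close> A] by simp
  have eq: "{x \<in> punctured_ball. x /\<^sub>R norm x \<in> g -` A} = g -` {x \<in> punctured_ball. x /\<^sub>R norm x \<in> A}"
    using orthogonal_transformation_norm[OF g] lin
    by (auto simp: linear_scale) (metis norm_eq_zero)+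
  have meas: "{x \<in> punctured_ball. x /\<^sub>R norm x \<in> A} \<in> sets borel"
  proof -
    have "(\<lambda>x::real ^ 'n. x /\<^sub>R norm x) -` A \<inter> space borel \<in> sets borel"
      using A by (intro measurable_sets[where A=borel]) auto
    moreover have "{x \<in> punctured_ball. x /\<^sub>R norm x \<in> A} = punctured_ball \<inter> ((\<lambda>x. x /\<^sub>R norm x) -` A)" by auto
    ultimately show ?thesis by auto
  qed
  have "emeasure lborel (g -` {x \<in> punctured_ball. x /\<^sub>R norm x \<in> A})
      = emeasure lborel {x \<in> punctured_ball. x /\<^sub>R norm x \<in> A}"
    using emeasure_linear_vimage[OF lin orthogonal_transformation_inj[OF g] meas]
    by (simp only: vol_factor_orthogonal[OF g] ennreal_1 mult_1)
  then show ?thesis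
    by (simp only: emeasure_sphere_surface[OF A] emeasure_sphere_surface[OF gA] eq)
qed

lemma distr_sphere_prob_orthogonal:
  fixes g :: "real ^ 'n \<Rightarrow> real ^ 'n"
  assumes g: "orthogonal_transformation g"
  shows "distr sphere_prob borel g = sphere_prob"
proof (rule measure_eqI)
  note lin = orthogonal_transformation_linear[OF g]
  have gm [measurable]: "g \<in> borel_measurable borel"
    using lin by (intro borel_measurable_continuous_onI linear_continuous_on) (simp add: linear_linear)
  fix A assume "A \<in> sets (distr sphere_prob borel g)"
  then have A: "A \<in> sets borel" by simp
  have gA: "g -` A \<in> sets borel"
    using measurable_sets_borel[OF gm A] by simp
  have "emeasure (distr sphere_prob borel g) A = emeasure sphere_prob (g -` A)"
    using A by (subst emeasure_distr) (auto cong: measurable_cong_sets)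
  also have "\<dots> = emeasure sphere_surface (sphere 0 1 \<inter> g -` A) / emeasure sphere_surface (sphere (0 :: real ^ 'n) 1)"
    unfolding sphere_prob_def using gA by (intro emeasure_uniform_measure) auto
  also have "sphere 0 1 \<inter> g -` A = g -` (sphere 0 1 \<inter> A)"
    using orthogonal_transformation_norm[OF g] by auto
  also have "emeasure sphere_surface (g -` (sphere 0 1 \<inter> A)) = emeasure sphere_surface (sphere 0 1 \<inter> A)"
    using A by (intro sphere_surface_orthogonal g) auto
  also have "\<dots> / emeasure sphere_surface (sphere (0 :: real ^ 'n) 1) = emeasure sphere_prob A"
    unfolding sphere_prob_def using A by (intro emeasure_uniform_measure[symmetric]) auto
  finally show "emeasure (distr sphere_prob borel g) A = emeasure sphere_prob A" .
qed simp

text \<open>For nonzero \<open>v\<close>, the cone over the unit vectors orthogonal to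
  \<open>v\<close> lies in a hyperplane and is null, so these directions have probability 0 instead
  of 1.\<close>

lemma AE_sphere_prob_orthogonal_imp_zero:
  fixes v :: "real ^ 'n"
  assumes "AE u in sphere_prob. u \<bullet> v = 0"
  shows "v = 0"
proof (rule ccontr)
  assume v: "v \<noteq> 0"
  let ?H = "{u. v \<bullet> u = 0} :: (real ^ 'n) set"
  have H: "?H \<in> sets borel" by (simp add: closed_hyperplane borel_closed)
  have "{x \<in> punctured_ball. x /\<^sub>R norm x \<in> sphere 0 1 \<inter> ?H} \<subseteq> ?H" by auto
  then have "emeasure lborel {x \<in> punctured_ball. x /\<^sub>R norm x \<in> sphere 0 1 \<inter> ?H} = 0"
    using null_sets_lborel_hyperplane[OF v, of 0] emeasure_eq_0[of ?H lborel] by (simp only: null_setsD1 null_setsD2)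
  then have "emeasure sphere_surface (sphere 0 1 \<inter> ?H) = 0"
    using H by (subst emeasure_sphere_surface) auto
  then have "emeasure sphere_prob ?H = 0"
    unfolding sphere_prob_def using H by (subst emeasure_uniform_measure) auto
  then have "AE u in sphere_prob. u \<notin> ?H"
    using H by (intro AE_not_in) (simp add: null_sets_def)
  with assms have "AE u in (sphere_prob :: (real ^ 'n) measure). False"
    by eventually_elim (simp add: inner_commute)
  then show False
    using prob_space.AE_False[OF prob_space_sphere_prob[where 'n='n]] by simp
qed

lemma integrable_sphere_prob:
  fixes f :: "real ^ 'n \<Rightarrow> 'b::{banach, second_countable_topology}"
  assumes f: "continuous_on UNIV f"
  shows "integrable sphere_prob f"
proof -
  interpret prob_space "sphere_prob :: (real ^ 'n) measure" by (rule prob_space_sphere_prob)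
  have "compact (f ` sphere 0 1)"
    using f by (intro compact_continuous_image) (auto intro: continuous_on_subset)
  then obtain B where B: "\<And>u. u \<in> sphere 0 1 \<Longrightarrow> norm (f u) \<le> B"
    using compact_imp_bounded by (fastforce simp: bounded_iff)
  have "f \<in> borel_measurable borel" using f by (rule borel_measurable_continuous_onI)
  moreover have "AE u in sphere_prob. norm (f u) \<le> B"
    using AE_sphere_prob by eventually_elim (use B in auto)
  ultimately show ?thesis by (intro integrable_const_bound[where B=B]) (auto cong: measurable_cong_sets)
qed

section \<open>Support functions and the Steiner point\<close>

lemma continuous_on_support_function:
  fixes P :: "(real ^ 'n) set"
  assumes P: "bounded P" "P \<noteq> {}"
  shows "continuous_on A (support_function P)"
proof -
  obtain B where B: "0 < B" "\<And>y. y \<in> P \<Longrightarrow> norm y \<le> B" using P by (auto simp: bounded_pos)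
  have le: "support_function P u \<le> support_function P w + B * dist u w" for u w
  proof (rule support_function_le[OF P(2)])
    fix y assume y: "y \<in> P"
    have "(u - w) \<bullet> y \<le> norm (u - w) * norm y" by (rule norm_cauchy_schwarz)
    also have "\<dots> \<le> B * dist u w" using B(2)[OF y] by (simp add: dist_norm mult.commute mult_right_mono)
    finally show "u \<bullet> y \<le> support_function P w + B * dist u w"
      using inner_le_support_function[OF P(1) y, of w] by (simp add: inner_diff_left)
  qed
  have "dist (support_function P u) (support_function P w) \<le> B * dist u w" for u w
    using le[of u w] le[of w u] by (simp add: dist_real_def dist_commute abs_le_iff)
  then have "B-lipschitz_on A (support_function P)" using B(1) by (intro lipschitz_onI) auto
  then show ?thesis by (rule lipschitz_on_continuous_on)
qed

lemma support_function_translation: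
  fixes P :: "(real ^ 'n) set"
  assumes P: "bounded P" "P \<noteq> {}"
  shows "support_function ((+) v ` P) u = u \<bullet> v + support_function P u"
proof (rule antisym)
  show "support_function ((+) v ` P) u \<le> u \<bullet> v + support_function P u"
    using P inner_le_support_function[OF P(1)] by (intro support_function_le) (auto simp: inner_add_right)
  have "support_function P u \<le> support_function ((+) v ` P) u - u \<bullet> v"
  proof (rule support_function_le[OF P(2)])
    fix y assume "y \<in> P"
    then have "u \<bullet> (v + y) \<le> support_function ((+) v ` P) u"
      using P by (intro inner_le_support_function bounded_translation) auto
    then show "u \<bullet> y \<le> support_function ((+) v ` P) u - u \<bullet> v" by (simp add: inner_add_right)
  qed
  then show "u \<bullet> v + support_function P u \<le> support_function ((+) v ` P) u" by simp
qed

lemma steiner_point_orthogonal_invariant: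
  fixes P :: "(real ^ 'n) set"
  assumes P: "bounded P" "P \<noteq> {}" and g: "orthogonal_transformation g" "g ` P = P"
  shows "g (steiner_point P) = steiner_point P"
proof -
  let ?F = "\<lambda>u. support_function P u *\<^sub>R u"
  have lin: "linear g" by (rule orthogonal_transformation_linear[OF g(1)])
  have bl: "bounded_linear g" using lin by (simp add: linear_linear)
  have sup: "support_function P (g u) = support_function P u" for u
  proof -
    have "(\<lambda>y. g u \<bullet> y) ` g ` P = (\<lambda>y. u \<bullet> y) ` P"
      using g(1) by (simp add: image_image orthogonal_transformation_def)
    then show ?thesis by (simp add: support_function_def g(2))
  qed
  have cont: "continuous_on UNIV ?F"
    using continuous_on_support_function[OF P] by (intro continuous_intros)
  have gm: "g \<in> borel_measurable sphere_prob"
    using linear_continuous_on[OF bl] by (auto cong: measurable_cong_sets intro: borel_measurable_continuous_onI)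
  have Fm: "?F \<in> borel_measurable borel" using cont by (rule borel_measurable_continuous_onI)
  have "g (\<integral>u. ?F u \<partial>sphere_prob) = (\<integral>u. g (?F u) \<partial>sphere_prob)"
    using integrable_sphere_prob[OF cont] by (rule integral_bounded_linear[OF bl, symmetric])
  also have "\<dots> = (\<integral>u. ?F (g u) \<partial>sphere_prob)"
    using lin by (simp add: linear_scale sup)
  also have "\<dots> = (\<integral>u. ?F u \<partial>distr sphere_prob borel g)"
    using gm Fm by (rule integral_distr[symmetric])
  also have "\<dots> = (\<integral>u. ?F u \<partial>sphere_prob)"
    by (simp only: distr_sphere_prob_orthogonal[OF g(1)])
  finally show ?thesis using lin by (simp add: steiner_point_def linear_scale)
qed

text \<open>A translation adds d times the integral of (u . v) u to the Steiner point. Pairing with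
  \<open>v\<close> leaves the integral of (u . v) squared, whose vanishing already forces v = 0,
  without evaluating second moments.\<close>

lemma steiner_point_translation_eq:
  fixes P :: "(real ^ 'n) set"
  assumes P: "bounded P" "P \<noteq> {}" and eq: "steiner_point ((+) v ` P) = steiner_point P"
  shows "v = 0"
proof -
  have c1: "continuous_on UNIV (\<lambda>u::real ^ 'n. (u \<bullet> v) *\<^sub>R u)" by (intro continuous_intros)
  have c2: "continuous_on UNIV (\<lambda>u. support_function P u *\<^sub>R u)"
    using continuous_on_support_function[OF P] by (intro continuous_intros)
  note i1 = integrable_sphere_prob[OF c1] and i2 = integrable_sphere_prob[OF c2]
  have "(\<integral>u. support_function ((+) v ` P) u *\<^sub>R u \<partial>sphere_prob)
      = (\<integral>u. (u \<bullet> v) *\<^sub>R u \<partial>sphere_prob) + (\<integral>u. support_function P u *\<^sub>R u \<partial>sphere_prob)"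
    unfolding support_function_translation[OF P] scaleR_add_left by (rule Bochner_Integration.integral_add[OF i1 i2])
  then have "(\<integral>u. (u \<bullet> v) *\<^sub>R u \<partial>sphere_prob) = 0"
    using eq by (simp add: steiner_point_def)
  then have "0 = v \<bullet> (\<integral>u. (u \<bullet> v) *\<^sub>R u \<partial>sphere_prob)" by simp
  also have "\<dots> = (\<integral>u. v \<bullet> ((u \<bullet> v) *\<^sub>R u) \<partial>sphere_prob)"
    using i1 by (intro integral_inner_right[symmetric])
  also have "\<dots> = (\<integral>u. (u \<bullet> v)\<^sup>2 \<partial>sphere_prob)"
    by (simp add: power2_eq_square inner_commute)
  finally have "(\<integral>u. (u \<bullet> v)\<^sup>2 \<partial>sphere_prob) = 0" by simp
  moreover have "integrable sphere_prob (\<lambda>u. (u \<bullet> v)\<^sup>2)"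
    by (intro integrable_sphere_prob continuous_intros)
  ultimately have "AE u in sphere_prob. (u \<bullet> v)\<^sup>2 = 0"
    using integral_nonneg_eq_0_iff_AE[of sphere_prob "\<lambda>u. (u \<bullet> v)\<^sup>2"] by simp
  then show ?thesis by (intro AE_sphere_prob_orthogonal_imp_zero) simp
qed

lemma wulff_orthogonal_invariant:
  fixes X :: "(real ^ 'n) set"
  assumes g: "orthogonal_transformation g" "g ` X = X"
  shows "g ` wulff X (\<lambda>_. \<eta>) = wulff X (\<lambda>_. \<eta>)"
proof -
  have pres: "g x \<bullet> g y = x \<bullet> y" for x y using g(1) by (auto simp: orthogonal_transformation_def)
  have mem: "g y \<in> wulff X (\<lambda>_. \<eta>) \<longleftrightarrow> y \<in> wulff X (\<lambda>_. \<eta>)" for y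
  proof -
    have "g y \<in> wulff X (\<lambda>_. \<eta>) \<longleftrightarrow> (\<forall>x\<in>g ` X. x \<bullet> g y \<le> \<eta>)" by (simp add: wulff_def g(2))
    then show ?thesis by (simp add: wulff_def pres)
  qed
  show ?thesis
  proof (intro equalityI subsetI)
    fix y assume "y \<in> wulff X (\<lambda>_. \<eta>)"
    moreover obtain z where "y = g z" using orthogonal_transformation_surj[OF g(1)] by (metis surjD)
    ultimately show "y \<in> g ` wulff X (\<lambda>_. \<eta>)" using mem by blast
  qed (use mem in blast)
qed

text \<open>A nonzero \<open>w\<close> would be a recession direction: all its nonnegative multiples
  satisfy the defining inequalities.\<close>

lemma bounded_wulff_direction:
  fixes w :: "'a::real_inner"
  assumes W: "bounded (wulff X (\<lambda>_. \<eta>))" and \<eta>: "0 \<le> \<eta>" and w: "\<And>x. x \<in> X \<Longrightarrow> x \<bullet> w \<le> 0"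
  shows "w = 0"
proof (rule ccontr)
  assume w0: "w \<noteq> 0"
  obtain B where B: "\<And>y. y \<in> wulff X (\<lambda>_. \<eta>) \<Longrightarrow> norm y \<le> B" "0 < B" using W by (auto simp: bounded_pos)
  have "((B + 1) / norm w) *\<^sub>R w \<in> wulff X (\<lambda>_. \<eta>)"
  proof -
    have "((B + 1) / norm w) * (x \<bullet> w) \<le> 0" if "x \<in> X" for x
      using w[OF that] B(2) by (intro mult_nonneg_nonpos) auto
    then show ?thesis using \<eta> by (fastforce simp: wulff_def)
  qed
  then have "norm (((B + 1) / norm w) *\<^sub>R w) \<le> B" by (rule B(1))
  then show False using w0 B(2) by simp
qed

text \<open>The Steiner point e is fixed by the group, so by transitivity x . e is the same for all
  normals x. According to its sign, - e or e would be a direction of unboundedness unless e =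
  0.\<close>

lemma steiner_point_wulff_transitive:
  fixes X :: "(real ^ 'n) set"
  assumes trans: "node_transitive X" and W: "bounded (wulff X (\<lambda>_. \<eta>))" and \<eta>: "0 \<le> \<eta>"
  shows "steiner_point (wulff X (\<lambda>_. \<eta>)) = 0"
proof -
  let ?W = "wulff X (\<lambda>_. \<eta>)"
  define e where "e = steiner_point ?W"
  have "0 \<in> ?W" using \<eta> by (simp add: wulff_def)
  then have ne: "?W \<noteq> {}" by blast
  obtain G where G: "subgroup G (orthogonal_group :: (real ^ 'n \<Rightarrow> real ^ 'n) monoid)" "\<And>g. g \<in> G \<Longrightarrow> g ` X = X"
      "\<And>x y. x \<in> X \<Longrightarrow> y \<in> X \<Longrightarrow> \<exists>g\<in>G. g x = y"
    using trans by (auto simp: node_transitive_def)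
  have orth: "orthogonal_transformation g" if "g \<in> G" for g
    using subgroup.subset[OF G(1)] that by (auto simp: orthogonal_group_def)
  have const: "x \<bullet> e = y \<bullet> e" if xy: "x \<in> X" "y \<in> X" for x y
  proof -
    obtain g where g: "g \<in> G" "g x = y" using G(3)[OF xy] by blast
    have "g e = e"
      unfolding e_def using g(1) G(2) orth by (intro steiner_point_orthogonal_invariant W ne wulff_orthogonal_invariant)
    then show ?thesis using orth[OF g(1)] g(2) by (metis orthogonal_transformation_def)
  qed
  show ?thesis
  proof (cases "\<exists>x\<in>X. x \<bullet> e > 0")
    case True
    then have "- e = 0"
      using const by (intro bounded_wulff_direction[OF W \<eta>]) (metis inner_minus_right less_imp_le neg_le_0_iff_le)
    then show ?thesis by (simp add: e_def)
  next
    case False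
    then have "e = 0" by (intro bounded_wulff_direction[OF W \<eta>]) (metis not_less)
    then show ?thesis by (simp add: e_def)
  qed
qed

section \<open>Polarity\<close>

lemma polar_body_convex_hull: "polar_body (convex hull X) = wulff X (\<lambda>_. 1)"
proof (intro equalityI subsetI)
  fix z assume "z \<in> polar_body (convex hull X)"
  then show "z \<in> wulff X (\<lambda>_. 1)"
    using hull_subset[of X convex] by (auto simp: polar_body_def wulff_def inner_commute)
next
  fix z assume "z \<in> wulff X (\<lambda>_. 1)"
  then have "X \<subseteq> {y. z \<bullet> y \<le> 1}" by (auto simp: wulff_def inner_commute)
  then have "convex hull X \<subseteq> {y. z \<bullet> y \<le> 1}" by (intro hull_minimal convex_halfspace_le)
  then show "z \<in> polar_body (convex hull X)" by (auto simp: polar_body_def)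
qed

lemma wulff_const_eq_scaled:
  assumes "0 < \<eta>"
  shows "wulff X (\<lambda>_. \<eta>) = (\<lambda>z. \<eta> *\<^sub>R z) ` wulff X (\<lambda>_. 1)"
proof (intro equalityI subsetI)
  fix y assume "y \<in> wulff X (\<lambda>_. \<eta>)"
  then have "inverse \<eta> *\<^sub>R y \<in> wulff X (\<lambda>_. 1)"
    using assms by (auto simp: wulff_def field_simps)
  then show "y \<in> (\<lambda>z. \<eta> *\<^sub>R z) ` wulff X (\<lambda>_. 1)"
    using assms by (intro image_eqI[of _ _ "inverse \<eta> *\<^sub>R y"]) auto
qed (use assms in \<open>auto simp: wulff_def mult_left_le\<close>)

text \<open>The bipolar theorem for \<open>convex hull X\<close>, by separation. It needs 0 in the
  hull, and boundedness of the Wulff shape provides this: a hyperplane separating 0 from the hull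
  would give a recession direction.\<close>

lemma polar_body_wulff:
  fixes X :: "(real ^ 'n) set"
  assumes X: "finite X" and W: "bounded (wulff X (\<lambda>_. \<eta>))" and \<eta>: "0 < \<eta>"
  shows "polar_body (wulff X (\<lambda>_. \<eta>)) = (\<lambda>z. inverse \<eta> *\<^sub>R z) ` (convex hull X)"
proof (intro equalityI subsetI)
  let ?C = "convex hull X"
  have C: "closed ?C" "convex ?C"
    using X by (auto intro: compact_imp_closed finite_imp_compact_convex_hull)
  have zero: "0 \<in> ?C"
  proof (rule ccontr)
    assume "0 \<notin> ?C"
    then obtain a b where ab: "a \<bullet> 0 < b" "\<And>c. c \<in> ?C \<Longrightarrow> b < a \<bullet> c"
      using separating_hyperplane_closed_point[OF C(2,1)] by blast
    have "x \<bullet> (- a) \<le> 0" if "x \<in> X" for x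
      using ab(1) ab(2)[OF hull_inc[OF that]] by (simp add: inner_commute)
    then have "- a = 0" using \<eta> by (intro bounded_wulff_direction[OF W, of "- a"]) auto
    moreover obtain x where "x \<in> X"
    proof -
      have "X \<noteq> {}" using W by (auto simp: wulff_def)
      then show ?thesis using that by blast
    qed
    ultimately show False using ab(1) ab(2)[OF hull_inc] by force
  qed
  fix z
  show "z \<in> (\<lambda>z. inverse \<eta> *\<^sub>R z) ` ?C" if z: "z \<in> polar_body (wulff X (\<lambda>_. \<eta>))"
  proof -
    have "\<eta> *\<^sub>R z \<in> ?C"
    proof (rule ccontr)
      assume "\<eta> *\<^sub>R z \<notin> ?C"
      then obtain a b where ab: "a \<bullet> (\<eta> *\<^sub>R z) < b" "\<And>c. c \<in> ?C \<Longrightarrow> b < a \<bullet> c"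
        using separating_hyperplane_closed_point[OF C(2,1)] by blast
      have b: "b < 0" using ab(2)[OF zero] by simp
      \<comment> \<open>As b is negative, rescaling reverses the separation: this multiple of the
        normal lies in the Wulff shape, but its inner product with z exceeds 1.\<close>
      have "(\<eta> / b) *\<^sub>R a \<in> wulff X (\<lambda>_. \<eta>)"
      proof -
        have "x \<bullet> ((\<eta> / b) *\<^sub>R a) \<le> \<eta>" if "x \<in> X" for x
        proof -
          have "(\<eta> / b) * (a \<bullet> x) \<le> (\<eta> / b) * b"
            using ab(2)[OF hull_inc[OF that]] b \<eta> by (intro mult_left_mono_neg) (auto simp: divide_nonneg_neg)
          then show ?thesis using b by (simp add: inner_commute)
        qed
        then show ?thesis by (simp add: wulff_def)
      qed
      then have "z \<bullet> ((\<eta> / b) *\<^sub>R a) \<le> 1" using z unfolding polar_body_def by blast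
      then have "(a \<bullet> (\<eta> *\<^sub>R z)) / b \<le> 1" by (simp add: inner_commute)
      then show False using ab(1) b by (simp add: divide_le_eq)
    qed
    then show ?thesis using \<eta> by (intro image_eqI[of _ _ "\<eta> *\<^sub>R z"]) auto
  qed
  show "z \<in> polar_body (wulff X (\<lambda>_. \<eta>))" if z: "z \<in> (\<lambda>z. inverse \<eta> *\<^sub>R z) ` ?C"
  proof -
    obtain c where c: "c \<in> ?C" "z = inverse \<eta> *\<^sub>R c" using z by blast
    have "z \<bullet> y \<le> 1" if "y \<in> wulff X (\<lambda>_. \<eta>)" for y
    proof -
      have "X \<subseteq> {c. y \<bullet> c \<le> \<eta>}" using that by (auto simp: wulff_def inner_commute)
      then have "?C \<subseteq> {c. y \<bullet> c \<le> \<eta>}" by (intro hull_minimal convex_halfspace_le)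
      then show ?thesis using c \<eta> by (auto simp: inner_commute field_simps)
    qed
    then show ?thesis by (simp add: polar_body_def)
  qed
qed

text \<open>Self-polarity becomes similarity of a body to its polar. As this relation is symmetric
  and transitive, it can be transported between \<open>P\<close> and
  \<open>convex hull X\<close>.\<close>

definition similar_sets :: "(real ^ 'n) set \<Rightarrow> (real ^ 'n) set \<Rightarrow> bool" where
  "similar_sets S T \<longleftrightarrow> (\<exists>c U. c > 0 \<and> orthogonal_transformation U \<and> S = (\<lambda>y. c *\<^sub>R U y) ` T)"

lemma similar_sets_scale: "0 < c \<Longrightarrow> similar_sets ((\<lambda>y. c *\<^sub>R y) ` T) T"
  unfolding similar_sets_def by (intro exI[of _ c] exI[of _ "\<lambda>y. y"]) (simp add: orthogonal_transformation_id)

lemma similar_sets_sym: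
  assumes "similar_sets S T"
  shows "similar_sets T S"
proof -
  obtain c U where cU: "c > 0" "orthogonal_transformation U" "S = (\<lambda>y. c *\<^sub>R U y) ` T"
    using assms by (auto simp: similar_sets_def)
  have inv: "inv_into UNIV U (c *\<^sub>R U y) = c *\<^sub>R y" for y
    using cU(2) by (metis inv_f_f linear_scale orthogonal_transformation_inj orthogonal_transformation_linear)
  have "T = (\<lambda>y. inverse c *\<^sub>R inv_into UNIV U y) ` S"
    unfolding cU(3) using cU(1) by (simp add: image_image inv)
  then show ?thesis
    unfolding similar_sets_def using cU(1,2) orthogonal_transformation_inv positive_imp_inverse_positive by blast
qed

lemma similar_sets_trans:
  assumes "similar_sets R S" "similar_sets S T"
  shows "similar_sets R T"
proof -
  obtain c U where cU: "c > 0" "orthogonal_transformation U" "R = (\<lambda>y. c *\<^sub>R U y) ` S"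
    using assms by (auto simp: similar_sets_def)
  obtain e V where eV: "e > 0" "orthogonal_transformation V" "S = (\<lambda>y. e *\<^sub>R V y) ` T"
    using assms by (auto simp: similar_sets_def)
  have "R = (\<lambda>y. (c * e) *\<^sub>R (U \<circ> V) y) ` T"
    unfolding cU(3) eV(3) using orthogonal_transformation_linear[OF cU(2)]
    by (simp add: image_image linear_scale)
  then show ?thesis
    unfolding similar_sets_def using cU(1,2) eV(1,2) orthogonal_transformation_compose mult_pos_pos by blast
qed

lemma self_polar_iff_similar:
  "compact P \<Longrightarrow> convex P \<Longrightarrow> 0 \<in> interior P \<Longrightarrow> self_polar_up_to_similarity P \<longleftrightarrow> similar_sets (polar_body P) P"
  by (simp add: self_polar_up_to_similarity_def similar_sets_def)

theorem proposition5p2: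
  fixes X P :: "(real ^ 'n) set" and t :: nat
  assumes "CARD('n) \<ge> 2"
    and "t \<ge> 2"
    and "spherical_design t X"
    and "node_transitive X"
    and "minkowski_polytope X P"
    and "steiner_point P = 0"
  shows "\<exists>h > 0.
           (\<forall>x\<in>X. support_function P x = h) \<and>
           P = (\<lambda>z. h *\<^sub>R z) ` polar_body (convex hull X) \<and>
           polar_body P = (\<lambda>z. inverse h *\<^sub>R z) ` (convex hull X) \<and>
           (self_polar_up_to_similarity P \<longleftrightarrow> self_polar_up_to_similarity (convex hull X))"
proof -
  let ?C = "convex hull X"
  have X: "finite X" "X \<subseteq> sphere 0 1" using assms(3) by (auto simp: spherical_design_def)
  obtain h v where h: "0 < h" and P: "P = (+) v ` wulff X (\<lambda>_. h)"
    using minkowski_polytope_homothetic[OF X assms(4,5)] .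
  let ?W = "wulff X (\<lambda>_. h)"
  have cP: "compact P" using assms(5) by (auto simp: minkowski_polytope_def polytope_imp_compact)
  have W_P: "?W = (+) (- v) ` P" unfolding P by (simp add: image_image)
  have cW: "compact ?W" unfolding W_P by (rule compact_translation[OF cP])
  then have bW: "bounded ?W" by (rule compact_imp_bounded)
  have zero: "0 \<in> ?W" using h by (simp add: wulff_def)
  have "steiner_point ?W = 0"
    using assms(4) bW h by (intro steiner_point_wulff_transitive) auto
  then have "v = 0"
    using steiner_point_translation_eq[OF bW, of v] zero assms(6) P by auto
  then have PW: "P = ?W" by (simp add: P)
  have unit: "norm x = 1" if "x \<in> X" for x using X that by auto
  have supp: "support_function P x = h" if x: "x \<in> X" for x
  proof (rule antisym)
    show "support_function P x \<le> h"
    proof (rule support_function_le)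
      show "P \<noteq> {}" using zero PW by blast
      show "x \<bullet> y \<le> h" if "y \<in> P" for y using that x by (simp add: PW wulff_def)
    qed
    \<comment> \<open>The inequality with normal x is tight at h times x itself: this point belongs
      to \<open>P\<close> since inner products of unit vectors are at most 1.\<close>
    have "y \<bullet> (h *\<^sub>R x) \<le> h" if "y \<in> X" for y
      using norm_cauchy_schwarz[of y x] unit[OF that] unit[OF x] h by (simp add: mult_left_le)
    then have "h *\<^sub>R x \<in> P" by (simp add: PW wulff_def)
    then have "x \<bullet> (h *\<^sub>R x) \<le> support_function P x"
      using cP by (intro inner_le_support_function compact_imp_bounded)
    then show "h \<le> support_function P x" using unit[OF x] by (simp add: norm_eq_1)
  qed
  have P_polar: "P = (\<lambda>z. h *\<^sub>R z) ` polar_body ?C"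
    unfolding PW polar_body_convex_hull by (rule wulff_const_eq_scaled[OF h])
  have polar_P: "polar_body P = (\<lambda>z. inverse h *\<^sub>R z) ` ?C"
    unfolding PW by (rule polar_body_wulff[OF X(1) bW h])
  have C_eq: "?C = (\<lambda>z. h *\<^sub>R z) ` polar_body P"
    unfolding polar_P using h by (simp add: image_image)
  have "0 \<in> interior P"
  proof -
    have "ball 0 h \<subseteq> P"
    proof
      fix y :: "real ^ 'n" assume y: "y \<in> ball 0 h"
      have "x \<bullet> y \<le> h" if "x \<in> X" for x
        using norm_cauchy_schwarz[of x y] unit[OF that] y by simp
      then show "y \<in> P" by (simp add: PW wulff_def)
    qed
    then show ?thesis using h by (auto simp: mem_interior)
  qed
  moreover have "convex P" using assms(5) by (auto simp: minkowski_polytope_def polytope_imp_convex)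
  ultimately have sP: "self_polar_up_to_similarity P \<longleftrightarrow> similar_sets (polar_body P) P"
    using cP by (intro self_polar_iff_similar)
  have "0 \<in> interior ?C"
  proof -
    obtain R where R: "0 < R" "\<And>y. y \<in> P \<Longrightarrow> norm y \<le> R"
      using compact_imp_bounded[OF cP] by (auto simp: bounded_pos)
    \<comment> \<open>Since \<open>P\<close> has norm bound R, its polar contains vectors of norm
      below 1 / R, and the hull is h times that polar.\<close>
    have "ball 0 (h / R) \<subseteq> ?C"
    proof
      fix c :: "real ^ 'n" assume c: "c \<in> ball 0 (h / R)"
      have "inverse h *\<^sub>R c \<in> polar_body P"
      proof -
        have "(inverse h *\<^sub>R c) \<bullet> y \<le> 1" if y: "y \<in> P" for y
        proof -
          have "c \<bullet> y \<le> norm c * norm y" by (rule norm_cauchy_schwarz)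
          also have "\<dots> \<le> (h / R) * R" using c R y h by (intro mult_mono) auto
          finally show ?thesis using h R by (simp add: field_simps)
        qed
        then show ?thesis by (simp add: polar_body_def)
      qed
      then have "h *\<^sub>R (inverse h *\<^sub>R c) \<in> ?C" unfolding C_eq by blast
      then show "c \<in> ?C" using h by simp
    qed
    then show ?thesis using h R by (auto simp: mem_interior intro!: exI[of _ "h / R"])
  qed
  then have sC: "self_polar_up_to_similarity ?C \<longleftrightarrow> similar_sets (polar_body ?C) ?C"
    using X(1) by (intro self_polar_iff_similar finite_imp_compact_convex_hull convex_convex_hull)
  have s1: "similar_sets (polar_body P) ?C"
    unfolding polar_P using h by (intro similar_sets_scale) simp
  have s2: "similar_sets P (polar_body ?C)"
    by (subst P_polar) (rule similar_sets_scale[OF h])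
  \<comment> \<open>Polarity swaps the two bodies: the polar of \<open>P\<close> is similar to the
    hull, while \<open>P\<close> is similar to the polar of the hull, so the equivalence also uses
    symmetry.\<close>
  have "similar_sets (polar_body P) P \<longleftrightarrow> similar_sets (polar_body ?C) ?C"
    using s1 s2 similar_sets_sym similar_sets_trans by meson
  then show ?thesis
    using h supp P_polar polar_P sP sC by (intro exI[of _ h]) auto
qed

end
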